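(* Let $Y$ be a del Pezzo surface of degree $5$ over $\mathbb{C}$, anticanonically embedded in $\mathbb{P}^5$. (a) The geometrical pentagons contained in $Y$ are exactly $12$. They are given by the divisors of zeros of the $12$ sections $s_{ij},\sigma_{ij}$ ($1\le i\ne j\le 3$) of $\mathcal{O}_Y(-K_Y)$. (b) There is a bijection between the set of such geometrical pentagons and the set of (unoriented) nondegenerate combinatorial pentagons on $\{1,2,3,4,5\}$. This bijection associates to the combinatorial pentagon $[i\mapsto p(i)]$ the geometrical pentagon $$E_{p(1)p(2)}+E_{p(2)p(3)}+E_{p(3)p(4)}+E_{p(4)p(5)}+E_{p(5)p(1)}.$$ (c) There is a bijection between the set of the $6$ quadrics $\{Q_{ij}\}$ and the set of double combinatorial pentagons on $\{1,2,3,4,5\}$. (d) The subset $\mathcal{M}=\{\pm s_{ij},\pm\sigma_{ij}\}$ of $V$ is an orbit for the action of $\mathfrak{S}_5$ on $V$, and the stabilizer of $s_{21}$ is the cyclic subgroup generated by $(1,2,3,4,5)$. In particular $\mathfrak{S}_4$ acts simply transitively on $\mathcal{M}$.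
   Context: $Y$ is the blow-up of $\mathbb{P}^2$ at $p_1=(1:0:0)$, $p_2=(0:1:0)$, $p_3=(0:0:1)$, $p_4=(1:1:1)$. $Y$ contains exactly ten lines $E_{i,j}=E_{j,i}$ ($1\le i<j\le5$): $E_{i,5}$ is the exceptional curve over $p_i$, and for $\{i,j,h,k\}=\{1,2,3,4\}$, $E_{h,k}$ is the strict transform of the line through $p_i,p_j$. $V=H^0(Y,\mathcal{O}_Y(-K_Y))$ is identified with the 6-dimensional space of cubic forms in $x_1,x_2,x_3$ vanishing at $p_1,\dots,p_4$ via $P\mapsto P\,(dx_1\wedge dx_2\wedge dx_3)^{-1}$. For $\{i,j,k\}=\{1,2,3\}$, $s_{ij}=x_ix_j(x_j-x_k)$ (a basis of $V$), $\sigma_{ij}=\eta\,(s_{ik}-s_{ki}-s_{jk})$ with $\eta$ the sign of the permutation $1\mapsto i,2\mapsto j,3\mapsto k$, and $Q_{ij}=s_{ij}\sigma_{ij}\in\operatorname{Sym}^2(V)$. $\operatorname{Aut}(Y)\cong\mathfrak{S}_5$ (with $\tau(E_{i,j})=E_{\tau(i),\tau(j)}$), and the induced linear action on $V$ is generated by: $\tau\in\mathfrak{S}_3$: $s_{ij}\mapsto\operatorname{sgn}(\tau)s_{\tau(i)\tau(j)}$; $(3,4)$: $s_{12}\mapsto\sigma_{31}$, $s_{13}\mapsto s_{23}$, $s_{21}\mapsto-\sigma_{32}$, $s_{23}\mapsto s_{13}$, $s_{31}\mapsto-\sigma_{12}$, $s_{32}\mapsto\sigma_{21}$; $(4,5)$: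 $s_{ij}\mapsto s_{ik}$ for $\{i,j,k\}=\{1,2,3\}$. $\mathfrak{S}_4\le\mathfrak{S}_5$ is the stabilizer of $5$. A nondegenerate (unoriented) combinatorial pentagon on a set $S$ is a class of injective maps $p:\mathbb{Z}/5\to S$ modulo $p(i)\sim p(\pm i+a)$, $a\in\mathbb{Z}/5$. The neighbouring pentagon of $p(i)$ is the class of $i\mapsto p(2i)$. A double combinatorial pentagon is an unordered pair of two neighbouring nondegenerate unoriented pentagons. A geometrical pentagon in $\mathbb{P}^5$ is a union of five distinct lines $L_i$ ($i\in\mathbb{Z}/5$) for which there are points $p(i)$, $i\in\mathbb{Z}/5$, such that $L_i$ is the line joining $p(i)$ and $p(i+1)$; it is viewed as the reduced divisor $\sum_i L_i$ when contained in $Y$. *)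

theory Defs
  imports
    "HOL-Analysis.Analysis"
    "HOL-Computational_Algebra.Polynomial"
    "HOL-Algebra.Sym_Groups"
    "HOL-Algebra.Group_Action"
begin

section \<open>Complex projective space\<close>

text \<open>Points of the projective space of \<open>complex ^ 'n\<close> are one-dimensional linear subspaces;
  \<open>vec.span\<close>, \<open>vec.subspace\<close>, \<open>vec.dim\<close> refer to the complex vector space structure.\<close>

definition proj_space :: "(complex ^ 'n) set set" where
  "proj_space = {x. vec.subspace x \<and> vec.dim x = 1}"

definition line_joining ::
  "(complex ^ 'n) set \<Rightarrow> (complex ^ 'n) set \<Rightarrow> (complex ^ 'n) set set" where
  "line_joining x y = {z \<in> proj_space. z \<subseteq> vec.span (x \<union> y)}"

inductive homogeneous_poly :: "nat \<Rightarrow> (complex ^ 'n \<Rightarrow> complex) \<Rightarrow> bool" where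
  const: "homogeneous_poly 0 (\<lambda>_. c)"
| coord: "homogeneous_poly 1 (\<lambda>x. x $ i)"
| add: "homogeneous_poly d f \<Longrightarrow> homogeneous_poly d g \<Longrightarrow> homogeneous_poly d (\<lambda>x. f x + g x)"
| mult: "homogeneous_poly d f \<Longrightarrow> homogeneous_poly e g \<Longrightarrow>
    homogeneous_poly (d + e) (\<lambda>x. f x * g x)"

definition zariski_closed :: "(complex ^ 'n) set set \<Rightarrow> bool" where
  "zariski_closed X \<longleftrightarrow> (\<exists>F. (\<forall>f\<in>F. \<exists>d. homogeneous_poly d f) \<and>
     X = {x \<in> proj_space. \<forall>f\<in>F. \<forall>v\<in>x. f v = 0})"

definition zariski_closure :: "(complex ^ 'n) set set \<Rightarrow> (complex ^ 'n) set set" where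
  "zariski_closure A = \<Inter> {X. zariski_closed X \<and> A \<subseteq> X}"

definition irreducible_closed :: "(complex ^ 'n) set set \<Rightarrow> bool" where
  "irreducible_closed C \<longleftrightarrow> zariski_closed C \<and> C \<noteq> {} \<and>
     (\<forall>A B. zariski_closed A \<and> zariski_closed B \<and> C = A \<union> B \<longrightarrow> C = A \<or> C = B)"

text \<open>Krull dimension one: there is a chain point \<open>\<subset>\<close> C, and no longer one.\<close>

definition irreducible_curve :: "(complex ^ 'n) set set \<Rightarrow> bool" where
  "irreducible_curve C \<longleftrightarrow> irreducible_closed C \<and> (\<forall>x. C \<noteq> {x}) \<and>
     (\<forall>D. irreducible_closed D \<and> D \<subset> C \<longrightarrow> (\<exists>x. D = {x}))"


section \<open>The blow-up of the plane at four points\<close>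

definition pt :: "nat \<Rightarrow> complex ^ 3" where
  "pt i = (if i = 1 then vector [1, 0, 0] else if i = 2 then vector [0, 1, 0]
           else if i = 3 then vector [0, 0, 1] else vector [1, 1, 1])"

definition centres :: "(complex ^ 3) set set" where
  "centres = {vec.span {pt i} | i. i \<in> {1..4}}"

text \<open>A line of the plane is a two-dimensional subspace of \<open>complex ^ 3\<close>. The blow-up at a point
  \<open>p\<close> is the incidence variety of pairs (point \<open>x\<close>, line through \<open>p\<close> and \<open>x\<close>); the blow-up at
  the four distinct points is the fibre product over the plane of the four single blow-ups.\<close>

definition pencil :: "complex ^ 3 \<Rightarrow> (complex ^ 3) set set" where
  "pencil q = {l. vec.subspace l \<and> vec.dim l = 2 \<and> q \<in> l}"

type_synonym blowup_point = "(complex ^ 3) set \<times> (nat \<Rightarrow> (complex ^ 3) set)"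

definition blowup :: "blowup_point set" where
  "blowup = {(x, l). x \<in> proj_space \<and> l \<in> (\<Pi>\<^sub>E i\<in>{1..4}. pencil (pt i)) \<and> (\<forall>i\<in>{1..4}. x \<subseteq> l i)}"


section \<open>Anticanonical sections\<close>

type_synonym form = "complex ^ 3 \<Rightarrow> complex"

definition V_forms :: "form set" where
  "V_forms = {P. homogeneous_poly 3 P \<and> (\<forall>i\<in>{1..4}. P (pt i) = 0)}"

definition index_pairs :: "(nat \<times> nat) set" where
  "index_pairs = {(i, j). i \<in> {1..3} \<and> j \<in> {1..3} \<and> i \<noteq> j}"

text \<open>For \<open>{i, j, k} = {1, 2, 3}\<close> the third index is \<open>k = 6 - i - j\<close>. In the numeral type \<open>3\<close>
  the coordinates \<open>1\<close>, \<open>2\<close>, \<open>3\<close> are \<open>of_nat 1\<close>, \<open>of_nat 2\<close>, \<open>of_nat 3\<close>.\<close>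

definition s_form :: "nat \<Rightarrow> nat \<Rightarrow> form" where
  "s_form i j = (\<lambda>x. x $ of_nat i * x $ of_nat j * (x $ of_nat j - x $ of_nat (6 - i - j)))"

definition perm3 :: "nat \<Rightarrow> nat \<Rightarrow> nat \<Rightarrow> nat \<Rightarrow> nat" where
  "perm3 i j k = (\<lambda>n. if n = 1 then i else if n = 2 then j else if n = 3 then k else n)"

definition sigma_form :: "nat \<Rightarrow> nat \<Rightarrow> form" where
  "sigma_form i j = (let k = 6 - i - j in
     (\<lambda>x. of_int (sign (perm3 i j k)) * (s_form i k x - s_form k i x - s_form j k x)))"

definition sections :: "form set" where
  "sections = {s_form i j | i j. (i, j) \<in> index_pairs} \<union> {sigma_form i j | i j. (i, j) \<in> index_pairs}"

text \<open>Local parametrizations of the blow-up, with parameters \<open>(u, t)\<close> sending \<open>(0, 0)\<close> to the given point \<open>(x, l)\<close>: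
  if \<open>x\<close> is not a centre, \<open>(u, t) \<mapsto> [v + u a + t b]\<close>; if \<open>x = [p\<^sub>i]\<close>, so that the point is the
  tangent direction \<open>l i = span {p\<^sub>i, a}\<close> on the exceptional curve, the usual blow-up chart
  \<open>(u, t) \<mapsto> [v + u (a + t b)]\<close> with exceptional curve \<open>u = 0\<close>.\<close>

definition charts :: "blowup_point \<Rightarrow> ((complex ^ 3) \<times> (complex ^ 3) \<times> (complex ^ 3)) set" where
  "charts y = {(v, a, b). vec.span {v, a, b} = UNIV \<and> fst y = vec.span {v} \<and>
     (\<forall>i\<in>{1..4}. fst y = vec.span {pt i} \<longrightarrow> snd y i = vec.span {v, a})}"

text \<open>Local expression in a chart of the section \<open>P (dx\<^sub>1 \<and> dx\<^sub>2 \<and> dx\<^sub>3)\<^sup>-\<^sup>1\<close> of the anticanonical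
  sheaf, with respect to the generator \<open>(du \<and> dt)\<^sup>-\<^sup>1\<close> and up to a nonzero constant. In a blow-up
  chart the affine coordinates of the plane are \<open>u\<close> and \<open>u t\<close>, and \<open>du \<and> d(u t) = u du \<and> dt\<close>,
  whence the division by \<open>u\<close>; it is exact because \<open>P\<close> vanishes at the centre. Elements of
  \<open>complex poly poly\<close> are polynomials in \<open>u, t\<close>, with \<open>coeff (coeff F m) n\<close> the coefficient of
  \<open>u\<^sup>m t\<^sup>n\<close>.\<close>

definition local_expr ::
  "blowup_point \<Rightarrow> (complex ^ 3) \<times> (complex ^ 3) \<times> (complex ^ 3) \<Rightarrow> form \<Rightarrow> complex poly poly" where
  "local_expr y c P = (case c of (v, a, b) \<Rightarrow> (THE F. \<forall>u t.
     if fst y \<in> centres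
     then u * poly (poly F [:u:]) t = P (v + u *s (a + t *s b))
     else poly (poly F [:u:]) t = P (v + u *s a + t *s b)))"

definition vanishes_to_order :: "nat \<Rightarrow> form \<Rightarrow> blowup_point \<Rightarrow> bool" where
  "vanishes_to_order k P y \<longleftrightarrow>
     (\<forall>c\<in>charts y. \<forall>m n. m + n < k \<longrightarrow> coeff (coeff (local_expr y c P) m) n = 0)"


section \<open>The anticanonical embedding\<close>

text \<open>The ambient projective 5-space is the one of the dual of \<open>V_forms\<close>, with coordinates given by the
  basis \<open>s\<^sub>i\<^sub>j\<close> of \<open>V_forms\<close>.\<close>

definition s_basis :: "6 \<Rightarrow> form" where
  "s_basis m = (if m = 1 then s_form 1 2 else if m = 2 then s_form 1 3 else if m = 3 then s_form 2 1
                else if m = 4 then s_form 2 3 else if m = 5 then s_form 3 1 else s_form 3 2)"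

text \<open>Values at a point of the blow-up of the six basis sections, in one common chart; changing the
  chart multiplies all of them by the same nonzero constant.\<close>

definition anticanonical :: "blowup_point \<Rightarrow> (complex ^ 6) set" where
  "anticanonical y = (let c = (SOME c. c \<in> charts y) in
     vec.span {\<chi> m. coeff (coeff (local_expr y c (s_basis m)) 0) 0})"

definition dP5 :: "(complex ^ 6) set set" where
  "dP5 = anticanonical ` blowup"

definition exceptional_curve :: "nat \<Rightarrow> (complex ^ 6) set set" where
  "exceptional_curve i = anticanonical ` {y \<in> blowup. fst y = vec.span {pt i}}"

definition strict_transform :: "(complex ^ 3) set \<Rightarrow> (complex ^ 6) set set" where
  "strict_transform l =
     zariski_closure (anticanonical ` {y \<in> blowup. fst y \<subseteq> l \<and> fst y \<notin> centres})"

text \<open>For \<open>h, k \<le> 4\<close>, the curve \<open>E_line h k\<close> comes from the line through the two points whose indices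
  are different from \<open>h\<close> and \<open>k\<close>.\<close>

definition E_line :: "nat \<Rightarrow> nat \<Rightarrow> (complex ^ 6) set set" where
  "E_line h k = (if k = 5 then exceptional_curve h else if h = 5 then exceptional_curve k
            else strict_transform (vec.span (pt ` ({1..4} - {h, k}))))"


section \<open>Divisors\<close>

text \<open>Divisors on \<open>dP5\<close> are written as integer-valued functions on the sets of points, the value at an
  irreducible curve being its coefficient.\<close>

type_synonym divisor = "(complex ^ 6) set set \<Rightarrow> int"

definition prime_divisor :: "(complex ^ 6) set set \<Rightarrow> divisor" where
  "prime_divisor C = (\<lambda>D. if D = C then 1 else 0)"

definition reduced_divisor :: "(complex ^ 6) set set \<Rightarrow> divisor" where
  "reduced_divisor S = (\<lambda>C. if irreducible_curve C \<and> C \<subseteq> S then 1 else 0)"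

text \<open>\<open>dP5\<close> being smooth, the order of a nonzero section along a curve is the smallest order
  of vanishing at the points of the curve.\<close>

definition order_along :: "form \<Rightarrow> (complex ^ 6) set set \<Rightarrow> nat" where
  "order_along P C =
     (GREATEST k. \<forall>y\<in>blowup. anticanonical y \<in> C \<longrightarrow> vanishes_to_order k P y)"

definition divisor_of_zeros :: "form \<Rightarrow> divisor" where
  "divisor_of_zeros P =
     (\<lambda>C. if irreducible_curve C \<and> C \<subseteq> dP5 then int (order_along P C) else 0)"


section \<open>Pentagons\<close>

definition geometrical_pentagon :: "(complex ^ 6) set set \<Rightarrow> bool" where
  "geometrical_pentagon S \<longleftrightarrow> (\<exists>(L :: 5 \<Rightarrow> (complex ^ 6) set set) (q :: 5 \<Rightarrow> (complex ^ 6) set).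
     inj L \<and> (\<forall>i. q i \<in> proj_space \<and> q i \<noteq> q (i + 1) \<and> L i = line_joining (q i) (q (i + 1))) \<and>
     S = (\<Union>i. L i))"

definition geometrical_pentagons_in_dP5 :: "(complex ^ 6) set set set" where
  "geometrical_pentagons_in_dP5 = {S. geometrical_pentagon S \<and> S \<subseteq> dP5}"

definition pentagon_class :: "(5 \<Rightarrow> 'a) \<Rightarrow> (5 \<Rightarrow> 'a) set" where
  "pentagon_class p = {\<lambda>i. p (e * i + a) | e a. e = 1 \<or> e = - 1}"

definition combinatorial_pentagons :: "'a set \<Rightarrow> (5 \<Rightarrow> 'a) set set" where
  "combinatorial_pentagons S = {pentagon_class p | p. inj p \<and> range p \<subseteq> S}"

definition neighbouring :: "(5 \<Rightarrow> 'a) set \<Rightarrow> (5 \<Rightarrow> 'a) set \<Rightarrow> bool" where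
  "neighbouring A B \<longleftrightarrow> (\<exists>p. A = pentagon_class p \<and> B = pentagon_class (\<lambda>i. p (2 * i)))"

definition double_pentagons :: "'a set \<Rightarrow> (5 \<Rightarrow> 'a) set set set" where
  "double_pentagons S = {{A, B} | A B.
     A \<in> combinatorial_pentagons S \<and> B \<in> combinatorial_pentagons S \<and> neighbouring A B}"


section \<open>Quadrics\<close>

text \<open>\<open>linear_form P\<close> is the element \<open>P\<close> of \<open>V_forms\<close> as a linear form on the dual space, and the
  symmetric square of \<open>V_forms\<close> is the space of quadratic forms on the dual space.\<close>

definition coords :: "form \<Rightarrow> complex ^ 6" where
  "coords P = (THE c. P = (\<lambda>x. \<Sum>m\<in>UNIV. c $ m * s_basis m x))"

definition linear_form :: "form \<Rightarrow> complex ^ 6 \<Rightarrow> complex" where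
  "linear_form P = (\<lambda>w. \<Sum>m\<in>UNIV. coords P $ m * w $ m)"

definition quadric :: "nat \<Rightarrow> nat \<Rightarrow> complex ^ 6 \<Rightarrow> complex" where
  "quadric i j = (\<lambda>w. linear_form (s_form i j) w * linear_form (sigma_form i j) w)"

definition quadrics :: "(complex ^ 6 \<Rightarrow> complex) set" where
  "quadrics = {quadric i j | i j. (i, j) \<in> index_pairs}"


section \<open>The action of the symmetric group\<close>

text \<open>A linear action of the symmetric group on \<open>{1..5}\<close> with the prescribed values on generators.
  On \<open>{1..5}\<close> it is determined by these conditions, as the generators generate the group and the
  \<open>s\<^sub>i\<^sub>j\<close> are a basis of \<open>V_forms\<close>.\<close>

definition S5_action :: "((nat \<Rightarrow> nat) \<Rightarrow> form \<Rightarrow> form) \<Rightarrow> bool" where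
  "S5_action \<rho> \<longleftrightarrow>
     group_action (sym_group 5) V_forms \<rho> \<and>
     (\<forall>\<tau>\<in>carrier (sym_group 5). \<forall>P\<in>V_forms. \<forall>P'\<in>V_forms. \<forall>a b.
        \<rho> \<tau> (\<lambda>x. a * P x + b * P' x) = (\<lambda>x. a * \<rho> \<tau> P x + b * \<rho> \<tau> P' x)) \<and>
     (\<forall>\<tau>. \<tau> permutes {1..3} \<longrightarrow> (\<forall>(i, j)\<in>index_pairs.
        \<rho> \<tau> (s_form i j) = (\<lambda>x. of_int (sign \<tau>) * s_form (\<tau> i) (\<tau> j) x))) \<and>
     \<rho> (Transposition.transpose 3 4) (s_form 1 2) = sigma_form 3 1 \<and>
     \<rho> (Transposition.transpose 3 4) (s_form 1 3) = s_form 2 3 \<and>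
     \<rho> (Transposition.transpose 3 4) (s_form 2 1) = - sigma_form 3 2 \<and>
     \<rho> (Transposition.transpose 3 4) (s_form 2 3) = s_form 1 3 \<and>
     \<rho> (Transposition.transpose 3 4) (s_form 3 1) = - sigma_form 1 2 \<and>
     \<rho> (Transposition.transpose 3 4) (s_form 3 2) = sigma_form 2 1 \<and>
     (\<forall>(i, j)\<in>index_pairs. \<rho> (Transposition.transpose 4 5) (s_form i j) = s_form i (6 - i - j))"

definition signed_sections :: "form set" where
  "signed_sections = sections \<union> uminus ` sections"

end

theory Submission
  imports Defs
begin

text \<open>Each of the sections \<open>s\<^sub>i\<^sub>j\<close>, \<open>\<sigma>\<^sub>i\<^sub>j\<close> is a product of three of the six linear forms that vanish on
  the lines through two of the four points. Its zeros on the surface therefore form a pentagon of five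
  of the ten lines \<open>E\<^sub>h\<^sub>k\<close>, each of multiplicity one. Any two of the ten lines lie in a common pentagon.
  If no section vanished identically on some line \<open>L\<close> of the surface, the zero on \<open>L\<close> of any section
  would lie on one of the ten lines, hence the zeros on \<open>L\<close> of any two sections would be zeros of a
  third one and coincide; but the sections have no common zero. So the ten lines are the only ones on
  the surface. As \<open>E\<^sub>h\<^sub>k\<close> and \<open>E\<^sub>m\<^sub>n\<close> meet if and only if \<open>{h, k}\<close> and \<open>{m, n}\<close> are disjoint, the geometrical
  pentagons are the 5-cycles of the Petersen graph, which are the pentagons on \<open>{1..5}\<close>.

  For the action, the space of sections is identified with the antisymmetric 5 by 5 matrices with zero row
  sums, on which a permutation acts by permuting the indices and multiplying by its sign. The
  sections up to sign become the 24 regular tournaments on five vertices. Since the rotations and the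
  reflections of a pentagon are squares of permutations, hence even, the signed action is transitive
  on them and the stabilizers are the groups of rotations.\<close>

text \<open>No intersection theory enters. A section is a linear form on \<open>complex ^ 6\<close>,
  a line of the surface is a plane cut out by those of the twelve linear forms that vanish on it,
  and questions of incidence become systems of equations in six coordinates. What the blow-up
  contributes is the factorization of the twelve cubics, read from the cubic itself off the centres
  and from its derivative on an exceptional curve.

  For (d), prescribed values on generators give an action only if they respect the relations of the
  symmetric group. Instead of checking relations, the values are found inside an action known
  beforehand. Antisymmetric matrices with zero row sums form the cycle space of the complete graph
  on five vertices, of dimension 10 - 4 = 6. An oriented pentagon and its neighbour both give
  matrices fixed by the rotations; \<open>chi\<close> takes their difference, because for it the
  relation \<open>sigma_form 1 2 = s_form 1 3 - s_form 3 1 - s_form 2 3\<close> holds between the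
  matrices. The sign twist is the factor by which a permutation of the coordinates multiplies the
  volume form in the identification of cubics with sections.\<close>

lemma exhaust_5: "(x::5) = 0 \<or> x = 1 \<or> x = 2 \<or> x = 3 \<or> x = 4"
proof (induct x)
  case (of_int z)
  then have "z = 0 \<or> z = 1 \<or> z = 2 \<or> z = 3 \<or> z = 4" by simp arith
  then show ?case by auto
qed

lemma exhaust_6: "(x::6) = 1 \<or> x = 2 \<or> x = 3 \<or> x = 4 \<or> x = 5 \<or> x = 6"
proof (induct x)
  case (of_int z)
  then have "z = 0 \<or> z = 1 \<or> z = 2 \<or> z = 3 \<or> z = 4 \<or> z = 5" by simp arith
  then show ?case by auto
qed

lemma UNIV_5: "(UNIV :: 5 set) = {0, 1, 2, 3, 4}"
  using exhaust_5 by auto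

lemma UNIV_6: "(UNIV :: 6 set) = {1, 2, 3, 4, 5, 6}"
  using exhaust_6 by auto

lemma forall_5: "(\<forall>i::5. P i) \<longleftrightarrow> P 0 \<and> P 1 \<and> P 2 \<and> P 3 \<and> P 4"
  by (metis exhaust_5)

lemma forall_6: "(\<forall>i::6. P i) \<longleftrightarrow> P 1 \<and> P 2 \<and> P 3 \<and> P 4 \<and> P 5 \<and> P 6"
  by (metis exhaust_6)

lemma sum_5: "sum f (UNIV::5 set) = f 0 + f 1 + f 2 + f 3 + f 4"
  unfolding UNIV_5 by (simp add: ac_simps)

lemma sum_6: "sum f (UNIV::6 set) = f 1 + f 2 + f 3 + f 4 + f 5 + f 6"
  unfolding UNIV_6 by (simp add: ac_simps)

section \<open>Index pairs, signs and the incidence of sections with lines\<close>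

lemma index_pairs_eq: "index_pairs = {(1, 2), (1, 3), (2, 1), (2, 3), (3, 1), (3, 2)}"
proof -
  have "{1..3::nat} = {1, 2, 3}" by auto
  then show ?thesis unfolding index_pairs_def by auto
qed

lemma perm3_simps:
  "perm3 (Suc 0) 2 3 = id" "perm3 2 (Suc 0) 3 = Transposition.transpose (Suc 0) 2"
  "perm3 3 2 (Suc 0) = Transposition.transpose (Suc 0) 3" "perm3 (Suc 0) 3 2 = Transposition.transpose 2 3"
  "perm3 2 3 (Suc 0) = Transposition.transpose (Suc 0) 2 \<circ> Transposition.transpose 2 3"
  "perm3 3 (Suc 0) 2 = Transposition.transpose 2 3 \<circ> Transposition.transpose (Suc 0) 2"
  by (auto simp: perm3_def fun_eq_iff Transposition.transpose_def)

lemma sign_perm3: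
  "sign (perm3 (Suc 0) 2 3) = 1" "sign (perm3 2 (Suc 0) 3) = -1" "sign (perm3 3 2 (Suc 0)) = -1"
  "sign (perm3 (Suc 0) 3 2) = -1" "sign (perm3 2 3 (Suc 0)) = 1" "sign (perm3 3 (Suc 0) 2) = 1"
  unfolding perm3_simps by (simp_all add: sign_swap_id sign_compose permutation_swap_id sign_id)

lemma sign_perm3_cases:
  assumes "(i, j) \<in> index_pairs"
  shows "sign (perm3 i j (6 - i - j)) = 1 \<or> sign (perm3 i j (6 - i - j)) = -1"
  using assms by (simp add: sign_def)

definition v6 :: "complex \<Rightarrow> complex \<Rightarrow> complex \<Rightarrow> complex \<Rightarrow> complex \<Rightarrow> complex \<Rightarrow> complex ^ 6" where
  "v6 a b c d e f = (\<chi> m. if m = 1 then a else if m = 2 then b else if m = 3 then c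
     else if m = 4 then d else if m = 5 then e else f)"

text \<open>In the numeral type the index 6 is the same as 0 and may be rewritten to it; the last
  equation covers that form.\<close>

lemma v6_nth [simp]: "v6 a b c d e f $ 1 = a" "v6 a b c d e f $ 2 = b" "v6 a b c d e f $ 3 = c"
  "v6 a b c d e f $ 4 = d" "v6 a b c d e f $ 5 = e" "v6 a b c d e f $ 6 = f" "v6 a b c d e f $ 0 = f"
  by (simp_all add: v6_def)

text \<open>The positions follow the order of \<open>s_basis\<close>; values outside
  \<open>index_pairs\<close> have no meaning.\<close>

definition s_index :: "nat \<Rightarrow> nat \<Rightarrow> 6" where
  "s_index i j = (if i = 1 then (if j = 2 then 1 else 2) else if i = 2 then (if j = 1 then 3 else 4)
     else (if j = 1 then 5 else 6))"

text \<open>The twelve sections are indexed by triples \<open>(b, i, j)\<close>, where \<open>b\<close> distinguishes \<open>\<sigma>\<^sub>i\<^sub>j\<close>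
  from \<open>s\<^sub>i\<^sub>j\<close>.\<close>

type_synonym sec_index = "bool \<times> nat \<times> nat"

abbreviation sec_indices :: "sec_index set" where "sec_indices \<equiv> UNIV \<times> index_pairs"

fun sec :: "sec_index \<Rightarrow> form" where
  "sec (b, i, j) = (if b then sigma_form i j else s_form i j)"

text \<open>The section as a linear form on the ambient space, with
  \<open>\<sigma>\<^sub>i\<^sub>j\<close> expanded in the basis. Written out, it avoids the definite
  description behind \<open>linear_form\<close>, with which it is identified in
  \<open>linear_form_sec\<close>.\<close>

fun sec_lin :: "sec_index \<Rightarrow> complex ^ 6 \<Rightarrow> complex" where
  "sec_lin (b, i, j) w = (let k = 6 - i - j in
     if b then of_int (sign (perm3 i j k)) * (w $ s_index i k - w $ s_index k i - w $ s_index j k)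
     else w $ s_index i j)"

text \<open>The lines \<open>E\<^sub>h\<^sub>k\<close> on which a section vanishes: the strict transforms of the linear factors of the
  cubic, and the exceptional curves over the points where two of these factors vanish.\<close>

fun edges :: "sec_index \<Rightarrow> nat set set" where
  "edges (b, i, j) = (let k = 6 - i - j in
     if b then {{k, 4}, {4, 5}, {5, j}, {j, i}, {i, k}} else {{i, 4}, {4, j}, {j, k}, {k, 5}, {5, i}})"

definition pairs5 :: "nat set set" where
  "pairs5 = {{1, 2}, {1, 3}, {1, 4}, {1, 5}, {2, 3}, {2, 4}, {2, 5}, {3, 4}, {3, 5}, {4, 5}}"

lemma ball_sec_indices:
  "(\<forall>s\<in>sec_indices. P s) \<longleftrightarrow> (\<forall>b. P (b, 1, 2) \<and> P (b, 1, 3) \<and> P (b, 2, 1) \<and> P (b, 2, 3) \<and>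
     P (b, 3, 1) \<and> P (b, 3, 2))"
  unfolding index_pairs_eq by auto

lemma pairs5_cases [consumes 1]:
  assumes "e \<in> pairs5"
  obtains "e = {1, 2}" | "e = {1, 3}" | "e = {1, 4}" | "e = {1, 5}" | "e = {2, 3}" | "e = {2, 4}"
    | "e = {2, 5}" | "e = {3, 4}" | "e = {3, 5}" | "e = {4, 5}"
  using assms unfolding pairs5_def insert_iff empty_iff by (elim disjE FalseE; (erule that)?)

lemma doubleton_in_pairs5:
  assumes "h \<in> {1..5::nat}" "k \<in> {1..5}" "h \<noteq> k"
  shows "{h, k} \<in> pairs5"
proof -
  have "{1..5::nat} = {1, 2, 3, 4, 5}" by auto
  then have "h \<in> {1, 2, 3, 4, 5}" "k \<in> {1, 2, 3, 4, 5}" using assms(1, 2) by blast+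
  with assms(3) show ?thesis
    unfolding pairs5_def by (elim insertE emptyE; simp add: doubleton_eq_iff)
qed

lemma edges_simps:
  "edges (False, Suc 0, 2) = {{1, 4}, {2, 4}, {2, 3}, {3, 5}, {1, 5}}"
  "edges (False, Suc 0, 3) = {{1, 4}, {3, 4}, {2, 3}, {2, 5}, {1, 5}}"
  "edges (False, 2, Suc 0) = {{2, 4}, {1, 4}, {1, 3}, {3, 5}, {2, 5}}"
  "edges (False, 2, 3) = {{2, 4}, {3, 4}, {1, 3}, {1, 5}, {2, 5}}"
  "edges (False, 3, Suc 0) = {{3, 4}, {1, 4}, {1, 2}, {2, 5}, {3, 5}}"
  "edges (False, 3, 2) = {{3, 4}, {2, 4}, {1, 2}, {1, 5}, {3, 5}}"
  "edges (True, Suc 0, 2) = {{3, 4}, {4, 5}, {2, 5}, {1, 2}, {1, 3}}"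
  "edges (True, Suc 0, 3) = {{2, 4}, {4, 5}, {3, 5}, {1, 3}, {1, 2}}"
  "edges (True, 2, Suc 0) = {{3, 4}, {4, 5}, {1, 5}, {1, 2}, {2, 3}}"
  "edges (True, 2, 3) = {{1, 4}, {4, 5}, {3, 5}, {2, 3}, {1, 2}}"
  "edges (True, 3, Suc 0) = {{2, 4}, {4, 5}, {1, 5}, {1, 3}, {2, 3}}"
  "edges (True, 3, 2) = {{1, 4}, {4, 5}, {2, 5}, {2, 3}, {1, 3}}"
  by (simp_all add: insert_commute)

declare edges.simps [simp del]
lemma edges_subset:
  assumes "s \<in> sec_indices"
  shows "edges s \<subseteq> pairs5"
proof -
  have "\<forall>s\<in>sec_indices. edges s \<subseteq> pairs5"
    unfolding ball_sec_indices all_bool_eq by (simp add: edges_simps pairs5_def doubleton_eq_iff)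
  then show ?thesis using assms by blast
qed

lemma bex_sec_indices:
  "(\<exists>s\<in>sec_indices. P s) \<longleftrightarrow> (\<exists>b. P (b, 1, 2) \<or> P (b, 1, 3) \<or> P (b, 2, 1) \<or> P (b, 2, 3) \<or>
     P (b, 3, 1) \<or> P (b, 3, 2))"
  using ball_sec_indices[of "\<lambda>s. \<not> P s"] by blast

lemma common_section:
  assumes "e \<in> pairs5" "e' \<in> pairs5"
  shows "\<exists>s\<in>sec_indices. e \<in> edges s \<and> e' \<in> edges s"
proof -
  have "\<forall>e\<in>pairs5. \<forall>e'\<in>pairs5. \<exists>s\<in>sec_indices. e \<in> edges s \<and> e' \<in> edges s"
    unfolding bex_sec_indices ex_bool_eq pairs5_def by (simp add: edges_simps doubleton_eq_iff)
  then show ?thesis using assms by blast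
qed

text \<open>The plane of \<open>complex ^ 6\<close> with projectivization \<open>E\<^sub>h\<^sub>k\<close>, for \<open>e = {h, k}\<close>.\<close>

definition line_space :: "nat set \<Rightarrow> (complex ^ 6) set" where
  "line_space e = {w. \<forall>s\<in>sec_indices. e \<in> edges s \<longrightarrow> sec_lin s w = 0}"

text \<open>The sections that vanish on the exceptional curve over (1:1:1) are the six
  \<open>sigma_form\<close>; their six equations have rank four and leave the coordinates 1 and 5
  free.\<close>

lemma linear_system_45: 
  fixes w :: "complex^6" shows "(w $ 2 - w $ 5 = w $ 4 \<and>
      w $ 6 = w $ 1 - w $ 3 \<and>
      w $ 2 = w $ 4 - w $ 6 \<and>
      w $ 3 - w $ 1 = w $ 5 \<and>
      w $ 6 - w $ 4 = w $ 1 \<and> w $ 3 = w $ 5 - w $ 2) \<longleftrightarrow>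
     (w $ 2 = - w $ 1 \<and> w $ 3 = w $ 1 + w $ 5 \<and> w $ 4 = - w $ 1 - w $ 5 \<and> w $ 6 = - w $ 5)"
    (is "?l \<longleftrightarrow> ?r")
proof
  assume l: ?l
  then have 1: "w $ 3 = w $ 1 + w $ 5" by (metis diff_add_cancel add.commute)
  with l have 2: "w $ 6 = - w $ 5" by simp
  with l have 3: "w $ 4 = - w $ 1 - w $ 5" by (metis diff_diff_eq2 minus_diff_commute add_diff_cancel_left' diff_add_cancel minus_diff_eq uminus_add_conv_diff)
  have "w $ 2 = w $ 4 - w $ 6" using l by blast
  also have "\<dots> = - w $ 1" unfolding 2 3 by simp
  finally show ?r using 1 2 3 by blast
qed simp

lemma line_space_eqs:
  "w \<in> line_space {1, 2} \<longleftrightarrow> w $ 5 = 0 \<and> w $ 6 = 0 \<and> w $ 2 = w $ 4 \<and> w $ 1 = w $ 3"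
  "w \<in> line_space {1, 3} \<longleftrightarrow> w $ 3 = 0 \<and> w $ 4 = 0 \<and> w $ 1 = w $ 6 \<and> w $ 2 = w $ 5"
  "w \<in> line_space {2, 3} \<longleftrightarrow> w $ 1 = 0 \<and> w $ 2 = 0 \<and> w $ 3 = w $ 5 \<and> w $ 4 = w $ 6"
  "w \<in> line_space {1, 4} \<longleftrightarrow> w $ 1 = 0 \<and> w $ 2 = 0 \<and> w $ 3 = 0 \<and> w $ 5 = 0"
  "w \<in> line_space {2, 4} \<longleftrightarrow> w $ 1 = 0 \<and> w $ 3 = 0 \<and> w $ 4 = 0 \<and> w $ 6 = 0"
  "w \<in> line_space {3, 4} \<longleftrightarrow> w $ 2 = 0 \<and> w $ 4 = 0 \<and> w $ 5 = 0 \<and> w $ 6 = 0"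
  "w \<in> line_space {1, 5} \<longleftrightarrow> w $ 1 = 0 \<and> w $ 2 = 0 \<and> w $ 4 = 0 \<and> w $ 6 = 0"
  "w \<in> line_space {2, 5} \<longleftrightarrow> w $ 2 = 0 \<and> w $ 3 = 0 \<and> w $ 4 = 0 \<and> w $ 5 = 0"
  "w \<in> line_space {3, 5} \<longleftrightarrow> w $ 1 = 0 \<and> w $ 3 = 0 \<and> w $ 5 = 0 \<and> w $ 6 = 0"
  "w \<in> line_space {4, 5} \<longleftrightarrow>
     w $ 2 = - w $ 1 \<and> w $ 3 = w $ 1 + w $ 5 \<and> w $ 4 = - w $ 1 - w $ 5 \<and> w $ 6 = - w $ 5"
  unfolding line_space_def ball_sec_indices mem_Collect_eq
  by (simp_all add: all_bool_eq edges_simps s_index_def sign_perm3 doubleton_eq_iff)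
    (rule linear_system_45 | (rule iffI; elim conjE; intro conjI; simp))+

section \<open>Linear algebra of projective points and lines\<close>

lemma in_span1: "w \<in> vec.span {a} \<longleftrightarrow> (\<exists>x. w = x *s a)"
  by (auto simp: vec.span_singleton)

lemma in_span2: "w \<in> vec.span {a, b} \<longleftrightarrow> (\<exists>x y. w = x *s a + y *s b)"
  unfolding vec.span_insert[of a] in_span1 mem_Collect_eq
  by (metis add.commute add_diff_cancel_left' diff_add_cancel)

lemma span1_subset: "vec.subspace W \<Longrightarrow> vec.span {v} \<subseteq> W \<longleftrightarrow> v \<in> W"
  by (metis empty_subsetI insert_subset vec.span_base vec.span_minimal singletonI subset_iff)

lemma proj_space_iff: "x \<in> proj_space \<longleftrightarrow> (\<exists>v. v \<noteq> 0 \<and> x = vec.span {v})"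
proof
  assume "x \<in> proj_space"
  then have x: "vec.subspace x" "vec.dim x = 1" by (auto simp: proj_space_def)
  obtain B where B: "B \<subseteq> x" "vec.independent B" "x \<subseteq> vec.span B" "card B = vec.dim x"
    using vec.basis_exists by blast
  then obtain v where v: "B = {v}" using x card_1_singletonE by metis
  have "x = vec.span {v}" using B v x(1) by (metis vec.span_subspace)
  moreover have "v \<noteq> 0" using B(2) v vec.dependent_zero by blast
  ultimately show "\<exists>v. v \<noteq> 0 \<and> x = vec.span {v}" by blast
next
  assume "\<exists>v. v \<noteq> 0 \<and> x = vec.span {v}"
  then obtain v where v: "v \<noteq> 0" "x = vec.span {v}" by blast
  have "vec.dim (vec.span {v}) = card {v}"
    by (rule vec.dim_span_eq_card_independent) (use v in \<open>simp add: vec.independent_insert\<close>)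
  then show "x \<in> proj_space" by (simp add: proj_space_def v)
qed

lemma span1_in_proj_space [simp]: "vec.span {v} \<in> proj_space \<longleftrightarrow> v \<noteq> 0"
proof
  assume "vec.span {v} \<in> proj_space"
  then obtain w where w: "w \<noteq> 0" "vec.span {v} = vec.span {w}" by (auto simp: proj_space_iff)
  then show "v \<noteq> 0" using vec.span_base[of w "{w}"] by (auto simp: in_span1)
qed (auto simp: proj_space_iff)

lemma span1_eqD:
  assumes "vec.span {v} = vec.span {w}" "v \<noteq> 0"
  shows "\<exists>c. c \<noteq> 0 \<and> w = c *s v"
proof -
  have "w \<in> vec.span {v}" "v \<in> vec.span {w}"
    using assms(1) vec.span_base[of w "{w}"] vec.span_base[of v "{v}"] by simp_all
  then obtain a b where "w = a *s v" "v = b *s w" unfolding in_span1 by blast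
  then show ?thesis using assms(2) by (metis vec.scale_zero_left vec.scale_zero_right)
qed

lemma span1_scale: "c \<noteq> 0 \<Longrightarrow> vec.span {c *s v} = vec.span {v}"
  using vec.span_image_scale[of "{v}" "\<lambda>_. c"] by simp

text \<open>Independence of the pair as a family: \<open>indep2 a a\<close> is false, while the set
  \<open>{a, a}\<close> may well be independent.\<close>

definition indep2 :: "complex ^ 'n \<Rightarrow> complex ^ 'n \<Rightarrow> bool" where
  "indep2 a b \<longleftrightarrow> (\<forall>x y. x *s a + y *s b = 0 \<longrightarrow> x = 0 \<and> y = 0)"

lemma indep2_nonzero: "indep2 a b \<Longrightarrow> a \<noteq> 0 \<and> b \<noteq> 0"
proof (intro conjI notI)
  assume i: "indep2 a b"
  show False if "a = 0"
    using i[unfolded indep2_def, rule_format, of 1 0] that by simp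
  show False if "b = 0"
    using i[unfolded indep2_def, rule_format, of 0 1] that by simp
qed

lemma indep2_iff: "v \<noteq> 0 \<Longrightarrow> indep2 v w \<longleftrightarrow> w \<notin> vec.span {v}"
proof -
  assume v: "v \<noteq> 0"
  show ?thesis
  proof
    assume i: "indep2 v w"
    show "w \<notin> vec.span {v}"
    proof
      assume "w \<in> vec.span {v}"
      then obtain x where "w = x *s v" by (auto simp: in_span1)
      then have "x *s v + (-1) *s w = 0" by (simp add: vec.scale_minus_left)
      then show False using i unfolding indep2_def by (metis one_neq_zero neg_equal_0_iff_equal)
    qed
  next
    assume w: "w \<notin> vec.span {v}"
    show "indep2 v w" unfolding indep2_def
    proof (intro allI impI)
      fix x y assume e: "x *s v + y *s w = 0"
      have "y = 0"
      proof (rule ccontr)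
        assume y: "y \<noteq> 0"
        have "y *s w = (- x) *s v" using e by (simp add: eq_neg_iff_add_eq_0 add.commute vec.scale_minus_left)
        then have "(1/y) *s (y *s w) = (- x/y) *s v" by (simp add: vec.scale_scale)
        then have "w = (- x/y) *s v" using y by simp
        then show False using w unfolding in_span1 by blast
      qed
      then show "x = 0 \<and> y = 0" using e v by simp
    qed
  qed
qed

lemma indep2_by_coordinates:
  assumes "a $ m * b $ n \<noteq> a $ n * b $ m"
  shows "indep2 a b"
  unfolding indep2_def
proof (intro allI impI)
  fix x y assume 0: "x *s a + y *s b = 0"
  have mn: "a $ m * b $ n - a $ n * b $ m \<noteq> 0" using assms by simp
  have "(x *s a + y *s b) $ m = 0" "(x *s a + y *s b) $ n = 0" by (simp_all add: 0)
  then have 1: "x * a $ m + y * b $ m = 0" "x * a $ n + y * b $ n = 0" by simp_all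
  have "x * (a $ m * b $ n - a $ n * b $ m) = (x * a $ m + y * b $ m) * b $ n - (x * a $ n + y * b $ n) * b $ m"
    "y * (a $ m * b $ n - a $ n * b $ m) = (x * a $ n + y * b $ n) * a $ m - (x * a $ m + y * b $ m) * a $ n"
    by (simp_all add: algebra_simps)
  then show "x = 0 \<and> y = 0" using mn unfolding 1 by simp
qed

lemma span1_neq_indep2:
  assumes "v \<noteq> 0" "w \<noteq> 0" "vec.span {v} \<noteq> vec.span {w}"
  shows "indep2 v w"
proof (rule ccontr)
  assume "\<not> indep2 v w"
  then obtain x where x: "w = x *s v" using assms(1) by (auto simp: indep2_iff in_span1)
  then have "x \<noteq> 0" using assms(2) by auto
  then show False using assms(3) x span1_scale by blast
qed

lemma indep2_combination_inj:
  assumes "indep2 a b" "x *s a + y *s b = x' *s a + y' *s b"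
  shows "x = x' \<and> y = y'"
proof -
  have "(x - x') *s a + (y - y') *s b = 0"
    using assms(2) by (simp add: vec.scale_left_diff_distrib algebra_simps)
  then show ?thesis using assms(1) unfolding indep2_def by (metis eq_iff_diff_eq_0)
qed

lemma span2_eq:
  assumes "p \<in> vec.span {a, b}" "q \<in> vec.span {a, b}" "indep2 p q"
  shows "vec.span {p, q} = vec.span {a, b}"
proof
  show "vec.span {p, q} \<subseteq> vec.span {a, b}" using assms(1, 2) by (intro vec.span_minimal) auto
  obtain x y where p: "p = x *s a + y *s b" using assms(1) by (auto simp: in_span2)
  obtain z w where q: "q = z *s a + w *s b" using assms(2) by (auto simp: in_span2)
  \<comment> \<open>The determinant of the coordinates of p and q. The adjugate matrix gives D a and
    D b as combinations of p and q, and D = 0 would be a nontrivial relation between them.\<close>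
  define D where "D = x * w - y * z"
  have A: "w *s p + (- y) *s q = D *s a" "(- z) *s p + x *s q = D *s b"
    unfolding p q D_def by (simp_all add: vec_eq_iff algebra_simps)
  have d: "D \<noteq> 0"
  proof
    assume "D = 0"
    with A assms(3) have "w = 0" "y = 0" "z = 0" "x = 0" unfolding indep2_def
      by (metis vec.scale_zero_left neg_equal_0_iff_equal)+
    then have "p = 0" by (simp add: p)
    then show False using assms(3) indep2_nonzero by blast
  qed
  have "a = (w / D) *s p + (- y / D) *s q"
    using arg_cong[OF A(1), of "(*s) (1 / D)"] d by (simp add: vec.scale_right_distrib)
  moreover have "b = (- z / D) *s p + (x / D) *s q"
    using arg_cong[OF A(2), of "(*s) (1 / D)"] d by (simp add: vec.scale_right_distrib)
  ultimately have "a \<in> vec.span {p, q}" "b \<in> vec.span {p, q}" unfolding in_span2 by blast+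
  then show "vec.span {a, b} \<subseteq> vec.span {p, q}" by (intro vec.span_minimal) auto
qed

definition proj :: "(complex ^ 'n) set \<Rightarrow> (complex ^ 'n) set set" where
  "proj W = {x \<in> proj_space. x \<subseteq> W}"

lemma span1_in_proj: "vec.subspace W \<Longrightarrow> vec.span {v} \<in> proj W \<longleftrightarrow> v \<noteq> 0 \<and> v \<in> W"
  by (simp add: proj_def span1_subset)

lemma proj_inject:
  assumes "vec.subspace W" "vec.subspace W'" "proj W = proj W'"
  shows "W = W'"
proof -
  have "v \<in> W \<longleftrightarrow> v \<in> W'" for v
  proof (cases "v = 0")
    case True
    then show ?thesis using assms vec.subspace_0 by auto
  next
    case False
    then show ?thesis using assms span1_in_proj by metis
  qed
  then show ?thesis by blast
qed

lemma line_joining_eq: "line_joining (vec.span {v}) (vec.span {w}) = proj (vec.span {v, w})"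
proof -
  have "vec.span (vec.span {v} \<union> vec.span {w}) = vec.span {v, w}"
  proof
    have "vec.span {v} \<union> vec.span {w} \<subseteq> vec.span {v, w}" by (intro Un_least vec.span_mono) auto
    then show "vec.span (vec.span {v} \<union> vec.span {w}) \<subseteq> vec.span {v, w}"
      by (rule vec.span_minimal) simp
    have "{v, w} \<subseteq> vec.span {v} \<union> vec.span {w}" by (simp add: vec.span_base)
    then show "vec.span {v, w} \<subseteq> vec.span (vec.span {v} \<union> vec.span {w})" by (rule vec.span_mono)
  qed
  then show ?thesis by (simp add: line_joining_def proj_def)
qed

section \<open>Closed subsets of projective lines\<close>

lemma homogeneous_poly_scale:
  assumes "homogeneous_poly d f"
  shows "f (c *s v) = c ^ d * f v"
  using assms by (induction rule: homogeneous_poly.induct) (auto simp: algebra_simps power_add)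

lemma homogeneous_poly_cmult: "homogeneous_poly d f \<Longrightarrow> homogeneous_poly d (\<lambda>x. c * f x)"
  using homogeneous_poly.mult[OF homogeneous_poly.const] by fastforce

lemma homogeneous_poly_diff:
  assumes "homogeneous_poly d f" "homogeneous_poly d g"
  shows "homogeneous_poly d (\<lambda>x. f x - g x)"
  using homogeneous_poly.add[OF assms(1) homogeneous_poly_cmult[OF assms(2), of "-1"]] by simp

lemma homogeneous_poly_on_line:
  assumes "homogeneous_poly d f"
  shows "\<exists>q. \<forall>t. poly q t = f (a + t *s b)"
  using assms
proof (induction rule: homogeneous_poly.induct)
  case (const c)
  show ?case by (rule exI[of _ "[:c:]"]) simp
next
  case (coord i)
  show ?case by (rule exI[of _ "[:a $ i, b $ i:]"]) simp
next
  case (add d f g)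
  then obtain p q where "\<forall>t. poly p t = f (a + t *s b)" "\<forall>t. poly q t = g (a + t *s b)" by blast
  then show ?case by (intro exI[of _ "p + q"]) simp
next
  case (mult d f e g)
  then obtain p q where "\<forall>t. poly p t = f (a + t *s b)" "\<forall>t. poly q t = g (a + t *s b)" by blast
  then show ?case by (intro exI[of _ "p * q"]) simp
qed

text \<open>Along an affine parameter of the line each defining polynomial becomes a polynomial in
  one variable; with infinitely many roots it is zero. The parameter is centred at the given point
  z, so that z is reached at t = 0.\<close>

lemma closed_contains_line:
  assumes X: "zariski_closed X" and i: "indep2 a b" and inf: "infinite (X \<inter> proj (vec.span {a, b}))"
  shows "proj (vec.span {a, b}) \<subseteq> X"
proof
  fix z assume z: "z \<in> proj (vec.span {a, b})"
  obtain F where F: "\<forall>f\<in>F. \<exists>d. homogeneous_poly d f"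
    and XF: "X = {x \<in> proj_space. \<forall>f\<in>F. \<forall>v\<in>x. f v = 0}" using X unfolding zariski_closed_def by blast
  obtain w0 where w0: "w0 \<noteq> 0" "z = vec.span {w0}" using z by (auto simp: proj_def proj_space_iff)
  have w0s: "w0 \<in> vec.span {a, b}" using z w0 span1_in_proj by auto
  have "infinite (X \<inter> proj (vec.span {a, b}) - {z})" using inf by simp
  then have "X \<inter> proj (vec.span {a, b}) - {z} \<noteq> {}" by (metis finite.emptyI)
  then obtain z1 where z1: "z1 \<in> X" "z1 \<in> proj (vec.span {a, b})" "z1 \<noteq> z" by blast
  obtain w1 where w1: "w1 \<noteq> 0" "z1 = vec.span {w1}" using z1 by (auto simp: proj_def proj_space_iff)
  have w1s: "w1 \<in> vec.span {a, b}" using z1 w1 span1_in_proj by auto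
  have i01: "indep2 w0 w1" using span1_neq_indep2 w0 w1 z1 by metis
  have S: "vec.span {w0, w1} = vec.span {a, b}" by (rule span2_eq[OF w0s w1s i01])
  \<comment> \<open>The point z1 is removed because it is the point at infinity of the
    parametrization \<open>w0 + t *s w1\<close>.\<close>
  define Z where "Z = X \<inter> proj (vec.span {a, b}) - {z1}"
  have Zinf: "infinite Z" using inf by (simp add: Z_def)
  have "\<exists>t. x = vec.span {w0 + t *s w1}" if x: "x \<in> Z" for x
  proof -
    obtain v where v: "v \<noteq> 0" "x = vec.span {v}" using x by (auto simp: Z_def proj_def proj_space_iff)
    have "v \<in> vec.span {w0, w1}" using x v S span1_in_proj by (auto simp: Z_def)
    then obtain p q where pq: "v = p *s w0 + q *s w1" by (auto simp: in_span2)
    have "p \<noteq> 0"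
    proof
      assume "p = 0"
      then have "x = z1" using pq v w1 span1_scale by (metis add.left_neutral vec.scale_eq_0_iff)
      then show False using x by (simp add: Z_def)
    qed
    then have "v = p *s (w0 + (q / p) *s w1)" using pq by (simp add: vec.scale_right_distrib)
    then show ?thesis using v span1_scale \<open>p \<noteq> 0\<close> by metis
  qed
  then obtain \<theta> where \<theta>: "\<And>x. x \<in> Z \<Longrightarrow> x = vec.span {w0 + \<theta> x *s w1}" by metis
  have "inj_on \<theta> Z" by (metis \<theta> inj_onI)
  then have Tinf: "infinite (\<theta> ` Z)" using Zinf finite_imageD by blast
  have "f v = 0" if f: "f \<in> F" and v: "v \<in> z" for f v
  proof -
    obtain d where d: "homogeneous_poly d f" using F f by blast
    obtain q where q: "\<And>t. poly q t = f (w0 + t *s w1)" using homogeneous_poly_on_line[OF d] by blast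
    have "poly q t = 0" if t: "t \<in> \<theta> ` Z" for t
    proof -
      obtain x where x: "x \<in> Z" "t = \<theta> x" using t by blast
      have "w0 + t *s w1 \<in> x" using \<theta>[OF x(1)] x(2) vec.span_base by (metis singletonI)
      moreover have "x \<in> X" using x by (simp add: Z_def)
      ultimately show ?thesis using XF f q by auto
    qed
    then have "infinite {t. poly q t = 0}" using Tinf by (metis (mono_tags, lifting) finite_subset mem_Collect_eq subsetI)
    then have "q = 0" using poly_roots_finite by blast
    then have "f w0 = 0" using q[of 0] by simp
    moreover obtain c where "v = c *s w0" using v w0 by (auto simp: in_span1)
    ultimately show ?thesis using homogeneous_poly_scale[OF d] by simp
  qed
  then show "z \<in> X" using XF w0 by auto
qed

lemma zariski_closed_Un:
  assumes "zariski_closed X" "zariski_closed Y"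
  shows "zariski_closed (X \<union> Y)"
proof -
  obtain F where F: "\<forall>f\<in>F. \<exists>d. homogeneous_poly d f"
    and X: "X = {x \<in> proj_space. \<forall>f\<in>F. \<forall>v\<in>x. f v = 0}" using assms(1) unfolding zariski_closed_def by blast
  obtain G where G: "\<forall>f\<in>G. \<exists>d. homogeneous_poly d f"
    and Y: "Y = {x \<in> proj_space. \<forall>f\<in>G. \<forall>v\<in>x. f v = 0}" using assms(2) unfolding zariski_closed_def by blast
  let ?H = "{\<lambda>x. f x * g x | f g. f \<in> F \<and> g \<in> G}"
  have "\<forall>h\<in>?H. \<exists>d. homogeneous_poly d h" using F G homogeneous_poly.mult by blast
  moreover have "X \<union> Y = {x \<in> proj_space. \<forall>h\<in>?H. \<forall>v\<in>x. h v = 0}"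
  proof (intro Set.set_eqI iffI)
    fix x assume "x \<in> X \<union> Y"
    then show "x \<in> {x \<in> proj_space. \<forall>h\<in>?H. \<forall>v\<in>x. h v = 0}" using X Y by auto
  next
    fix x assume x: "x \<in> {x \<in> proj_space. \<forall>h\<in>?H. \<forall>v\<in>x. h v = 0}"
    then obtain v where v: "x = vec.span {v}" "v \<noteq> 0" by (auto simp: proj_space_iff)
    have vx: "v \<in> x" using v vec.span_base by blast
    \<comment> \<open>By homogeneity vanishing at a generator means vanishing on the whole point.
      The vectors u and u' at which f and g are nonzero can thus both be replaced by v, and the
      product is tested there.\<close>
    have all: "\<forall>u\<in>x. f u = 0" if "homogeneous_poly d f" "f v = 0" for d f
      using that v homogeneous_poly_scale by (fastforce simp: in_span1)
    show "x \<in> X \<union> Y"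
    proof (rule ccontr)
      assume n: "x \<notin> X \<union> Y"
      then obtain f u where f: "f \<in> F" "u \<in> x" "f u \<noteq> 0" using X x by blast
      from n obtain g u' where g: "g \<in> G" "u' \<in> x" "g u' \<noteq> 0" using Y x by blast
      have "f v \<noteq> 0" "g v \<noteq> 0" using all f g F G by blast+
      have "(\<lambda>x. f x * g x) \<in> ?H" using f g by blast
      moreover have "\<forall>h\<in>?H. \<forall>v\<in>x. h v = 0" by (rule conjunct2[OF CollectD[OF x]])
      ultimately have "f v * g v = 0" using vx by (metis (no_types, lifting))
      with \<open>f v \<noteq> 0\<close> \<open>g v \<noteq> 0\<close> show False by simp
    qed
  qed
  ultimately show ?thesis unfolding zariski_closed_def by blast
qed

lemma zariski_closed_point:
  assumes "x \<in> proj_space"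
  shows "zariski_closed {x}"
proof -
  obtain v where v: "v \<noteq> 0" "x = vec.span {v}" using assms by (auto simp: proj_space_iff)
  \<comment> \<open>The 2 by 2 minors of the pair v, w, which all vanish exactly when w is a
    multiple of v.\<close>
  let ?F = "{\<lambda>w. v $ i * w $ j - v $ j * w $ i | i j. True}"
  have "\<forall>f\<in>?F. \<exists>d. homogeneous_poly d f"
    using homogeneous_poly_diff[OF homogeneous_poly_cmult[OF homogeneous_poly.coord] homogeneous_poly_cmult[OF homogeneous_poly.coord]]
    by blast
  moreover have "{x} = {x \<in> proj_space. \<forall>f\<in>?F. \<forall>v\<in>x. f v = 0}"
  proof (intro Set.set_eqI iffI)
    fix z assume "z \<in> {x}"
    then have z: "z = vec.span {v}" using v by simp
    then show "z \<in> {x \<in> proj_space. \<forall>f\<in>?F. \<forall>v\<in>x. f v = 0}" using v by (auto simp: in_span1)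
  next
    fix z assume z: "z \<in> {x \<in> proj_space. \<forall>f\<in>?F. \<forall>v\<in>x. f v = 0}"
    then obtain w where w: "w \<noteq> 0" "z = vec.span {w}" by (auto simp: proj_space_iff)
    have wz: "w \<in> z" using w vec.span_base by blast
    have e: "v $ i * w $ j = v $ j * w $ i" for i j
    proof -
      have "(\<lambda>w. v $ i * w $ j - v $ j * w $ i) \<in> ?F" by blast
      moreover have "\<forall>f\<in>?F. \<forall>v\<in>z. f v = 0" by (rule conjunct2[OF CollectD[OF z]])
      ultimately have "v $ i * w $ j - v $ j * w $ i = 0" using wz by (metis (no_types, lifting))
      then show ?thesis by simp
    qed
    obtain i where i: "v $ i \<noteq> 0" using v(1) by (auto simp: vec_eq_iff)
    have "w = (w $ i / v $ i) *s v" unfolding vec_eq_iff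
    proof
      fix j show "w $ j = ((w $ i / v $ i) *s v) $ j" using e[of i j] i by (simp add: field_simps)
    qed
    moreover have "w $ i / v $ i \<noteq> 0" using w calculation by (metis vec.scale_zero_left)
    ultimately have "z = vec.span {v}" using w span1_scale by metis
    then show "z \<in> {x}" using v by simp
  qed
  ultimately show ?thesis unfolding zariski_closed_def by blast
qed

lemma zariski_closed_empty: "zariski_closed {}"
proof -
  have "\<forall>f\<in>{\<lambda>_. 1}. \<exists>d. homogeneous_poly d f" using homogeneous_poly.const by blast
  moreover have "{} = {x \<in> proj_space. \<forall>f\<in>{\<lambda>_. 1 :: complex}. \<forall>v\<in>x. f v = 0}"
    using vec.span_base by (auto simp: proj_space_iff)
  ultimately show ?thesis unfolding zariski_closed_def by blast
qed

lemma zariski_closed_finite: "finite X \<Longrightarrow> X \<subseteq> proj_space \<Longrightarrow> zariski_closed X"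
proof (induction rule: finite_induct)
  case (insert x X)
  then show ?case using zariski_closed_Un[OF zariski_closed_point] by (metis insert_is_Un insert_subset)
qed (rule zariski_closed_empty)

lemma zariski_closed_subset: "zariski_closed X \<Longrightarrow> X \<subseteq> proj_space"
  unfolding zariski_closed_def by blast

lemma inj_span_affine:
  assumes "indep2 a b"
  shows "inj (\<lambda>t. vec.span {a + t *s b})"
proof (rule injI)
  have ne: "a + t *s b \<noteq> 0" for t
    using assms unfolding indep2_def by (metis vec.scale_one zero_neq_one)
  fix s t assume "vec.span {a + s *s b} = vec.span {a + t *s b}"
  then obtain c where "a + t *s b = c *s (a + s *s b)" using span1_eqD ne by blast
  then have "1 *s a + t *s b = c *s a + (c * s) *s b" by (simp add: vec.scale_right_distrib)
  then show "s = t" using indep2_combination_inj[OF assms] by fastforce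
qed

lemma span_affine_in_proj:
  assumes "indep2 a b"
  shows "vec.span {a + t *s b} \<in> proj (vec.span {a, b})"
proof -
  have "a + t *s b \<noteq> 0" using assms unfolding indep2_def by (metis vec.scale_one zero_neq_one)
  moreover have "a + t *s b \<in> vec.span {a, b}" unfolding in_span2 by (metis vec.scale_one)
  ultimately show ?thesis by (simp add: span1_in_proj)
qed

lemma infinite_proj_line:
  assumes "indep2 a b"
  shows "infinite (proj (vec.span {a, b}))"
proof
  assume "finite (proj (vec.span {a, b}))"
  then have "finite (range (\<lambda>t. vec.span {a + t *s b}))"
    by (rule finite_subset[rotated]) (use span_affine_in_proj[OF assms] in blast)
  then show False using finite_imageD[OF _ inj_span_affine[OF assms]] infinite_UNIV_char_0 by blast
qed

text \<open>By \<open>closed_contains_line\<close> a closed subset of a line is finite or the whole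
  line. Splitting a finite set into a point and the rest shows that the irreducible ones are single
  points.\<close>

lemma irreducible_curve_line:
  assumes c: "zariski_closed (proj (vec.span {a, b}))" and i: "indep2 a b"
  shows "irreducible_curve (proj (vec.span {a, b}))"
proof -
  let ?L = "proj (vec.span {a, b})"
  have inf: "infinite ?L" by (rule infinite_proj_line[OF i])
  have full: "D = ?L" if "zariski_closed D" "D \<subseteq> ?L" "infinite D" for D
    using closed_contains_line[OF that(1) i] that by (metis inf.absorb1 subset_antisym)
  have "irreducible_closed ?L" unfolding irreducible_closed_def
  proof (intro conjI allI impI)
    show "?L \<noteq> {}" using inf by auto
    fix A B assume AB: "zariski_closed A \<and> zariski_closed B \<and> ?L = A \<union> B"
    then have "infinite A \<or> infinite B" using inf by (metis finite_Un)
    then show "?L = A \<or> ?L = B" using full[of A] full[of B] AB by blast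
  qed (rule c)
  moreover have "\<exists>x. D = {x}" if D: "irreducible_closed D" "D \<subset> ?L" for D
  proof -
    have cD: "zariski_closed D" "D \<noteq> {}" using D(1) by (auto simp: irreducible_closed_def)
    then have fin: "finite D" using full[of D] D(2) by blast
    obtain x where x: "x \<in> D" using cD by blast
    have sub: "D \<subseteq> proj_space" using zariski_closed_subset[OF cD(1)] .
    have "zariski_closed {x}" "zariski_closed (D - {x})"
      using zariski_closed_finite fin sub x by auto
    moreover have "D = {x} \<union> (D - {x})" using x by blast
    ultimately have "D = {x} \<or> D = D - {x}" using D(1) unfolding irreducible_closed_def by meson
    then show ?thesis using x by blast
  qed
  moreover have "\<forall>x. ?L \<noteq> {x}" using inf by (metis finite.emptyI finite_insert)
  ultimately show ?thesis unfolding irreducible_curve_def by blast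
qed

lemma irreducible_closed_in_union:
  assumes "irreducible_closed C" "finite T" "\<forall>X\<in>T. zariski_closed X" "C \<subseteq> \<Union>T"
  shows "\<exists>X\<in>T. C \<subseteq> X"
  using assms(2, 3, 4)
proof (induction rule: finite_induct)
  case empty
  then show ?case using assms(1) by (auto simp: irreducible_closed_def)
next
  case (insert X T)
  have inter: "zariski_closed (C \<inter> Y)" if Y: "zariski_closed Y" for Y
  proof -
    have "zariski_closed C" using assms(1) by (simp add: irreducible_closed_def)
    then obtain F where F: "\<forall>f\<in>F. \<exists>d. homogeneous_poly d f"
      "C = {x \<in> proj_space. \<forall>f\<in>F. \<forall>v\<in>x. f v = 0}" unfolding zariski_closed_def by blast
    obtain G where G: "\<forall>f\<in>G. \<exists>d. homogeneous_poly d f"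
      "Y = {x \<in> proj_space. \<forall>f\<in>G. \<forall>v\<in>x. f v = 0}" using Y unfolding zariski_closed_def by blast
    have "\<forall>f\<in>F \<union> G. \<exists>d. homogeneous_poly d f" "C \<inter> Y = {x \<in> proj_space. \<forall>f\<in>F \<union> G. \<forall>v\<in>x. f v = 0}"
      using F G by blast+
    then show ?thesis unfolding zariski_closed_def by blast
  qed
  have "zariski_closed (\<Union>T)" using insert.hyps(1) insert.prems(1)
  proof (induction rule: finite_induct)
    case (insert Y S)
    then show ?case using zariski_closed_Un[of Y "\<Union>S"] by simp
  qed (simp add: zariski_closed_empty)
  then have "zariski_closed (C \<inter> X)" "zariski_closed (C \<inter> \<Union>T)" using inter insert.prems by auto
  moreover have "C = (C \<inter> X) \<union> (C \<inter> \<Union>T)" using insert.prems by auto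
  ultimately have "C = C \<inter> X \<or> C = C \<inter> \<Union>T" using assms(1) unfolding irreducible_closed_def by meson
  then have "C \<subseteq> X \<or> C \<subseteq> \<Union>T" by blast
  then show ?case using insert.IH insert.prems(1) by auto
qed

section \<open>Local expressions of sections\<close>

text \<open>The derivatives of \<open>s_form i j\<close> and, below, of \<open>sec s\<close> at \<open>v\<close> in the direction \<open>a\<close>: along an
  exceptional curve the value of a section is a derivative of the cubic form.\<close>

definition dS :: "nat \<Rightarrow> nat \<Rightarrow> complex ^ 3 \<Rightarrow> complex ^ 3 \<Rightarrow> complex" where
  "dS i j v a = (let k = 6 - i - j in
     a $ of_nat i * v $ of_nat j * (v $ of_nat j - v $ of_nat k)
     + v $ of_nat i * a $ of_nat j * (v $ of_nat j - v $ of_nat k)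
     + v $ of_nat i * v $ of_nat j * (a $ of_nat j - a $ of_nat k))"

fun dsec :: "sec_index \<Rightarrow> complex ^ 3 \<Rightarrow> complex ^ 3 \<Rightarrow> complex" where
  "dsec (b, i, j) v a = (let k = 6 - i - j in
     if b then of_int (sign (perm3 i j k)) * (dS i k v a - dS k i v a - dS j k v a) else dS i j v a)"

text \<open>\<open>ev\<close> and \<open>dev\<close> lift the anticanonical map to vectors:
  \<open>ev v\<close> at a point off the centres, \<open>dev v a\<close> on the exceptional curve
  over the centre v at the tangent direction a.\<close>

definition ev :: "complex ^ 3 \<Rightarrow> complex ^ 6" where
  "ev v = v6 (s_form 1 2 v) (s_form 1 3 v) (s_form 2 1 v) (s_form 2 3 v) (s_form 3 1 v) (s_form 3 2 v)"

definition dev :: "complex ^ 3 \<Rightarrow> complex ^ 3 \<Rightarrow> complex ^ 6" where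
  "dev v a = v6 (dS 1 2 v a) (dS 1 3 v a) (dS 2 1 v a) (dS 2 3 v a) (dS 3 1 v a) (dS 3 2 v a)"

lemma sec_ballI:
  assumes "s \<in> sec_indices"
    "\<And>b. P (b, 1, 2)" "\<And>b. P (b, 1, 3)" "\<And>b. P (b, 2, 1)" "\<And>b. P (b, 2, 3)" "\<And>b. P (b, 3, 1)" "\<And>b. P (b, 3, 2)"
  shows "P s"
  using assms ball_sec_indices[of P] by blast

lemma sec_lin_ev: "s \<in> sec_indices \<Longrightarrow> sec_lin s (ev v) = sec s v"
  by (rule sec_ballI, assumption) (simp_all add: ev_def s_index_def sigma_form_def Let_def)

lemma sec_lin_dev: "s \<in> sec_indices \<Longrightarrow> sec_lin s (dev v a) = dsec s v a"
  by (rule sec_ballI, assumption) (simp_all add: dev_def s_index_def Let_def)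

text \<open>The exact Taylor expansion of a cubic. Exchanging v and u a exchanges the two middle
  terms, so the second-order term at v is a first derivative at a in the direction v.\<close>

lemma sec_add:
  assumes "s \<in> sec_indices"
  shows "sec s (v + u *s a) = sec s v + u * dsec s v a + u\<^sup>2 * dsec s a v + u ^ 3 * sec s a"
proof -
  have s: "s_form i j (v + u *s a) = s_form i j v + u * dS i j v a + u\<^sup>2 * dS i j a v + u ^ 3 * s_form i j a" for i j
    by (simp add: s_form_def dS_def Let_def algebra_simps power2_eq_square power3_eq_cube)
  show ?thesis
    by (rule sec_ballI[OF assms]) (simp_all add: sigma_form_def Let_def s algebra_simps)
qed

text \<open>Homogeneity of degree two in the point, linearity in the direction, and Euler's identity
  for a cubic.\<close>

lemma dS_simps:
  "dS i j (c *s v) a = c\<^sup>2 * dS i j v a"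
  "dS i j v (x *s a + y *s b) = x * dS i j v a + y * dS i j v b"
  "dS i j v v = 3 * s_form i j v"
  by (simp_all add: s_form_def dS_def Let_def algebra_simps power2_eq_square)

lemma dsec_combination:
  assumes "s \<in> sec_indices"
  shows "dsec s v (x *s a + y *s b) = x * dsec s v a + y * dsec s v b"
  by (rule sec_ballI[OF assms]) (simp_all add: Let_def dS_simps algebra_simps)

text \<open>The effect of a change of chart at a centre. By Euler's identity the part of the
  direction along v contributes a multiple of \<open>ev v\<close>, which is zero.\<close>

lemma dev_scale: "ev v = 0 \<Longrightarrow> dev (c *s v) (x *s a + y *s v) = (c\<^sup>2 * x) *s dev v a"
  by (simp add: dev_def ev_def vec_eq_iff forall_6 dS_simps)

lemma ev_scale: "ev (c *s v) = c ^ 3 *s ev v"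
  by (simp add: ev_def s_form_def vec_eq_iff forall_6 power3_eq_cube algebra_simps)

lemma homogeneous_s_form: "homogeneous_poly 3 (s_form i j)"
proof -
  have "homogeneous_poly (1 + 1 + 1) (s_form i j)" unfolding s_form_def
    by (intro homogeneous_poly.mult homogeneous_poly_diff homogeneous_poly.coord)
  then show ?thesis by (simp add: numeral_3_eq_3)
qed

lemma homogeneous_sec: "homogeneous_poly 3 (sec s)"
proof (cases s)
  case (fields b i j)
  have "homogeneous_poly 3 (sigma_form i j)" unfolding sigma_form_def Let_def
    by (intro homogeneous_poly_cmult homogeneous_poly_diff homogeneous_s_form)
  then show ?thesis using homogeneous_s_form fields by (cases b) (auto simp: fun_eq_iff)
qed

abbreviation poly2 :: "complex poly poly \<Rightarrow> complex \<Rightarrow> complex \<Rightarrow> complex" where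
  "poly2 F u t \<equiv> poly (poly F [:u:]) t"

text \<open>Agreement is asked only for nonzero u because in a blow-up chart
  \<open>local_expr\<close> is characterized after multiplication by u.\<close>

lemma poly2_eqI:
  assumes "\<And>u t. u \<noteq> 0 \<Longrightarrow> poly2 F u t = poly2 G u t"
  shows "F = G"
proof (rule ccontr)
  assume "F \<noteq> G"
  then have fin: "finite {x. poly (F - G) x = 0}" by (intro poly_roots_finite) simp
  have "poly (F - G) [:u:] = 0" if "u \<noteq> 0" for u
    by (rule iffD1[OF poly_eq_poly_eq_iff]) (simp add: fun_eq_iff assms[OF that])
  then have "(\<lambda>u. [:u:]) ` (UNIV - {0}) \<subseteq> {x. poly (F - G) x = 0}" by auto
  then have "finite ((\<lambda>u :: complex. [:u:]) ` (UNIV - {0}))" using fin finite_subset by blast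
  then have "finite (UNIV - {0 :: complex})" by (rule finite_imageD) (auto intro: inj_onI)
  then show False using infinite_UNIV_char_0 by (metis finite_Diff2 finite.emptyI finite_insert)
qed

text \<open>Polynomials substituted into a form give a polynomial again. This is the existence half
  of the definite description in \<open>local_expr\<close>; \<open>poly2_eqI\<close> is the
  uniqueness half.\<close>

lemma homogeneous_poly_poly2:
  assumes "homogeneous_poly d f"
  shows "\<exists>G. \<forall>u t. poly2 G u t = f (\<chi> i. poly2 (X i) u t)"
  using assms
proof (induction rule: homogeneous_poly.induct)
  case (const c)
  show ?case by (rule exI[of _ "[:[:c:]:]"]) simp
next
  case (coord i)
  show ?case by (rule exI[of _ "X i"]) simp
next
  case (add d f g)
  then obtain p q where "\<forall>u t. poly2 p u t = f (\<chi> i. poly2 (X i) u t)" "\<forall>u t. poly2 q u t = g (\<chi> i. poly2 (X i) u t)"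
    by blast
  then show ?case by (intro exI[of _ "p + q"]) simp
next
  case (mult d f e g)
  then obtain p q where "\<forall>u t. poly2 p u t = f (\<chi> i. poly2 (X i) u t)" "\<forall>u t. poly2 q u t = g (\<chi> i. poly2 (X i) u t)"
    by blast
  then show ?case by (intro exI[of _ "p * q"]) simp
qed

lemma coeff_cubic:
  assumes "\<And>t. poly q t = c0 + t * c1 + t\<^sup>2 * c2 + t ^ 3 * (c3 :: complex)"
  shows "coeff q 0 = c0" "coeff q (Suc 0) = c1"
proof -
  have "q = [:c0, c1, c2, c3:]"
    by (rule iffD1[OF poly_eq_poly_eq_iff])
      (simp add: fun_eq_iff assms algebra_simps power2_eq_square power3_eq_cube)
  then show "coeff q 0 = c0" "coeff q (Suc 0) = c1" by simp_all
qed

text \<open>The restriction to the axis t = 0, which turns the coefficients of pure powers of u into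
  those of an ordinary polynomial.\<close>

definition swap2 :: "complex poly poly \<Rightarrow> complex poly" where
  "swap2 F = map_poly (\<lambda>p. coeff p 0) F"

lemma poly_swap2: "poly (swap2 F) u = poly2 F u 0"
  by (induction F) (simp_all add: swap2_def map_poly_pCons poly_0_coeff_0)

lemma coeff_swap2: "coeff (swap2 F) m = coeff (coeff F m) 0"
  by (simp add: swap2_def coeff_map_poly)

text \<open>The value and the two partial derivatives can be read on the axes u = 0 and t = 0, where
  the local expression is the cubic of \<open>sec_add\<close>.\<close>

lemma local_expr_noncentre:
  fixes v a b :: "complex ^ 3"
  assumes "fst y \<notin> centres" and s: "s \<in> sec_indices"
  defines "F \<equiv> local_expr y (v, a, b) (sec s)"
  shows "coeff (coeff F 0) 0 = sec s v" "coeff (coeff F 0) (Suc 0) = dsec s v b"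
    "coeff (coeff F (Suc 0)) 0 = dsec s v a"
proof -
  obtain G where G: "\<And>u t. poly2 G u t = sec s (\<chi> i. poly2 [:[:v $ i, b $ i:], [:a $ i:]:] u t)"
    using homogeneous_poly_poly2[OF homogeneous_sec[of s], of "\<lambda>i. [:[:v $ i, b $ i:], [:a $ i:]:]"] by blast
  have v: "(\<chi> i. poly2 [:[:v $ i, b $ i:], [:a $ i:]:] u t) = v + u *s a + t *s b" for u t
    by (simp add: vec_eq_iff algebra_simps)
  have G': "poly2 G u t = sec s (v + u *s a + t *s b)" for u t using G[of u t] unfolding v .
  have "F = G" unfolding F_def local_expr_def prod.case
  proof (rule the_equality)
    show "\<forall>u t. if fst y \<in> centres then u * poly2 G u t = sec s (v + u *s (a + t *s b))
      else poly2 G u t = sec s (v + u *s a + t *s b)" using G' assms(1) by simp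
    fix F' assume "\<forall>u t. if fst y \<in> centres then u * poly2 F' u t = sec s (v + u *s (a + t *s b))
      else poly2 F' u t = sec s (v + u *s a + t *s b)"
    then have "poly2 F' u t = poly2 G u t" for u t using G' assms(1) by simp
    then show "F' = G" by (intro poly2_eqI)
  qed
  then have F: "poly2 F u t = sec s (v + u *s a + t *s b)" for u t using G' by simp
  have "poly (coeff F 0) t = sec s v + t * dsec s v b + t\<^sup>2 * dsec s b v + t ^ 3 * sec s b" for t
    using F[of 0 t] sec_add[OF s, of v t b] by (simp add: poly_0_coeff_0)
  from coeff_cubic[OF this] show "coeff (coeff F 0) 0 = sec s v" "coeff (coeff F 0) (Suc 0) = dsec s v b" .
  have "poly (swap2 F) u = sec s v + u * dsec s v a + u\<^sup>2 * dsec s a v + u ^ 3 * sec s a" for u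
    using F[of u 0] sec_add[OF s, of v u a] by (simp add: poly_swap2)
  from coeff_cubic(2)[OF this] show "coeff (coeff F (Suc 0)) 0 = dsec s v a" by (simp add: coeff_swap2)
qed

text \<open>Division by u lowers each order by one: the value of the section is a first derivative
  of the cubic at the centre, and its u-derivative is the second-order term, which
  \<open>sec_add\<close> writes as \<open>dsec s a v\<close>.\<close>

lemma local_expr_centre:
  fixes v a b :: "complex ^ 3"
  assumes "fst y \<in> centres" and s: "s \<in> sec_indices" and 0: "sec s v = 0"
  defines "F \<equiv> local_expr y (v, a, b) (sec s)"
  shows "coeff (coeff F 0) 0 = dsec s v a" "coeff (coeff F 0) (Suc 0) = dsec s v b"
    "coeff (coeff F (Suc 0)) 0 = dsec s a v"
proof -
  obtain G where G: "\<And>u t. poly2 G u t = sec s (\<chi> i. poly2 [:[:v $ i:], [:a $ i, b $ i:]:] u t)"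
    using homogeneous_poly_poly2[OF homogeneous_sec[of s], of "\<lambda>i. [:[:v $ i:], [:a $ i, b $ i:]:]"] by blast
  have v: "(\<chi> i. poly2 [:[:v $ i:], [:a $ i, b $ i:]:] u t) = v + u *s (a + t *s b)" for u t
    by (simp add: vec_eq_iff algebra_simps)
  \<comment> \<open>At u = 0 the cubic is evaluated at v, where it vanishes, so G is divisible by
    u.\<close>
  have "coeff G 0 = 0"
    by (rule iffD1[OF poly_eq_poly_eq_iff]) (use G[of 0] v[of 0] 0 in \<open>simp add: fun_eq_iff poly_0_coeff_0\<close>)
  then obtain H where H: "G = pCons 0 H" by (metis coeff_pCons_0 pCons_cases)
  have H': "u * poly2 H u t = sec s (v + u *s (a + t *s b))" for u t using G[of u t] v[of u t] by (simp add: H)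
  have "F = H" unfolding F_def local_expr_def prod.case
  proof (rule the_equality)
    show "\<forall>u t. if fst y \<in> centres then u * poly2 H u t = sec s (v + u *s (a + t *s b))
      else poly2 H u t = sec s (v + u *s a + t *s b)" using H' assms(1) by simp
    fix F' assume "\<forall>u t. if fst y \<in> centres then u * poly2 F' u t = sec s (v + u *s (a + t *s b))
      else poly2 F' u t = sec s (v + u *s a + t *s b)"
    then have "u * poly2 F' u t = u * poly2 H u t" for u t using H' assms(1) by simp
    then show "F' = H" by (intro poly2_eqI) (metis mult_cancel_left)
  qed
  then have "u * poly2 F u t = u * (dsec s v (a + t *s b) + u * dsec s (a + t *s b) v + u\<^sup>2 * sec s (a + t *s b))" for u t
    using H'[of u t] sec_add[OF s, of v u "a + t *s b"] 0 by (simp add: algebra_simps power2_eq_square power3_eq_cube)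
  then have ne: "poly2 F u t = dsec s v (a + t *s b) + u * dsec s (a + t *s b) v + u\<^sup>2 * sec s (a + t *s b)" if "u \<noteq> 0" for u t
    using that by (metis mult_cancel_left)
  have fix_t: "poly (map_poly (\<lambda>p. poly p t) F) u = poly2 F u t" for u t
    by (induction F) (simp_all add: map_poly_pCons)
  \<comment> \<open>For fixed t both sides are polynomials in u that agree off u = 0. Their equality
    as polynomials extends the formula to the exceptional curve u = 0 itself.\<close>
  have Ft: "map_poly (\<lambda>p. poly p t) F = [:dsec s v (a + t *s b), dsec s (a + t *s b) v, sec s (a + t *s b):]" for t
  proof (rule ccontr)
    let ?D = "map_poly (\<lambda>p. poly p t) F - [:dsec s v (a + t *s b), dsec s (a + t *s b) v, sec s (a + t *s b):]"
    assume "\<not> ?thesis"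
    then have "finite {u. poly ?D u = 0}" by (intro poly_roots_finite) simp
    moreover have "UNIV - {0} \<subseteq> {u. poly ?D u = 0}"
      using ne by (auto simp: fix_t algebra_simps power2_eq_square)
    ultimately have "finite (UNIV - {0 :: complex})" using finite_subset by blast
    then show False using infinite_UNIV_char_0 by (metis finite_Diff2 finite.emptyI finite_insert)
  qed
  have c: "poly (coeff F m) t = coeff [:dsec s v (a + t *s b), dsec s (a + t *s b) v, sec s (a + t *s b):] m" for m t
    using Ft[of t] coeff_map_poly[of "\<lambda>p. poly p t" F m] by simp
  have "poly (coeff F 0) t = dsec s v a + t * dsec s v b + t\<^sup>2 * 0 + t ^ 3 * 0" for t
    using c[of 0 t] dsec_combination[OF s, of v 1 a t b] by simp
  from coeff_cubic[OF this] show "coeff (coeff F 0) 0 = dsec s v a" "coeff (coeff F 0) (Suc 0) = dsec s v b" .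
  show "coeff (coeff F (Suc 0)) 0 = dsec s a v"
    using c[of "Suc 0" 0] by (simp add: poly_0_coeff_0)
qed

section \<open>Base points, charts and the anticanonical map\<close>

lemma ev_eq_0D:
  assumes "ev v = 0"
  shows "\<exists>i\<in>{1..4}. v \<in> vec.span {pt i}"
proof -
  have e: "v $ 1 * v $ 2 * (v $ 2 - v $ 3) = 0" "v $ 1 * v $ 3 * (v $ 3 - v $ 2) = 0"
    "v $ 2 * v $ 1 * (v $ 1 - v $ 3) = 0" "v $ 2 * v $ 3 * (v $ 3 - v $ 1) = 0"
    "v $ 3 * v $ 1 * (v $ 1 - v $ 2) = 0" "v $ 3 * v $ 2 * (v $ 2 - v $ 1) = 0"
    using assms by (simp_all add: ev_def s_form_def vec_eq_iff forall_6)
  have "v = v $ 1 *s pt 1 \<or> v = v $ 2 *s pt 2 \<or> v = v $ 3 *s pt 3 \<or> v = v $ 1 *s pt 4"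
  proof (cases "v $ 1 = 0")
    case True
    then have "v $ 2 = 0 \<or> v $ 3 = 0" using e(4) by simp
    then show ?thesis using True by (auto simp: vec_eq_iff forall_3 pt_def)
  next
    case False
    have "v $ 2 = 0 \<or> v $ 2 = v $ 3" using e(1) False by simp
    moreover have "v $ 3 = 0 \<or> v $ 3 = v $ 2" using e(2) False by simp
    moreover have "v $ 2 = 0 \<or> v $ 1 = v $ 3" using e(3) False by simp
    ultimately have "v $ 2 = 0 \<and> v $ 3 = 0 \<or> v $ 1 = v $ 3 \<and> v $ 2 = v $ 3" by metis
    then show ?thesis by (auto simp: vec_eq_iff forall_3 pt_def)
  qed
  then have "v \<in> vec.span {pt 1} \<or> v \<in> vec.span {pt 2} \<or> v \<in> vec.span {pt 3} \<or> v \<in> vec.span {pt 4}"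
    unfolding in_span1 by blast
  then show ?thesis by (elim disjE) (rule bexI, assumption, simp)+
qed

lemma ball_14: "(\<forall>i\<in>{1..4::nat}. P i) \<longleftrightarrow> P 1 \<and> P 2 \<and> P 3 \<and> P 4"
proof -
  have "{1..4::nat} = {1, 2, 3, 4}" by auto
  then show ?thesis by auto
qed

lemma pt_nonzero: "pt i \<noteq> 0"
  by (auto simp: pt_def vec_eq_iff forall_3)

lemma ev_pt: "i \<in> {1..4} \<Longrightarrow> ev (pt i) = 0"
proof -
  have "\<forall>i\<in>{1..4}. ev (pt i) = 0" unfolding ball_14
    by (simp add: ev_def s_form_def pt_def vec_eq_iff forall_6)
  then show "i \<in> {1..4} \<Longrightarrow> ev (pt i) = 0" by blast
qed

lemma span_in_centres: "v \<noteq> 0 \<Longrightarrow> vec.span {v} \<in> centres \<longleftrightarrow> ev v = 0"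
proof
  assume v: "v \<noteq> 0" "vec.span {v} \<in> centres"
  then obtain i where i: "i \<in> {1..4}" "vec.span {v} = vec.span {pt i}" by (auto simp: centres_def)
  then have "v \<in> vec.span {pt i}" using vec.span_base by blast
  then obtain x where "v = x *s pt i" by (auto simp: in_span1)
  then show "ev v = 0" using ev_pt[OF i(1)] by (simp add: ev_scale)
next
  assume v: "v \<noteq> 0" "ev v = 0"
  then obtain i where "i \<in> {1..4}" "v \<in> vec.span {pt i}" using ev_eq_0D by blast
  then obtain x where i: "i \<in> {1..4}" "v = x *s pt i" unfolding in_span1 by blast
  then have "vec.span {v} = vec.span {pt i}" using v(1) span1_scale by auto
  then show "vec.span {v} \<in> centres" using i(1) by (auto simp: centres_def)
qed

lemma dim_span2:
  assumes "indep2 a b"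
  shows "vec.dim (vec.span {a, b}) = 2"
proof -
  have a: "a \<noteq> 0" and b: "b \<notin> vec.span {a}" using assms indep2_nonzero indep2_iff by blast+
  then have "a \<noteq> b" using vec.span_base by blast
  moreover have "vec.independent {b, a}"
    using a b by (simp add: vec.independent_insert)
  ultimately show ?thesis by (simp add: vec.dim_eq_card_independent insert_commute)
qed

lemma subspace_dim2:
  fixes q :: "complex ^ 'n"
  assumes "vec.subspace l" "vec.dim l = 2" "q \<in> l" "q \<noteq> 0"
  shows "\<exists>a. indep2 q a \<and> l = vec.span {q, a}"
proof -
  have "\<not> l \<subseteq> vec.span {q}"
  proof
    assume "l \<subseteq> vec.span {q}"
    then have "vec.dim l \<le> card {q}" by (intro vec.dim_le_card) auto
    then show False using assms(2) by simp
  qed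
  then obtain a where a: "a \<in> l" "a \<notin> vec.span {q}" by blast
  have i: "indep2 q a" using a assms(4) indep2_iff by blast
  have "vec.span {q, a} \<subseteq> l" using a(1) assms(1, 3) by (intro vec.span_minimal) auto
  then have "vec.span {q, a} = l" using assms(1, 2) dim_span2[OF i]
    by (intro vec.subspace_dim_equal) auto
  then show ?thesis using i by blast
qed

lemma dim_complex3: "vec.dim (UNIV :: (complex ^ 3) set) = 3"
  by (simp only: vec_dim_card) simp

lemma span2_neq_UNIV: "vec.span {a, b :: complex ^ 3} \<noteq> UNIV"
proof
  assume "vec.span {a, b} = UNIV"
  then have "vec.dim (UNIV :: (complex ^ 3) set) \<le> card {a, b}" by (intro vec.dim_le_card) auto
  then show False unfolding dim_complex3 by (simp add: card_insert_if split: if_splits)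
qed

lemma extend_basis1:
  fixes v :: "complex ^ 3"
  assumes "v \<noteq> 0"
  shows "\<exists>a. indep2 v a"
proof -
  have "vec.span {v} \<noteq> UNIV" using span2_neq_UNIV[of v v] by simp
  then show ?thesis using assms indep2_iff by blast
qed

lemma extend_basis2:
  fixes v a :: "complex ^ 3"
  assumes "indep2 v a"
  shows "\<exists>b. vec.span {v, a, b} = UNIV"
proof -
  obtain b where b: "b \<notin> vec.span {a, v}" using span2_neq_UNIV by blast
  have v: "v \<noteq> 0" and a: "a \<notin> vec.span {v}" using assms indep2_nonzero indep2_iff by blast+
  have "v \<noteq> a" using a vec.span_base by blast
  moreover have "b \<noteq> v" "b \<noteq> a" using b vec.span_base by blast+
  ultimately have c: "card {b, a, v} = 3" by auto
  have "vec.independent {v}" using v by (simp add: vec.independent_insert)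
  then have "vec.independent {a, v}" using a by (rule vec.independent_insertI[rotated])
  then have "vec.independent {b, a, v}" using b by (rule vec.independent_insertI[rotated])
  then have "vec.dim (vec.span {b, a, v}) = 3" using c by (simp add: vec.dim_eq_card_independent)
  then have "vec.span {b, a, v} = UNIV"
    by (intro vec.subspace_dim_equal) (simp_all add: dim_complex3 del: vec.dim_UNIV)
  then show ?thesis by (metis insert_commute)
qed

lemma spanning3_indep2:
  fixes v a b :: "complex ^ 3"
  assumes "vec.span {v, a, b} = UNIV"
  shows "indep2 v a"
proof (rule ccontr)
  assume n: "\<not> indep2 v a"
  show False
  proof (cases "v = 0")
    case True
    then show False using assms span2_neq_UNIV vec.span_insert_0 by metis
  next
    case False
    then have "a \<in> vec.span {v}" using n indep2_iff by blast
    then have "a \<in> vec.span {v, b}" by (meson subsetD vec.span_mono insertI1 empty_subsetI insert_subset)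
    then have "vec.span {a, v, b} = vec.span {v, b}" using vec.span_redundant by blast
    then show False using assms span2_neq_UNIV by (metis insert_commute)
  qed
qed

lemma blowup_cases:
  assumes "y \<in> blowup"
  obtains (noncentre) v where "v \<noteq> 0" "ev v \<noteq> 0" "fst y = vec.span {v}" "fst y \<notin> centres"
  | (centre) i a where "i \<in> {1..4}" "indep2 (pt i) a" "fst y = vec.span {pt i}" "snd y i = vec.span {pt i, a}" "fst y \<in> centres"
proof -
  have x: "fst y \<in> proj_space" and l: "snd y \<in> (\<Pi>\<^sub>E i\<in>{1..4}. pencil (pt i))"
    using assms by (auto simp: blowup_def)
  obtain v where v: "v \<noteq> 0" "fst y = vec.span {v}" using x by (auto simp: proj_space_iff)
  show ?thesis
  proof (cases "fst y \<in> centres")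
    case False
    then show ?thesis using v span_in_centres noncentre by metis
  next
    case True
    then obtain i where i: "i \<in> {1..4}" "fst y = vec.span {pt i}" by (auto simp: centres_def)
    have "snd y i \<in> pencil (pt i)" using l i(1) by blast
    then obtain a where "indep2 (pt i) a" "snd y i = vec.span {pt i, a}"
      using subspace_dim2[of "snd y i" "pt i"] pt_nonzero unfolding pencil_def by blast
    then show ?thesis using centre i True by blast
  qed
qed

definition vals :: "blowup_point \<Rightarrow> complex ^ 3 \<Rightarrow> complex ^ 3 \<Rightarrow> complex ^ 6" where
  "vals y v a = (if fst y \<in> centres then dev v a else ev v)"

lemma chartsD:
  assumes "(v, a, b) \<in> charts y"
  shows "vec.span {v, a, b} = UNIV" "fst y = vec.span {v}"
    "i \<in> {1..4} \<Longrightarrow> fst y = vec.span {pt i} \<Longrightarrow> snd y i = vec.span {v, a}"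
  using assms unfolding charts_def by blast+

lemma chartsI:
  assumes "vec.span {v, a, b} = UNIV" "fst y = vec.span {v}"
    "\<And>i. i \<in> {1..4} \<Longrightarrow> fst y = vec.span {pt i} \<Longrightarrow> snd y i = vec.span {v, a}"
  shows "(v, a, b) \<in> charts y"
  using assms unfolding charts_def by blast

lemma chart_nonzero:
  assumes "(v, a, b) \<in> charts y"
  shows "indep2 v a" "v \<noteq> 0" "fst y = vec.span {v}"
proof -
  show "indep2 v a" by (rule spanning3_indep2[OF chartsD(1)[OF assms]])
  then show "v \<noteq> 0" using indep2_nonzero by blast
  show "fst y = vec.span {v}" by (rule chartsD(2)[OF assms])
qed

lemma centre_chart:
  assumes "(v, a, b) \<in> charts y" "fst y \<in> centres"
  shows "ev v = 0"
  using assms chart_nonzero[OF assms(1)] span_in_centres by metis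

lemma sec_0_if_ev_0:
  assumes "ev v = 0" "s \<in> sec_indices"
  shows "sec s v = 0"
proof -
  have "sec_lin s 0 = 0" by (cases s) (simp add: Let_def)
  then show ?thesis using sec_lin_ev[OF assms(2), of v] assms(1) by simp
qed

lemma chart_value:
  assumes "(v, a, b) \<in> charts y" "s \<in> sec_indices"
  shows "coeff (coeff (local_expr y (v, a, b) (sec s)) 0) 0 = sec_lin s (vals y v a)"
proof (cases "fst y \<in> centres")
  case True
  then show ?thesis using local_expr_centre(1)[OF True assms(2)] centre_chart[OF assms(1)] assms(2)
    by (simp add: vals_def sec_lin_dev sec_0_if_ev_0)
next
  case False
  then show ?thesis using local_expr_noncentre(1)[OF False assms(2)] assms(2) by (simp add: vals_def sec_lin_ev)
qed

lemma centres_distinct: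
  assumes "i \<in> {1..4}" "j \<in> {1..4}" "i \<noteq> j"
  shows "indep2 (pt i) (pt j)"
proof -
  have "\<forall>i\<in>{1..4}. \<forall>j\<in>{1..4}. (\<exists>c. pt j = c *s pt i) \<longrightarrow> j = i"
    unfolding ball_14 by (auto simp: pt_def vec_eq_iff forall_3)
  then have "\<not> (\<exists>c. pt j = c *s pt i)" using assms by blast
  then show ?thesis unfolding indep2_iff[OF pt_nonzero] in_span1 by blast
qed

lemma centres_inject:
  assumes "i \<in> {1..4}" "j \<in> {1..4}" "vec.span {pt i} = vec.span {pt j}"
  shows "i = j"
  using assms centres_distinct[of i j] indep2_iff[OF pt_nonzero] vec.span_base by blast

lemma centre_chart_exists:
  assumes "i \<in> {1..4}" "fst y = vec.span {pt i}" "snd y i = vec.span {pt i, a}" "indep2 (pt i) a"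
  shows "\<exists>b. (pt i, a, b) \<in> charts y"
proof -
  obtain b where "vec.span {pt i, a, b} = UNIV" using extend_basis2 assms(4) by metis
  then have "(pt i, a, b) \<in> charts y"
    \<comment> \<open>The condition in \<open>charts\<close> ranges over all four indices; as the
      centres are distinct, it concerns only the index i.\<close>
    using assms centres_inject by (intro chartsI) metis+
  then show ?thesis by blast
qed

lemma noncentre_chart_exists:
  assumes "fst y = vec.span {v}" "v \<noteq> 0" "fst y \<notin> centres" "indep2 v a"
  shows "\<exists>b. (v, a, b) \<in> charts y"
proof -
  obtain b where "vec.span {v, a, b} = UNIV" using extend_basis2 assms(4) by metis
  then have "(v, a, b) \<in> charts y" using assms by (intro chartsI) (auto simp: centres_def)
  then show ?thesis by blast
qed

lemma charts_nonempty:
  assumes "y \<in> blowup"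
  shows "charts y \<noteq> {}"
  using assms
proof (cases rule: blowup_cases)
  case (noncentre v)
  then show ?thesis using noncentre_chart_exists[of y v] extend_basis1[of v] by blast
next
  case (centre i a)
  then show ?thesis using centre_chart_exists[of i y a] by blast
qed

text \<open>Off the centres a new representative \<open>c *s v\<close> multiplies all cubics by
  \<open>c ^ 3\<close>. At a centre the new direction is z v + x a, and all derivatives are
  multiplied by c^2 x, where x is nonzero because the new v and a are independent. The factor is
  common to the six coordinates, so the chart picked by \<open>SOME\<close> in
  \<open>anticanonical\<close> does not matter.\<close>

lemma vals_unique:
  assumes "y \<in> blowup" "(v, a, b) \<in> charts y" "(v', a', b') \<in> charts y"
  shows "\<exists>c. c \<noteq> 0 \<and> vals y v' a' = c *s vals y v a"
proof -
  obtain c where c: "c \<noteq> 0" "v' = c *s v"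
    using chart_nonzero[OF assms(2)] chart_nonzero[OF assms(3)] span1_eqD by metis
  show ?thesis
  proof (cases "fst y \<in> centres")
    case False
    then have "vals y v' a' = c ^ 3 *s vals y v a" by (simp add: vals_def c ev_scale)
    then show ?thesis using c(1) by (metis power_not_zero)
  next
    case True
    then obtain i where i: "i \<in> {1..4}" "fst y = vec.span {pt i}" by (auto simp: centres_def)
    have "vec.span {v, a} = vec.span {v', a'}" using chartsD(3)[OF assms(2) i] chartsD(3)[OF assms(3) i] by simp
    then have "a' \<in> vec.span {v, a}" using vec.span_base[of a' "{v', a'}"] by simp
    then obtain z x where a': "a' = z *s v + x *s a" by (auto simp: in_span2)
    have "x \<noteq> 0"
    proof
      assume "x = 0"
      then have "z *s v' + (- c) *s a' = 0" by (simp add: a' c vec_eq_iff)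
      then show False using chart_nonzero(1)[OF assms(3)] c(1) unfolding indep2_def by (metis neg_equal_0_iff_equal)
    qed
    moreover have "vals y v' a' = (c\<^sup>2 * x) *s vals y v a"
      using True dev_scale[OF centre_chart[OF assms(2) True], of c x a z]
      by (simp add: vals_def c a' add.commute)
    ultimately show ?thesis using c(1) by (metis mult_eq_0_iff power_not_zero)
  qed
qed

lemma s_basis_sec:
  "s_basis 1 = sec (False, 1, 2)" "s_basis 2 = sec (False, 1, 3)" "s_basis 3 = sec (False, 2, 1)"
  "s_basis 4 = sec (False, 2, 3)" "s_basis 5 = sec (False, 3, 1)" "s_basis 6 = sec (False, 3, 2)"
  by (simp_all add: s_basis_def fun_eq_iff)

lemma anticanonical_chart:
  assumes "y \<in> blowup" "(v, a, b) \<in> charts y"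
  shows "anticanonical y = vec.span {vals y v a}"
proof -
  obtain v' a' b' where c: "(SOME c. c \<in> charts y) = (v', a', b')" by (metis prod_cases3)
  then have c': "(v', a', b') \<in> charts y" using charts_nonempty[OF assms(1)] by (metis some_in_eq)
  have "(\<chi> m. coeff (coeff (local_expr y (v', a', b') (s_basis m)) 0) 0) = vals y v' a'"
    unfolding vec_eq_iff forall_6 vec_lambda_beta s_basis_sec
    by (simp add: chart_value[OF c'] index_pairs_eq s_index_def del: sec.simps)
  then have "anticanonical y = vec.span {vals y v' a'}" by (simp add: anticanonical_def c Let_def)
  then show ?thesis using vals_unique[OF assms c'] span1_scale by metis
qed

lemma anticanonical_noncentre:
  assumes "y \<in> blowup" "fst y = vec.span {v}" "v \<noteq> 0" "ev v \<noteq> 0"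
  shows "anticanonical y = vec.span {ev v}"
proof -
  have n: "fst y \<notin> centres" using assms span_in_centres by simp
  obtain a b where "(v, a, b) \<in> charts y"
    using noncentre_chart_exists[OF assms(2, 3) n] extend_basis1[OF assms(3)] by blast
  then show ?thesis using anticanonical_chart[OF assms(1)] n by (simp add: vals_def)
qed

lemma anticanonical_centre:
  assumes "y \<in> blowup" "i \<in> {1..4}" "fst y = vec.span {pt i}" "snd y i = vec.span {pt i, a}" "indep2 (pt i) a"
  shows "anticanonical y = vec.span {dev (pt i) a}"
proof -
  have "fst y \<in> centres" using assms by (auto simp: centres_def)
  moreover obtain b where "(pt i, a, b) \<in> charts y" using centre_chart_exists assms by metis
  ultimately show ?thesis using anticanonical_chart[OF assms(1)] by (simp add: vals_def)
qed

lemma span2_in_pencil: "indep2 q a \<Longrightarrow> vec.span {q, a} \<in> pencil q"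
  using dim_span2[of q a] by (simp add: pencil_def vec.span_base)

lemma blowup_noncentre_exists:
  assumes "ev v \<noteq> 0"
  shows "\<exists>y\<in>blowup. fst y = vec.span {v}"
proof -
  have v: "v \<noteq> 0" using assms ev_scale[of 0 v] by auto
  have i: "indep2 (pt i) v" if "i \<in> {1..4}" for i
  proof -
    have "v \<notin> vec.span {pt i}"
    proof
      assume "v \<in> vec.span {pt i}"
      then obtain c where "v = c *s pt i" by (auto simp: in_span1)
      then show False using assms ev_scale ev_pt[OF that] by auto
    qed
    then show ?thesis using indep2_iff[OF pt_nonzero] by blast
  qed
  have "(vec.span {v}, \<lambda>i\<in>{1..4}. vec.span {pt i, v}) \<in> blowup"
    unfolding blowup_def using v i span2_in_pencil by (auto intro!: vec.span_mono)
  then show ?thesis by force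
qed

lemma blowup_centre_exists:
  assumes "i \<in> {1..4}" "indep2 (pt i) a"
  shows "\<exists>y\<in>blowup. fst y = vec.span {pt i} \<and> snd y i = vec.span {pt i, a}"
proof -
  \<comment> \<open>Over the centre i only the component i is free, and it carries the tangent
    direction; every other component has to be the line through the two centres.\<close>
  let ?l = "\<lambda>j\<in>{1..4}. if j = i then vec.span {pt i, a} else vec.span {pt j, pt i}"
  have "?l \<in> (\<Pi>\<^sub>E j\<in>{1..4}. pencil (pt j))"
    using assms span2_in_pencil centres_distinct by auto
  moreover have "vec.span {pt i} \<subseteq> ?l j" if "j \<in> {1..4}" for j
    using that by (auto intro!: vec.span_mono)
  ultimately have "(vec.span {pt i}, ?l) \<in> blowup" unfolding blowup_def using pt_nonzero by auto
  then show ?thesis using assms(1) by force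
qed

lemma dP5_cases:
  assumes "z \<in> dP5"
  obtains (noncentre) v where "ev v \<noteq> 0" "z = vec.span {ev v}"
  | (centre) i a where "i \<in> {1..4}" "indep2 (pt i) a" "z = vec.span {dev (pt i) a}"
proof -
  obtain y where y: "y \<in> blowup" "z = anticanonical y" using assms by (auto simp: dP5_def)
  from y(1) show ?thesis
    by (cases rule: blowup_cases) (use y anticanonical_noncentre anticanonical_centre noncentre centre in metis)+
qed

lemma dev_in_dP5: "i \<in> {1..4} \<Longrightarrow> indep2 (pt i) a \<Longrightarrow> vec.span {dev (pt i) a} \<in> dP5"
  using blowup_centre_exists[of i a] anticanonical_centre by (metis dP5_def image_eqI)

section \<open>The ten lines\<close>

lemmas line_space_simps = line_space_eqs[unfolded One_nat_def]

lemma vanishing_on_line_space: "w \<in> line_space e \<Longrightarrow> s \<in> sec_indices \<Longrightarrow> e \<in> edges s \<Longrightarrow> sec_lin s w = 0"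
  by (auto simp: line_space_def)

lemma sec_lin_combination: "sec_lin s (x *s v + y *s w) = x * sec_lin s v + y * sec_lin s w"
  by (cases s) (simp add: Let_def algebra_simps)

lemma subspace_line_space: "vec.subspace (line_space e)"
proof -
  have 0: "sec_lin s 0 = 0" for s using sec_lin_combination[of s 0 0 0 0] by simp
  have "sec_lin s (v + w) = sec_lin s v + sec_lin s w" for s v w
    using sec_lin_combination[of s 1 v 1 w] by simp
  moreover have "sec_lin s (c *s v) = c * sec_lin s v" for s c v
    using sec_lin_combination[of s c v 0 0] by simp
  ultimately show ?thesis unfolding vec.subspace_def line_space_def using 0 by auto
qed

lemma homogeneous_sec_lin: "homogeneous_poly 1 (sec_lin s)"
proof (cases s)
  case (fields b i j)
  have "homogeneous_poly 1 (\<lambda>w. sec_lin (b, i, j) w)" unfolding sec_lin.simps Let_def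
    by (cases b) (simp_all add: homogeneous_poly.coord[unfolded One_nat_def] homogeneous_poly_diff homogeneous_poly_cmult)
  then show ?thesis unfolding fields .
qed

lemma closed_line_space: "zariski_closed (proj (line_space e))"
proof -
  let ?F = "{sec_lin s | s. s \<in> sec_indices \<and> e \<in> edges s}"
  have "\<forall>f\<in>?F. \<exists>d. homogeneous_poly d f" using homogeneous_sec_lin by blast
  moreover have "proj (line_space e) = {x \<in> proj_space. \<forall>f\<in>?F. \<forall>v\<in>x. f v = 0}"
    unfolding proj_def line_space_def by blast
  ultimately show ?thesis unfolding zariski_closed_def by blast
qed

lemma pairs5E:
  assumes "e \<in> pairs5"
  obtains h k where "h \<in> {1..5}" "k \<in> {1..5}" "h \<noteq> k" "e = {h, k}"
  using assms
proof (cases rule: pairs5_cases)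
  case 1 show ?thesis by (rule that[OF _ _ _ 1]) simp_all
next
  case 2 show ?thesis by (rule that[OF _ _ _ 2]) simp_all
next
  case 3 show ?thesis by (rule that[OF _ _ _ 3]) simp_all
next
  case 4 show ?thesis by (rule that[OF _ _ _ 4]) simp_all
next
  case 5 show ?thesis by (rule that[OF _ _ _ 5]) simp_all
next
  case 6 show ?thesis by (rule that[OF _ _ _ 6]) simp_all
next
  case 7 show ?thesis by (rule that[OF _ _ _ 7]) simp_all
next
  case 8 show ?thesis by (rule that[OF _ _ _ 8]) simp_all
next
  case 9 show ?thesis by (rule that[OF _ _ _ 9]) simp_all
next
  case 10 show ?thesis by (rule that[OF _ _ _ 10]) simp_all
qed

lemma line_space_basis:
  assumes "e \<in> pairs5"
  shows "\<exists>a b. indep2 a b \<and> line_space e = vec.span {a, b}"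
proof -
  \<comment> \<open>The plane is a graph over its coordinates i and j; a and b are its elements with
    these coordinates (1, 0) and (0, 1).\<close>
  have *: "\<exists>a b. indep2 a b \<and> line_space e = vec.span {a, b}"
    if "\<And>w. w \<in> line_space e \<longleftrightarrow> w = w $ i *s a + w $ j *s b" "a $ i = 1" "a $ j = 0" "b $ i = 0" "b $ j = 1" for e a b i j
  proof (intro exI conjI)
    show "indep2 a b" by (rule indep2_by_coordinates[of _ i _ j]) (simp add: that)
    have "x *s a + y *s b \<in> line_space e" for x y unfolding that(1) by (simp add: that)
    then show "line_space e = vec.span {a, b}" using that(1) unfolding Set.set_eq_iff in_span2 by metis
  qed
  show ?thesis using assms
  proof (cases rule: pairs5_cases)
    case 1 show ?thesis unfolding 1
      by (rule *[of _ 1 "v6 1 0 1 0 0 0" 2 "v6 0 1 0 1 0 0"]; force simp: line_space_simps vec_eq_iff forall_6)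
  next
    case 2 show ?thesis unfolding 2
      by (rule *[of _ 1 "v6 1 0 0 0 0 1" 2 "v6 0 1 0 0 1 0"]; force simp: line_space_simps vec_eq_iff forall_6)
  next
    case 3 show ?thesis unfolding 3
      by (rule *[of _ 4 "v6 0 0 0 1 0 0" 6 "v6 0 0 0 0 0 1"]; force simp: line_space_simps vec_eq_iff forall_6)
  next
    case 4 show ?thesis unfolding 4
      by (rule *[of _ 3 "v6 0 0 1 0 0 0" 5 "v6 0 0 0 0 1 0"]; force simp: line_space_simps vec_eq_iff forall_6)
  next
    case 5 show ?thesis unfolding 5
      by (rule *[of _ 3 "v6 0 0 1 0 1 0" 4 "v6 0 0 0 1 0 1"]; force simp: line_space_simps vec_eq_iff forall_6)
  next
    case 6 show ?thesis unfolding 6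
      by (rule *[of _ 2 "v6 0 1 0 0 0 0" 5 "v6 0 0 0 0 1 0"]; force simp: line_space_simps vec_eq_iff forall_6)
  next
    case 7 show ?thesis unfolding 7
      by (rule *[of _ 1 "v6 1 0 0 0 0 0" 6 "v6 0 0 0 0 0 1"]; force simp: line_space_simps vec_eq_iff forall_6)
  next
    case 8 show ?thesis unfolding 8
      by (rule *[of _ 1 "v6 1 0 0 0 0 0" 3 "v6 0 0 1 0 0 0"]; force simp: line_space_simps vec_eq_iff forall_6)
  next
    case 9 show ?thesis unfolding 9
      by (rule *[of _ 2 "v6 0 1 0 0 0 0" 4 "v6 0 0 0 1 0 0"]; force simp: line_space_simps vec_eq_iff forall_6)
  next
    case 10 show ?thesis unfolding 10
      by (rule *[of _ 1 "v6 1 (-1) 1 (-1) 0 0" 5 "v6 0 0 1 (-1) 1 (-1)"]; force simp: line_space_simps vec_eq_iff forall_6)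
  qed
qed

lemma irreducible_curve_line_space: "e \<in> pairs5 \<Longrightarrow> irreducible_curve (proj (line_space e))"
  using line_space_basis closed_line_space irreducible_curve_line by metis

text \<open>The non-adjacent pairs of the Petersen graph: for two edges with one common index the
  two systems of four equations have joint rank six.\<close>

lemma line_space_meet_trivial:
  assumes "e \<in> pairs5" "e' \<in> pairs5" "e \<noteq> e'" "e \<inter> e' \<noteq> {}" "w \<in> line_space e" "w \<in> line_space e'"
  shows "w = 0"
proof -
  have "w $ 1 = 0 \<and> w $ 2 = 0 \<and> w $ 3 = 0 \<and> w $ 4 = 0 \<and> w $ 5 = 0 \<and> w $ 6 = 0"
    using assms(1)
  proof (cases rule: pairs5_cases)
    case 1
    show ?thesis using assms(2)
      by (cases rule: pairs5_cases; (use assms(4)[unfolded 1] in \<open>simp; fail\<close>)?;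
          use assms(3, 5, 6)[unfolded 1] in \<open>simp add: line_space_simps\<close>)
  next
    case 2
    show ?thesis using assms(2)
      by (cases rule: pairs5_cases; (use assms(4)[unfolded 2] in \<open>simp; fail\<close>)?;
          use assms(3, 5, 6)[unfolded 2] in \<open>simp add: line_space_simps\<close>)
  next
    case 3
    show ?thesis using assms(2)
      by (cases rule: pairs5_cases; (use assms(4)[unfolded 3] in \<open>simp; fail\<close>)?;
          use assms(3, 5, 6)[unfolded 3] in \<open>simp add: line_space_simps\<close>)
  next
    case 4
    show ?thesis using assms(2)
      by (cases rule: pairs5_cases; (use assms(4)[unfolded 4] in \<open>simp; fail\<close>)?;
          use assms(3, 5, 6)[unfolded 4] in \<open>simp add: line_space_simps\<close>)
  next
    case 5
    show ?thesis using assms(2)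
      by (cases rule: pairs5_cases; (use assms(4)[unfolded 5] in \<open>simp; fail\<close>)?;
          use assms(3, 5, 6)[unfolded 5] in \<open>simp add: line_space_simps\<close>)
  next
    case 6
    show ?thesis using assms(2)
      by (cases rule: pairs5_cases; (use assms(4)[unfolded 6] in \<open>simp; fail\<close>)?;
          use assms(3, 5, 6)[unfolded 6] in \<open>simp add: line_space_simps\<close>)
  next
    case 7
    show ?thesis using assms(2)
      by (cases rule: pairs5_cases; (use assms(4)[unfolded 7] in \<open>simp; fail\<close>)?;
          use assms(3, 5, 6)[unfolded 7] in \<open>simp add: line_space_simps\<close>)
  next
    case 8
    show ?thesis using assms(2)
      by (cases rule: pairs5_cases; (use assms(4)[unfolded 8] in \<open>simp; fail\<close>)?;
          use assms(3, 5, 6)[unfolded 8] in \<open>simp add: line_space_simps\<close>)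
  next
    case 9
    show ?thesis using assms(2)
      by (cases rule: pairs5_cases; (use assms(4)[unfolded 9] in \<open>simp; fail\<close>)?;
          use assms(3, 5, 6)[unfolded 9] in \<open>simp add: line_space_simps\<close>)
  next
    case 10
    show ?thesis using assms(2)
      by (cases rule: pairs5_cases; (use assms(4)[unfolded 10] in \<open>simp; fail\<close>)?;
          use assms(3, 5, 6)[unfolded 10] in \<open>simp add: line_space_simps\<close>)
  qed
  then show ?thesis by (simp add: vec_eq_iff forall_6)
qed

text \<open>The fifteen adjacent pairs of the Petersen graph, each with its intersection point as an
  explicit vector.\<close>

lemma line_space_meet:
  assumes "e \<in> pairs5" "e' \<in> pairs5" "e \<inter> e' = {}"
  shows "\<exists>w. w \<noteq> 0 \<and> w \<in> line_space e \<and> w \<in> line_space e'"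
proof -
  define P where "P e e' \<longleftrightarrow> (\<exists>w. w \<noteq> 0 \<and> w \<in> line_space e \<and> w \<in> line_space e')" for e e'
  have I: "w \<noteq> 0 \<Longrightarrow> w \<in> line_space e \<Longrightarrow> w \<in> line_space e' \<Longrightarrow> P e e'" for w e e'
    unfolding P_def by blast
  have P1534: "P {1, 5} {3, 4}"
    by (rule I[of "v6 0 0 1 0 0 0"]) (simp_all add: line_space_simps vec_eq_iff forall_6)
  have P1524: "P {1, 5} {2, 4}"
    by (rule I[of "v6 0 0 0 0 1 0"]) (simp_all add: line_space_simps vec_eq_iff forall_6)
  have P1523: "P {1, 5} {2, 3}"
    by (rule I[of "v6 0 0 1 0 1 0"]) (simp_all add: line_space_simps vec_eq_iff forall_6)
  have P2534: "P {2, 5} {3, 4}"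
    by (rule I[of "v6 1 0 0 0 0 0"]) (simp_all add: line_space_simps vec_eq_iff forall_6)
  have P2514: "P {2, 5} {1, 4}"
    by (rule I[of "v6 0 0 0 0 0 1"]) (simp_all add: line_space_simps vec_eq_iff forall_6)
  have P2513: "P {2, 5} {1, 3}"
    by (rule I[of "v6 1 0 0 0 0 1"]) (simp_all add: line_space_simps vec_eq_iff forall_6)
  have P3524: "P {3, 5} {2, 4}"
    by (rule I[of "v6 0 1 0 0 0 0"]) (simp_all add: line_space_simps vec_eq_iff forall_6)
  have P3514: "P {3, 5} {1, 4}"
    by (rule I[of "v6 0 0 0 1 0 0"]) (simp_all add: line_space_simps vec_eq_iff forall_6)
  have P3512: "P {3, 5} {1, 2}"
    by (rule I[of "v6 0 1 0 1 0 0"]) (simp_all add: line_space_simps vec_eq_iff forall_6)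
  have P4512: "P {4, 5} {1, 2}"
    by (rule I[of "v6 1 (-1) 1 (-1) 0 0"]) (simp_all add: line_space_simps vec_eq_iff forall_6)
  have P4513: "P {4, 5} {1, 3}"
    by (rule I[of "v6 1 (-1) 0 0 (-1) 1"]) (simp_all add: line_space_simps vec_eq_iff forall_6)
  have P4523: "P {4, 5} {2, 3}"
    by (rule I[of "v6 0 0 1 (-1) 1 (-1)"]) (simp_all add: line_space_simps vec_eq_iff forall_6)
  have P1234: "P {1, 2} {3, 4}"
    by (rule I[of "v6 1 0 1 0 0 0"]) (simp_all add: line_space_simps vec_eq_iff forall_6)
  have P1324: "P {1, 3} {2, 4}"
    by (rule I[of "v6 0 1 0 0 1 0"]) (simp_all add: line_space_simps vec_eq_iff forall_6)
  have P2314: "P {2, 3} {1, 4}"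
    by (rule I[of "v6 0 0 0 1 0 1"]) (simp_all add: line_space_simps vec_eq_iff forall_6)
  note all = P1534 P1524 P1523 P2534 P2514 P2513 P3524 P3514 P3512 P4512 P4513 P4523 P1234 P1324 P2314
  have sym: "P e e' \<Longrightarrow> P e' e" for e e' unfolding P_def by blast
  have "\<forall>e\<in>pairs5. \<forall>e'\<in>pairs5. e \<inter> e' = {} \<longrightarrow> P e e'"
    unfolding pairs5_def using all all[THEN sym] by simp
  then have "P e e'" using assms by blast
  then show ?thesis unfolding P_def .
qed

text \<open>If e and e' are disjoint, some index m lies in neither. The edge \<open>{h', m}\<close>
  is disjoint from e but shares h' with e', so its line meets the line of e and misses that of e'.
  Edges with a common index are separated by \<open>line_space_meet_trivial\<close>
  directly.\<close>

lemma line_space_inject: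
  assumes "e \<in> pairs5" "e' \<in> pairs5" "line_space e = line_space e'"
  shows "e = e'"
proof (rule ccontr)
  assume n: "e \<noteq> e'"
  obtain a b where ab: "indep2 a b" "line_space e = vec.span {a, b}" using line_space_basis assms(1) by blast
  have a: "a \<noteq> 0" "a \<in> line_space e" using ab indep2_nonzero vec.span_base by blast+
  show False
  proof (cases "e \<inter> e' = {}")
    case False
    then show False using line_space_meet_trivial[OF assms(1, 2) n] a assms(3) by metis
  next
    case True
    obtain h k where e: "h \<in> {1..5}" "k \<in> {1..5}" "h \<noteq> k" "e = {h, k}" using assms(1) pairs5E by metis
    obtain h' k' where e': "h' \<in> {1..5}" "k' \<in> {1..5}" "h' \<noteq> k'" "e' = {h', k'}" using assms(2) pairs5E by metis
    have "card {h, k, h', k'} \<le> 4" by (simp add: card_insert_if)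
    then have "\<not> {1..5} \<subseteq> {h, k, h', k'}" using card_mono[of "{h, k, h', k'}" "{1..5}"] by fastforce
    then obtain m where m: "m \<in> {1..5}" "m \<notin> {h, k, h', k'}" by blast
    have f: "{h', m} \<in> pairs5" "e \<inter> {h', m} = {}" "e' \<noteq> {h', m}" "e' \<inter> {h', m} \<noteq> {}"
      using e e' m True doubleton_in_pairs5 by (auto simp: doubleton_eq_iff)
    then obtain w where "w \<noteq> 0" "w \<in> line_space e" "w \<in> line_space {h', m}"
      using line_space_meet assms(1) by blast
    then show False using line_space_meet_trivial[OF assms(2) f(1, 3, 4)] assms(3) by blast
  qed
qed

section \<open>Strict transforms and exceptional curves as projective lines\<close>

lemma plane_lines:
  "v $ 3 = 0 \<Longrightarrow> ev v \<in> line_space {3, 4}" "v $ 2 = 0 \<Longrightarrow> ev v \<in> line_space {2, 4}"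
  "v $ 1 = 0 \<Longrightarrow> ev v \<in> line_space {1, 4}" "v $ 2 = v $ 3 \<Longrightarrow> ev v \<in> line_space {2, 3}"
  "v $ 1 = v $ 3 \<Longrightarrow> ev v \<in> line_space {1, 3}" "v $ 1 = v $ 2 \<Longrightarrow> ev v \<in> line_space {1, 2}"
  by (simp_all add: line_space_simps ev_def s_form_def)

lemma exceptional_lines:
  "dev (pt 1) a \<in> line_space {1, 5}" "dev (pt 2) a \<in> line_space {2, 5}"
  "dev (pt 3) a \<in> line_space {3, 5}" "dev (pt 4) a \<in> line_space {4, 5}"
  by (simp_all add: line_space_simps dev_def dS_def Let_def pt_def)

lemma exceptional_meets_plane_lines:
  "a $ 2 = 0 \<Longrightarrow> dev (pt 1) a \<in> line_space {2, 4}" "a $ 3 = 0 \<Longrightarrow> dev (pt 1) a \<in> line_space {3, 4}"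
  "a $ 2 = a $ 3 \<Longrightarrow> dev (pt 1) a \<in> line_space {2, 3}"
  "a $ 1 = 0 \<Longrightarrow> dev (pt 2) a \<in> line_space {1, 4}" "a $ 3 = 0 \<Longrightarrow> dev (pt 2) a \<in> line_space {3, 4}"
  "a $ 1 = a $ 3 \<Longrightarrow> dev (pt 2) a \<in> line_space {1, 3}"
  "a $ 1 = 0 \<Longrightarrow> dev (pt 3) a \<in> line_space {1, 4}" "a $ 2 = 0 \<Longrightarrow> dev (pt 3) a \<in> line_space {2, 4}"
  "a $ 1 = a $ 2 \<Longrightarrow> dev (pt 3) a \<in> line_space {1, 2}"
  "a $ 1 = a $ 2 \<Longrightarrow> dev (pt 4) a \<in> line_space {1, 2}" "a $ 1 = a $ 3 \<Longrightarrow> dev (pt 4) a \<in> line_space {1, 3}"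
  "a $ 2 = a $ 3 \<Longrightarrow> dev (pt 4) a \<in> line_space {2, 3}"
  by (simp_all add: line_space_simps dev_def dS_def Let_def pt_def)

text \<open>The basis expansion hides the factors: each of these sections is one coordinate line
  times two lines through (1:1:1).\<close>

lemma sigma_form_eq:
  "sigma_form (Suc 0) 2 v = v $ 3 * (v $ 1 - v $ 2) * (v $ 3 - v $ 1)"
  "sigma_form (Suc 0) 3 v = - (v $ 2 * (v $ 1 - v $ 3) * (v $ 2 - v $ 1))"
  "sigma_form 2 (Suc 0) v = - (v $ 3 * (v $ 2 - v $ 1) * (v $ 3 - v $ 2))"
  "sigma_form 2 3 v = v $ 1 * (v $ 2 - v $ 3) * (v $ 1 - v $ 2)"
  "sigma_form 3 (Suc 0) v = v $ 2 * (v $ 3 - v $ 1) * (v $ 2 - v $ 3)"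
  "sigma_form 3 2 v = - (v $ 1 * (v $ 3 - v $ 2) * (v $ 1 - v $ 3))"
  by (simp_all add: sigma_form_def s_form_def Let_def sign_perm3 algebra_simps)

lemma sec_zero_noncentre:
  assumes "s \<in> sec_indices" "sec s v = 0"
  shows "\<exists>e\<in>edges s. ev v \<in> line_space e"
proof -
  have "\<forall>s\<in>sec_indices. sec s v = 0 \<longrightarrow> (\<exists>e\<in>edges s. ev v \<in> line_space e)"
    unfolding ball_sec_indices all_bool_eq
    using plane_lines[of v] by (simp add: edges_simps sigma_form_eq s_form_def; metis)
  then show ?thesis using assms by blast
qed

lemma sec_zero_centre:
  assumes "s \<in> sec_indices" "i \<in> {1..4}" "dsec s (pt i) a = 0"
  shows "\<exists>e\<in>edges s. dev (pt i) a \<in> line_space e"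
proof -
  have "\<forall>i\<in>{1..4}. \<forall>s\<in>sec_indices. dsec s (pt i) a = 0 \<longrightarrow> (\<exists>e\<in>edges s. dev (pt i) a \<in> line_space e)"
    unfolding ball_14 ball_sec_indices all_bool_eq
    using exceptional_lines[of a] exceptional_meets_plane_lines[of a] 
    by (simp add: edges_simps dS_def pt_def Let_def sign_perm3; metis)
  then show ?thesis using assms by blast
qed

text \<open>Adding a multiple of the centre to a leaves \<open>dev\<close> unchanged, so one
  coordinate of a can be normalized to 0; the other two are then read off from w.\<close>

lemma dev_surj:
  assumes "i \<in> {1..4}" "w \<in> line_space {i, 5}"
  shows "\<exists>a. dev (pt i) a = w"
proof -
  have "\<forall>i\<in>{1..4}. w \<in> line_space {i, 5} \<longrightarrow> (\<exists>a. dev (pt i) a = w)"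
    unfolding ball_14
  proof (intro conjI impI)
    show "\<exists>a. dev (pt 1) a = w" if "w \<in> line_space {1, 5}"
      using that by (intro exI[of _ "vector [0, w $ 3, w $ 5]"])
        (simp add: line_space_simps dev_def dS_def Let_def pt_def vec_eq_iff forall_6)
    show "\<exists>a. dev (pt 2) a = w" if "w \<in> line_space {2, 5}"
      using that by (intro exI[of _ "vector [w $ 1, 0, w $ 6]"])
        (simp add: line_space_simps dev_def dS_def Let_def pt_def vec_eq_iff forall_6)
    show "\<exists>a. dev (pt 3) a = w" if "w \<in> line_space {3, 5}"
      using that by (intro exI[of _ "vector [w $ 2, w $ 4, 0]"])
        (simp add: line_space_simps dev_def dS_def Let_def pt_def vec_eq_iff forall_6)
    show "\<exists>a. dev (pt 4) a = w" if "w \<in> line_space {4, 5}"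
      using that by (intro exI[of _ "vector [w $ 1 + w $ 5, w $ 1, 0]"])
        (simp add: line_space_simps dev_def dS_def Let_def pt_def vec_eq_iff forall_6)
  qed
  then show ?thesis using assms by blast
qed

lemma dev_scale_pt: "i \<in> {1..4} \<Longrightarrow> dev (pt i) (c *s pt i) = 0"
  using ev_pt[of i] by (simp add: dev_def dS_simps ev_def vec_eq_iff forall_6) (simp add: dS_simps(2)[where y = 0, simplified] dS_simps(3))

lemma dev_nonzero:
  assumes "i \<in> {1..4}" "indep2 (pt i) a"
  shows "dev (pt i) a \<noteq> 0"
proof -
  have "\<forall>i\<in>{1..4}. dev (pt i) a = 0 \<longrightarrow> (\<exists>c. a = c *s pt i)"
    unfolding ball_14
  proof (intro conjI impI)
    show "\<exists>c. a = c *s pt 1" if "dev (pt 1) a = 0"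
      using that by (intro exI[of _ "a $ 1"]) (simp add: dev_def dS_def Let_def pt_def vec_eq_iff forall_6 forall_3)
    show "\<exists>c. a = c *s pt 2" if "dev (pt 2) a = 0"
      using that by (intro exI[of _ "a $ 2"]) (simp add: dev_def dS_def Let_def pt_def vec_eq_iff forall_6 forall_3)
    show "\<exists>c. a = c *s pt 3" if "dev (pt 3) a = 0"
      using that by (intro exI[of _ "a $ 3"]) (simp add: dev_def dS_def Let_def pt_def vec_eq_iff forall_6 forall_3)
    show "\<exists>c. a = c *s pt 4" if "dev (pt 4) a = 0"
    proof -
      have "dev (pt 4) a $ 1 = 0" "dev (pt 4) a $ 3 = 0" using that by simp_all
      then have "a $ 2 = a $ 3" "a $ 1 = a $ 3"
        by (simp_all add: dev_def dS_def Let_def pt_def)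
      then show ?thesis by (intro exI[of _ "a $ 3"]) (simp add: pt_def vec_eq_iff forall_3)
    qed
  qed
  then have "dev (pt i) a = 0 \<Longrightarrow> a \<in> vec.span {pt i}" using assms(1) unfolding in_span1 by blast
  then show ?thesis using assms(2) indep2_iff[OF pt_nonzero] by blast
qed

lemma exceptional_line: "i \<in> {1..4} \<Longrightarrow> dev (pt i) a \<in> line_space {i, 5}"
proof -
  have "\<forall>i\<in>{1..4}. dev (pt i) a \<in> line_space {i, 5}" unfolding ball_14 using exceptional_lines by blast
  then show "i \<in> {1..4} \<Longrightarrow> dev (pt i) a \<in> line_space {i, 5}" by blast
qed

lemma proj_exceptional:
  assumes i: "i \<in> {1..4}" and z: "z \<in> proj (line_space {i, 5})"
  shows "\<exists>a. indep2 (pt i) a \<and> z = vec.span {dev (pt i) a}"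
proof -
  obtain w where w: "w \<noteq> 0" "z = vec.span {w}" using z by (auto simp: proj_def proj_space_iff)
  then have "w \<in> line_space {i, 5}" using z span1_in_proj[OF subspace_line_space] by auto
  then obtain a where a: "dev (pt i) a = w" using dev_surj i by blast
  have "a \<notin> vec.span {pt i}" using a w(1) dev_scale_pt[OF i] by (auto simp: in_span1)
  then show ?thesis using a w(2) indep2_iff[OF pt_nonzero] by blast
qed

lemma exceptional_curve_eq:
  assumes i: "i \<in> {1..4}"
  shows "exceptional_curve i = proj (line_space {i, 5})"
proof
  show "exceptional_curve i \<subseteq> proj (line_space {i, 5})"
  proof
    fix z assume "z \<in> exceptional_curve i"
    then obtain y where y: "y \<in> blowup" "fst y = vec.span {pt i}" "z = anticanonical y"
      by (auto simp: exceptional_curve_def)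
    have "snd y i \<in> pencil (pt i)" using y(1) i by (auto simp: blowup_def)
    then obtain a where a: "indep2 (pt i) a" "snd y i = vec.span {pt i, a}"
      using subspace_dim2[of "snd y i" "pt i"] pt_nonzero unfolding pencil_def by blast
    then have "z = vec.span {dev (pt i) a}" using anticanonical_centre y i by blast
    then show "z \<in> proj (line_space {i, 5})"
      using span1_in_proj[OF subspace_line_space] dev_nonzero[OF i a(1)] exceptional_line[OF i] by auto
  qed
  show "proj (line_space {i, 5}) \<subseteq> exceptional_curve i"
  proof
    fix z assume "z \<in> proj (line_space {i, 5})"
    then obtain a where a: "indep2 (pt i) a" "z = vec.span {dev (pt i) a}" using proj_exceptional i by blast
    obtain y where "y \<in> blowup" "fst y = vec.span {pt i}" "snd y i = vec.span {pt i, a}"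
      using blowup_centre_exists[OF i a(1)] by blast
    moreover from this have "anticanonical y = z" using anticanonical_centre[OF _ i] a by blast
    ultimately show "z \<in> exceptional_curve i" unfolding exceptional_curve_def by blast
  qed
qed

lemma exceptional_in_dP5: "i \<in> {1..4} \<Longrightarrow> proj (line_space {i, 5}) \<subseteq> dP5"
  using proj_exceptional dev_in_dP5 by blast

text \<open>On the line through two base points the pure cubes drop out of the cubics. What remains
  has the factor x y, and the quotient is linear in (x, y): this is why the strict transform is
  embedded as a line.\<close>

lemma ev_combination:
  assumes "ev p = 0" "ev q = 0"
  shows "ev (x *s p + y *s q) = (x\<^sup>2 * y) *s dev p q + (x * y\<^sup>2) *s dev q p"
proof -
  have "s_form i j (x *s p + y *s q) = (x\<^sup>2 * y) * dS i j p q + (x * y\<^sup>2) * dS i j q p" 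
    if "s_form i j p = 0" "s_form i j q = 0" for i j
  proof -
    have "s_form i j (x *s p + y *s q) = x ^ 3 * s_form i j p + (x\<^sup>2 * y) * dS i j p q + (x * y\<^sup>2) * dS i j q p + y ^ 3 * s_form i j q"
      by (simp add: s_form_def dS_def Let_def algebra_simps power2_eq_square power3_eq_cube)
    then show ?thesis using that by simp
  qed
  then show ?thesis using assms by (simp add: ev_def dev_def vec_eq_iff forall_6)
qed

text \<open>By \<open>ev_combination\<close> the point x p_i + t p_j goes to x
  \<open>dev (pt i) (pt j)\<close> + t \<open>dev (pt j) (pt i)\<close>. The image contains all
  points with x and t nonzero, an infinite subset of the projective line, so its closure is the
  whole line. The two points with x = 0 or t = 0 belong to the surface because they come from the
  exceptional curves.\<close>

lemma strict_transform_eq: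
  assumes i: "i \<in> {1..4}" and j: "j \<in> {1..4}" and e: "e \<in> pairs5" and ij: "i \<noteq> j"
    and D: "dev (pt i) (pt j) \<in> line_space e" "dev (pt j) (pt i) \<in> line_space e"
      "indep2 (dev (pt i) (pt j)) (dev (pt j) (pt i))"
  shows "strict_transform (vec.span {pt i, pt j}) = proj (line_space e)" "proj (line_space e) \<subseteq> dP5"
proof -
  let ?a = "dev (pt i) (pt j)" and ?b = "dev (pt j) (pt i)"
  let ?I = "anticanonical ` {y \<in> blowup. fst y \<subseteq> vec.span {pt i, pt j} \<and> fst y \<notin> centres}"
  obtain a b where "line_space e = vec.span {a, b}" using line_space_basis[OF e] by blast
  then have L: "line_space e = vec.span {?a, ?b}" using span2_eq D by metis
  note ev_c = ev_combination[OF ev_pt[OF i] ev_pt[OF j]]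
  have sub: "?I \<subseteq> proj (line_space e)"
  proof
    fix z assume "z \<in> ?I"
    then obtain y where y: "y \<in> blowup" "fst y \<subseteq> vec.span {pt i, pt j}" "fst y \<notin> centres" "z = anticanonical y" by blast
    from y(1) obtain v where v: "v \<noteq> 0" "ev v \<noteq> 0" "fst y = vec.span {v}"
      by (cases rule: blowup_cases) (use y(3) in auto)
    then have z: "z = vec.span {ev v}" using anticanonical_noncentre y by blast
    have "v \<in> vec.span {pt i, pt j}" using y(2) v(3) vec.span_base by blast
    then obtain x t where "v = x *s pt i + t *s pt j" by (auto simp: in_span2)
    then have "ev v \<in> line_space e" unfolding L in_span2 using ev_c by blast
    then show "z \<in> proj (line_space e)" using z v(2) span1_in_proj[OF subspace_line_space] by blast
  qed
  have in_I: "vec.span {x *s ?a + t *s ?b} \<in> ?I" if "x \<noteq> 0" "t \<noteq> 0" for x t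
  proof -
    let ?v = "x *s pt i + t *s pt j"
    have ev: "ev ?v = (x * t) *s (x *s ?a + t *s ?b)"
      unfolding ev_c by (simp add: vec.scale_right_distrib power2_eq_square ac_simps)
    have "x *s ?a + t *s ?b \<noteq> 0" using D(3) that unfolding indep2_def by blast
    then have nz: "ev ?v \<noteq> 0" unfolding ev vec.scale_eq_0_iff using that by simp
    then have v: "?v \<noteq> 0" using ev_scale[of 0 ?v] by auto
    obtain y where y: "y \<in> blowup" "fst y = vec.span {?v}" using blowup_noncentre_exists[OF nz] by blast
    have "?v \<in> vec.span {pt i, pt j}" unfolding in_span2 by blast
    then have "fst y \<subseteq> vec.span {pt i, pt j}" unfolding y(2) span1_subset[OF vec.subspace_span] .
    moreover have "fst y \<notin> centres" using y(2) span_in_centres[OF v] nz by simp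
    moreover have "anticanonical y = vec.span {x *s ?a + t *s ?b}"
      unfolding anticanonical_noncentre[OF y v nz] ev by (rule span1_scale) (use that in simp)
    ultimately show ?thesis using y(1) by blast
  qed
  have inf: "infinite ?I"
  proof
    assume fin: "finite ?I"
    have "(\<lambda>t. vec.span {?a + t *s ?b}) ` (UNIV - {0}) \<subseteq> ?I" using in_I[of 1] by auto
    then have "finite ((\<lambda>t. vec.span {?a + t *s ?b}) ` (UNIV - {0}))" using fin finite_subset by blast
    then have "finite (UNIV - {0 :: complex})"
      by (rule finite_imageD) (use inj_span_affine[OF D(3)] in \<open>auto intro: inj_on_subset\<close>)
    then show False using infinite_UNIV_char_0 by (metis finite_Diff2 finite.emptyI finite_insert)
  qed
  show "strict_transform (vec.span {pt i, pt j}) = proj (line_space e)"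
    unfolding strict_transform_def zariski_closure_def
  proof (intro subset_antisym Inter_lower Inter_greatest)
    show "proj (line_space e) \<in> {X. zariski_closed X \<and> ?I \<subseteq> X}" using sub closed_line_space by blast
    fix X assume "X \<in> {X. zariski_closed X \<and> ?I \<subseteq> X}"
    then have X: "zariski_closed X" "?I \<subseteq> X" by blast+
    have "?I \<subseteq> X \<inter> proj (line_space e)" using X sub by blast
    then have "infinite (X \<inter> proj (line_space e))" using inf finite_subset by blast
    then show "proj (line_space e) \<subseteq> X" using closed_contains_line[OF X(1) D(3)] L by simp
  qed
  show "proj (line_space e) \<subseteq> dP5"
  proof
    fix z assume z: "z \<in> proj (line_space e)"
    then obtain w where w: "w \<noteq> 0" "z = vec.span {w}" by (auto simp: proj_def proj_space_iff)
    then have "w \<in> line_space e" using z span1_in_proj[OF subspace_line_space] by auto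
    then obtain x t where xt: "w = x *s ?a + t *s ?b" unfolding L in_span2 by blast
    show "z \<in> dP5"
    proof (cases "x = 0 \<or> t = 0")
      case False
      then show ?thesis using in_I[of x t] xt w by (auto simp: dP5_def)
    next
      case True
      then have "z = vec.span {?a} \<or> z = vec.span {?b}" using xt w span1_scale
        by (metis add.left_neutral add.right_neutral vec.scale_zero_left)
      then show ?thesis using dev_in_dP5 i j centres_distinct ij by metis
    qed
  qed
qed

lemma strict_transforms:
  "strict_transform (vec.span {pt 1, pt 2}) = proj (line_space {3, 4}) \<and> proj (line_space {3, 4}) \<subseteq> dP5"
  "strict_transform (vec.span {pt 1, pt 3}) = proj (line_space {2, 4}) \<and> proj (line_space {2, 4}) \<subseteq> dP5"
  "strict_transform (vec.span {pt 2, pt 3}) = proj (line_space {1, 4}) \<and> proj (line_space {1, 4}) \<subseteq> dP5"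
  "strict_transform (vec.span {pt 1, pt 4}) = proj (line_space {2, 3}) \<and> proj (line_space {2, 3}) \<subseteq> dP5"
  "strict_transform (vec.span {pt 2, pt 4}) = proj (line_space {1, 3}) \<and> proj (line_space {1, 3}) \<subseteq> dP5"
  "strict_transform (vec.span {pt 3, pt 4}) = proj (line_space {1, 2}) \<and> proj (line_space {1, 2}) \<subseteq> dP5"
proof -
  have *: "strict_transform (vec.span {pt i, pt j}) = proj (line_space e) \<and> proj (line_space e) \<subseteq> dP5"
    if "i \<in> {1..4} \<and> j \<in> {1..4} \<and> i \<noteq> j" "e \<in> pairs5"
      "dev (pt i) (pt j) \<in> line_space e \<and> dev (pt j) (pt i) \<in> line_space e"
      "\<exists>m n. dev (pt i) (pt j) $ m * dev (pt j) (pt i) $ n \<noteq> dev (pt i) (pt j) $ n * dev (pt j) (pt i) $ m" for i j e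
  proof -
    have "indep2 (dev (pt i) (pt j)) (dev (pt j) (pt i))" using that(4) indep2_by_coordinates by blast
    then show ?thesis using strict_transform_eq[of i j e] that by blast
  qed
  note defs = dev_def dS_def Let_def pt_def line_space_simps pairs5_def
  show "strict_transform (vec.span {pt 1, pt 2}) = proj (line_space {3, 4}) \<and> proj (line_space {3, 4}) \<subseteq> dP5"
    by (rule *; (rule exI[of _ 3], rule exI[of _ 1])?; simp add: defs)
  show "strict_transform (vec.span {pt 1, pt 3}) = proj (line_space {2, 4}) \<and> proj (line_space {2, 4}) \<subseteq> dP5"
    by (rule *; (rule exI[of _ 5], rule exI[of _ 2])?; simp add: defs)
  show "strict_transform (vec.span {pt 2, pt 3}) = proj (line_space {1, 4}) \<and> proj (line_space {1, 4}) \<subseteq> dP5"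
    by (rule *; (rule exI[of _ 6], rule exI[of _ 4])?; simp add: defs)
  show "strict_transform (vec.span {pt 1, pt 4}) = proj (line_space {2, 3}) \<and> proj (line_space {2, 3}) \<subseteq> dP5"
    by (rule *; (rule exI[of _ 3], rule exI[of _ 4])?; simp add: defs)
  show "strict_transform (vec.span {pt 2, pt 4}) = proj (line_space {1, 3}) \<and> proj (line_space {1, 3}) \<subseteq> dP5"
    by (rule *; (rule exI[of _ 1], rule exI[of _ 2])?; simp add: defs)
  show "strict_transform (vec.span {pt 3, pt 4}) = proj (line_space {1, 2}) \<and> proj (line_space {1, 2}) \<subseteq> dP5"
    by (rule *; (rule exI[of _ 2], rule exI[of _ 1])?; simp add: defs)
qed

lemma line_in_dP5:
  assumes "e \<in> pairs5"
  shows "proj (line_space e) \<subseteq> dP5"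
  using assms by (cases rule: pairs5_cases) (use strict_transforms exceptional_in_dP5 in auto)

lemma E_line_eq:
  assumes "h \<in> {1..5}" "k \<in> {1..5}" "h \<noteq> k"
  shows "E_line h k = proj (line_space {h, k})"
proof -
  have I: "{1..4::nat} = {1, 2, 3, 4}" "{1..5::nat} = {1, 2, 3, 4, 5}" by auto
  have "{1, 2, 3, 4} - {1, 2} = {3, 4::nat}" "{1, 2, 3, 4} - {1, 3} = {2, 4::nat}" "{1, 2, 3, 4} - {1, 4} = {2, 3::nat}"
   "{1, 2, 3, 4} - {2, 3} = {1, 4::nat}" "{1, 2, 3, 4} - {2, 4} = {1, 3::nat}" "{1, 2, 3, 4} - {3, 4} = {1, 2::nat}" by auto
  note 6 = this
  have sym: "E_line h k = E_line k h" "line_space {h, k} = line_space {k, h}" for h k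
    by (auto simp: E_line_def insert_commute)
  have "E_line h k = proj (line_space {h, k})" if "h < k" "h \<in> {1, 2, 3, 4, 5}" "k \<in> {1, 2, 3, 4, 5}" for h k :: nat
    using that unfolding insert_iff empty_iff
    by (elim disjE FalseE; hypsubst?; (simp; fail)?;
      simp only: E_line_def I 6 image_insert image_empty strict_transforms exceptional_curve_eq
       numeral_eq_iff num.distinct num.inject simp_thms if_True if_False;
      (simp add: exceptional_curve_eq strict_transforms[simplified]; fail)?)
  then show ?thesis using assms sym unfolding I by (metis linorder_neqE_nat)
qed

section \<open>Divisors of zeros of the sections\<close>

lemma simple_zero_noncentre:
  assumes "ev v \<noteq> 0" "ev v \<in> line_space e" "indep2 v a"
    "\<forall>s\<in>sec_indices. e \<in> edges s \<longrightarrow> dsec s v a \<noteq> 0"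
  shows "\<exists>y\<in>blowup. \<exists>c\<in>charts y. anticanonical y \<in> proj (line_space e) \<and>
    (\<forall>s\<in>sec_indices. e \<in> edges s \<longrightarrow> coeff (coeff (local_expr y c (sec s)) (Suc 0)) 0 \<noteq> 0)"
proof -
  have v: "v \<noteq> 0" using assms(3) indep2_nonzero by blast
  obtain y where y: "y \<in> blowup" "fst y = vec.span {v}" using blowup_noncentre_exists[OF assms(1)] by blast
  have n: "fst y \<notin> centres" using y(2) span_in_centres[OF v] assms(1) by simp
  obtain b where b: "(v, a, b) \<in> charts y" using noncentre_chart_exists[OF y(2) v n assms(3)] by blast
  have "anticanonical y \<in> proj (line_space e)"
    using anticanonical_noncentre[OF y v assms(1)] span1_in_proj[OF subspace_line_space] assms by simp
  then show ?thesis using y(1) b local_expr_noncentre(3)[OF n] assms(4) by metis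
qed

lemma simple_zero_centre:
  assumes i: "i \<in> {1..4}" and a: "indep2 (pt i) a"
    and d: "\<forall>s\<in>sec_indices. {i, 5} \<in> edges s \<longrightarrow> dsec s a (pt i) \<noteq> 0"
  shows "\<exists>y\<in>blowup. \<exists>c\<in>charts y. anticanonical y \<in> proj (line_space {i, 5}) \<and>
    (\<forall>s\<in>sec_indices. {i, 5} \<in> edges s \<longrightarrow> coeff (coeff (local_expr y c (sec s)) (Suc 0)) 0 \<noteq> 0)"
proof -
  obtain y where y: "y \<in> blowup" "fst y = vec.span {pt i}" "snd y i = vec.span {pt i, a}"
    using blowup_centre_exists[OF i a] by blast
  have n: "fst y \<in> centres" using y(2) i by (auto simp: centres_def)
  obtain b where b: "(pt i, a, b) \<in> charts y" using centre_chart_exists[OF i y(2, 3) a] by blast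
  have "anticanonical y \<in> proj (line_space {i, 5})"
    using anticanonical_centre[OF y(1) i y(2, 3) a] span1_in_proj[OF subspace_line_space] dev_nonzero[OF i a]
      exceptional_line[OF i] by simp
  then show ?thesis using y(1) b local_expr_centre(3)[OF n _ sec_0_if_ev_0[OF ev_pt[OF i]]] d by metis
qed

text \<open>Since the order along a curve is the smallest order at its points, a single sample point
  with nonzero u-derivative shows multiplicity one. The same point serves all six sections that
  vanish on the line.\<close>

lemma simple_zero:
  assumes "e \<in> pairs5"
  shows "\<exists>y\<in>blowup. \<exists>c\<in>charts y. anticanonical y \<in> proj (line_space e) \<and>
    (\<forall>s\<in>sec_indices. e \<in> edges s \<longrightarrow> coeff (coeff (local_expr y c (sec s)) (Suc 0)) 0 \<noteq> 0)"
proof -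
  \<comment> \<open>The sample vectors below have entries 0, 1, 2 so as to lie on exactly one of the
    six plane lines, and a is transversal to that line. The index l names a nonzero coordinate of
    \<open>ev v\<close>; m and n name a nonzero minor of v and a.\<close>
  have plane: ?thesis if e: "e = e'" and "ev v \<in> line_space e'" "ev v $ l \<noteq> 0" "v $ m * a $ n \<noteq> v $ n * a $ m"
    "\<forall>s\<in>sec_indices. e' \<in> edges s \<longrightarrow> dsec s v a \<noteq> 0" for e' v a l m n
    unfolding e by (rule simple_zero_noncentre[OF _ that(2) indep2_by_coordinates[OF that(4)] that(5)]) (use that(3) in auto)
  \<comment> \<open>On an exceptional curve the sample is a tangent direction a that points along
    none of the three plane lines through the centre.\<close>
  have exc: ?thesis if e: "e = {i, 5}" and "i \<in> {1..4}" "pt i $ m * a $ n \<noteq> pt i $ n * a $ m"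
    "\<forall>s\<in>sec_indices. {i, 5} \<in> edges s \<longrightarrow> dsec s a (pt i) \<noteq> 0" for i a m n
    unfolding e by (rule simple_zero_centre[OF that(2) indep2_by_coordinates[OF that(3)] that(4)])
  note ev_defs = line_space_simps ev_def s_form_def pt_def
  note dsec_defs = edges_simps doubleton_eq_iff dS_def pt_def Let_def sign_perm3
  show ?thesis using assms
  proof (cases rule: pairs5_cases)
    case 1
    show ?thesis
      by (rule plane[OF 1, where v = "vector [2, 2, 1]" and a = "vector [1, 0, 0]" and l = 2 and m = 1 and n = 3];
          (simp add: ev_defs; fail)?; simp only: ball_sec_indices all_bool_eq; simp add: dsec_defs)
  next
    case 2
    show ?thesis
      by (rule plane[OF 2, where v = "vector [2, 1, 2]" and a = "vector [1, 0, 0]" and l = 1 and m = 1 and n = 2];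
          (simp add: ev_defs; fail)?; simp only: ball_sec_indices all_bool_eq; simp add: dsec_defs)
  next
    case 3
    show ?thesis
      by (rule plane[OF 3, where v = "vector [0, 1, 2]" and a = "vector [1, 0, 0]" and l = 4 and m = 1 and n = 2];
          (simp add: ev_defs; fail)?; simp only: ball_sec_indices all_bool_eq; simp add: dsec_defs)
  next
    case 4
    show ?thesis
      by (rule exc[OF 4, where a = "vector [0, 1, 2]" and m = 1 and n = 2];
          (simp add: ev_defs; fail)?; simp only: ball_sec_indices all_bool_eq; simp add: dsec_defs)
  next
    case 5
    show ?thesis
      by (rule plane[OF 5, where v = "vector [1, 2, 2]" and a = "vector [0, 1, 0]" and l = 3 and m = 1 and n = 2];
          (simp add: ev_defs; fail)?; simp only: ball_sec_indices all_bool_eq; simp add: dsec_defs)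
  next
    case 6
    show ?thesis
      by (rule plane[OF 6, where v = "vector [1, 0, 2]" and a = "vector [0, 1, 0]" and l = 2 and m = 1 and n = 2];
          (simp add: ev_defs; fail)?; simp only: ball_sec_indices all_bool_eq; simp add: dsec_defs)
  next
    case 7
    show ?thesis
      by (rule exc[OF 7, where a = "vector [1, 0, 2]" and m = 2 and n = 1];
          (simp add: ev_defs; fail)?; simp only: ball_sec_indices all_bool_eq; simp add: dsec_defs)
  next
    case 8
    show ?thesis
      by (rule plane[OF 8, where v = "vector [1, 2, 0]" and a = "vector [0, 0, 1]" and l = 1 and m = 1 and n = 3];
          (simp add: ev_defs; fail)?; simp only: ball_sec_indices all_bool_eq; simp add: dsec_defs)
  next
    case 9
    show ?thesis
      by (rule exc[OF 9, where a = "vector [1, 2, 0]" and m = 3 and n = 1];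
          (simp add: ev_defs; fail)?; simp only: ball_sec_indices all_bool_eq; simp add: dsec_defs)
  next
    case 10
    show ?thesis
      by (rule exc[OF 10, where a = "vector [0, 1, 2]" and m = 2 and n = 1];
          (simp add: ev_defs; fail)?; simp only: ball_sec_indices all_bool_eq; simp add: dsec_defs)
  qed
qed

lemma vals_in_anticanonical:
  assumes "y \<in> blowup" "(v, a, b) \<in> charts y"
  shows "vals y v a \<in> anticanonical y"
  using anticanonical_chart[OF assms] vec.span_base by blast

lemma vanishes_to_order_1:
  assumes y: "y \<in> blowup" and s: "s \<in> sec_indices"
  shows "vanishes_to_order 1 (sec s) y \<longleftrightarrow> (\<forall>w\<in>anticanonical y. sec_lin s w = 0)"
proof -
  have "sec_lin s (vals y v a) = 0 \<longleftrightarrow> (\<forall>w\<in>anticanonical y. sec_lin s w = 0)" if c: "(v, a, b) \<in> charts y" for v a b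
    using anticanonical_chart[OF y c] sec_lin_combination[of s _ _ 0 0] vals_in_anticanonical[OF y c]
    by (auto simp: in_span1)
  then have "(\<forall>c\<in>charts y. coeff (coeff (local_expr y c (sec s)) 0) 0 = 0) \<longleftrightarrow> (\<forall>w\<in>anticanonical y. sec_lin s w = 0)"
    using charts_nonempty[OF y] chart_value[OF _ s] by (metis all_not_in_conv prod_cases3)
  then show ?thesis by (auto simp: vanishes_to_order_def)
qed

text \<open>The linear form vanishes on the line, so the order is at least one; order two would
  contradict the nonzero coefficient of u at the point from \<open>simple_zero\<close>.\<close>

lemma order_along_edge:
  assumes s: "s \<in> sec_indices" and e: "e \<in> edges s"
  shows "order_along (sec s) (proj (line_space e)) = 1"
  unfolding order_along_def
proof (rule Greatest_equality)
  show "\<forall>y\<in>blowup. anticanonical y \<in> proj (line_space e) \<longrightarrow> vanishes_to_order 1 (sec s) y"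
    using vanishes_to_order_1[OF _ s] vanishing_on_line_space[OF _ s e] by (auto simp: proj_def)
  fix k assume k: "\<forall>y\<in>blowup. anticanonical y \<in> proj (line_space e) \<longrightarrow> vanishes_to_order k (sec s) y"
  have "e \<in> pairs5" using edges_subset[OF s] e by blast
  then obtain y c where y: "y \<in> blowup" "c \<in> charts y" "anticanonical y \<in> proj (line_space e)"
    "coeff (coeff (local_expr y c (sec s)) (Suc 0)) 0 \<noteq> 0" using simple_zero s e by metis
  show "k \<le> 1"
  proof (rule ccontr)
    assume "\<not> k \<le> 1"
    then have "Suc 0 + 0 < k" by simp
    then show False using k y unfolding vanishes_to_order_def by blast
  qed
qed

lemma sec_zero_on_line:
  assumes s: "s \<in> sec_indices" and z: "z \<in> dP5" and 0: "\<forall>w\<in>z. sec_lin s w = 0"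
  shows "\<exists>e\<in>edges s. z \<subseteq> line_space e"
  using z
proof (cases rule: dP5_cases)
  case (noncentre v)
  then have "sec s v = 0" using 0 sec_lin_ev[OF s] vec.span_base by (metis singletonI)
  then show ?thesis using sec_zero_noncentre[OF s] noncentre span1_subset[OF subspace_line_space] by metis
next
  case (centre i a)
  then have "dsec s (pt i) a = 0" using 0 sec_lin_dev[OF s] vec.span_base by (metis singletonI)
  then show ?thesis using sec_zero_centre[OF s centre(1)] centre span1_subset[OF subspace_line_space] by metis
qed

text \<open>Irreducibility puts C into one of the five lines. A proper irreducible closed subset of
  a line is a point, which is excluded for a curve, so C is that line.\<close>

lemma curve_in_zeros:
  assumes s: "s \<in> sec_indices" and C: "irreducible_curve C" and sub: "C \<subseteq> (\<Union>e\<in>edges s. proj (line_space e))"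
  shows "\<exists>e\<in>edges s. C = proj (line_space e)"
proof -
  have fin: "finite (edges s)" using finite_subset[OF edges_subset[OF s]] by (simp add: pairs5_def)
  have irr: "irreducible_closed C" using C by (simp add: irreducible_curve_def)
  obtain e where e: "e \<in> edges s" "C \<subseteq> proj (line_space e)"
    using irreducible_closed_in_union[OF irr, of "(\<lambda>e. proj (line_space e)) ` edges s"] fin sub closed_line_space by auto
  have "irreducible_curve (proj (line_space e))" using irreducible_curve_line_space edges_subset[OF s] e by blast
  then have "C = proj (line_space e)" using C e(2) irr unfolding irreducible_curve_def by (metis psubsetI)
  then show ?thesis using e(1) by blast
qed

text \<open>Some point of C lies on none of the lines of s. The section has a nonzero value there,
  and this one point keeps the minimum at zero.\<close>

lemma order_along_other:
  assumes s: "s \<in> sec_indices" and C: "irreducible_curve C" "C \<subseteq> dP5" and n: "\<forall>e\<in>edges s. C \<noteq> proj (line_space e)"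
  shows "order_along (sec s) C = 0"
proof -
  have "\<not> C \<subseteq> (\<Union>e\<in>edges s. proj (line_space e))" using curve_in_zeros[OF s C(1)] n by blast
  then obtain z where z: "z \<in> C" "z \<notin> (\<Union>e\<in>edges s. proj (line_space e))" by blast
  have "z \<in> proj_space" using z(1) C(1) zariski_closed_subset by (auto simp: irreducible_curve_def irreducible_closed_def)
  then have nz: "\<not> (\<forall>w\<in>z. sec_lin s w = 0)" using sec_zero_on_line[OF s, of z] z C(2) by (auto simp: proj_def)
  obtain y where y: "y \<in> blowup" "anticanonical y = z" using z(1) C(2) by (auto simp: dP5_def)
  have "\<not> vanishes_to_order 1 (sec s) y" using vanishes_to_order_1[OF y(1) s] nz y(2) by simp
  then have pos: "\<not> vanishes_to_order k (sec s) y" if "k > 0" for k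
    using that unfolding vanishes_to_order_def by (metis One_nat_def less_one add_is_0 )
  show ?thesis unfolding order_along_def
  proof (rule Greatest_equality)
    show "\<forall>y\<in>blowup. anticanonical y \<in> C \<longrightarrow> vanishes_to_order 0 (sec s) y"
      by (simp add: vanishes_to_order_def)
    fix k assume "\<forall>y\<in>blowup. anticanonical y \<in> C \<longrightarrow> vanishes_to_order k (sec s) y"
    then have "vanishes_to_order k (sec s) y" using y z(1) by simp
    then show "k \<le> 0" using pos by blast
  qed
qed

definition lines_union :: "nat set set \<Rightarrow> (complex ^ 6) set set" where
  "lines_union T = (\<Union>e\<in>T. proj (line_space e))"

lemma divisor_of_zeros_sec:
  assumes s: "s \<in> sec_indices"
  shows "divisor_of_zeros (sec s) = reduced_divisor (lines_union (edges s))"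
proof
  fix C
  have E: "e \<in> pairs5" if "e \<in> edges s" for e using edges_subset[OF s] that by blast
  show "divisor_of_zeros (sec s) C = reduced_divisor (lines_union (edges s)) C"
  proof (cases "\<exists>e\<in>edges s. C = proj (line_space e)")
    case True
    then show ?thesis using order_along_edge[OF s] irreducible_curve_line_space[OF E] line_in_dP5[OF E]
      by (auto simp: divisor_of_zeros_def reduced_divisor_def lines_union_def)
  next
    case False
    then have "\<not> (irreducible_curve C \<and> C \<subseteq> lines_union (edges s))"
      using curve_in_zeros[OF s, of C] unfolding lines_union_def by blast
    then have "reduced_divisor (lines_union (edges s)) C = 0" unfolding reduced_divisor_def by (rule if_not_P)
    moreover have "divisor_of_zeros (sec s) C = 0"
      using order_along_other[OF s, of C] False unfolding divisor_of_zeros_def by simp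
    ultimately show ?thesis by simp
  qed
qed

lemma reduced_divisor_lines:
  assumes s: "s \<in> sec_indices"
  shows "reduced_divisor (lines_union (edges s)) C = (if C \<in> (\<lambda>e. proj (line_space e)) ` edges s then 1 else 0)"
proof -
  have E: "e \<in> pairs5" if "e \<in> edges s" for e using edges_subset[OF s] that by blast
  show ?thesis using curve_in_zeros[OF s] irreducible_curve_line_space[OF E]
    by (auto simp: reduced_divisor_def lines_union_def)
qed

lemma proj_line_space_inject: "e \<in> pairs5 \<Longrightarrow> e' \<in> pairs5 \<Longrightarrow> proj (line_space e) = proj (line_space e') \<longleftrightarrow> e = e'"
  using line_space_inject proj_inject[OF subspace_line_space subspace_line_space] by blast

section \<open>Lines contained in the surface\<close>

lemma lines_in_dP5:
  assumes i: "indep2 a b" and sub: "proj (vec.span {a, b}) \<subseteq> dP5"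
  shows "\<exists>e\<in>pairs5. proj (vec.span {a, b}) = proj (line_space e)"
proof -
  let ?W = "vec.span {a, b}"
  have "\<exists>s\<in>sec_indices. sec_lin s a = 0 \<and> sec_lin s b = 0"
  proof (rule ccontr)
    assume n: "\<not> ?thesis"
    \<comment> \<open>The zero of \<open>sec_lin s\<close> on the line, obtained by eliminating
      between its values at a and b; it is a nonzero vector because these values are not both
      zero.\<close>
    define z where "z s = sec_lin s b *s a + (- sec_lin s a) *s b" for s
    have z0: "z s \<noteq> 0" if "s \<in> sec_indices" for s
      using n that i unfolding z_def indep2_def by (metis neg_equal_0_iff_equal)
    have zW: "z s \<in> ?W" for s unfolding in_span2 z_def by blast
    have zs: "sec_lin s (z s) = 0" for s unfolding z_def sec_lin_combination by simp
    have ex: "\<exists>e\<in>edges s. z s \<in> line_space e" if s: "s \<in> sec_indices" for s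
    proof -
      have "vec.span {z s} \<in> dP5" using sub span1_in_proj[OF vec.subspace_span] zW z0[OF s] by blast
      moreover have "\<forall>w\<in>vec.span {z s}. sec_lin s w = 0"
        using sec_lin_combination[of s _ "z s" 0 0] zs by (auto simp: in_span1)
      ultimately show ?thesis using sec_zero_on_line[OF s] span1_subset[OF subspace_line_space] by blast
    qed
    have same: "\<not> indep2 (z s) (z t)" if s: "s \<in> sec_indices" and t: "t \<in> sec_indices" for s t
    proof
      assume ind: "indep2 (z s) (z t)"
      obtain e where e: "e \<in> edges s" "z s \<in> line_space e" using ex s by blast
      obtain e' where e': "e' \<in> edges t" "z t \<in> line_space e'" using ex t by blast
      obtain r where r: "r \<in> sec_indices" "e \<in> edges r" "e' \<in> edges r"
        using common_section edges_subset s t e e' by blast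
      have "sec_lin r (z s) = 0" "sec_lin r (z t) = 0" using vanishing_on_line_space r e e' by blast+
      then have "sec_lin r w = 0" if "w \<in> vec.span {z s, z t}" for w
        using that unfolding in_span2 by (elim exE) (simp add: sec_lin_combination del: sec_lin.simps)
      moreover have "vec.span {z s, z t} = ?W" using span2_eq zW ind by blast
      ultimately have "sec_lin r a = 0" "sec_lin r b = 0" using vec.span_base by (metis insertCI)+
      then show False using n r by blast
    qed
    define s0 where "s0 = (False, 1 :: nat, 2 :: nat)"
    have s0: "s0 \<in> sec_indices" by (simp add: s0_def index_pairs_eq)
    have "sec_lin s (z s0) = 0" if s: "s \<in> sec_indices" for s
    proof -
      obtain c where "z s0 = c *s z s" using same[OF s s0] indep2_iff[OF z0[OF s]] by (auto simp: in_span1)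
      then show ?thesis using zs[of s] sec_lin_combination[of s c "z s" 0 0] by simp
    qed
    then have "\<forall>s\<in>sec_indices. sec_lin s (z s0) = 0" by blast
    then have "z s0 = 0" unfolding ball_sec_indices all_bool_eq by (simp add: s_index_def vec_eq_iff forall_6)
    then show False using z0[OF s0] by blast
  qed
  then obtain s where s: "s \<in> sec_indices" "sec_lin s a = 0" "sec_lin s b = 0" by blast
  then have "sec_lin s w = 0" if "w \<in> ?W" for w
    using that unfolding in_span2 by (elim exE) (simp add: sec_lin_combination del: sec_lin.simps)
  then have cov: "\<exists>e\<in>edges s. z \<in> proj (line_space e)" if "z \<in> proj ?W" for z
    using that sub sec_zero_on_line[OF s(1), of z] by (auto simp: proj_def)
  have fin: "finite (edges s)" using finite_subset[OF edges_subset[OF s(1)]] by (simp add: pairs5_def)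
  \<comment> \<open>The infinitely many points of the line are distributed over the five lines of
    one pentagon, so one of these contains infinitely many of them.\<close>
  obtain e where e: "e \<in> edges s" "infinite (proj (line_space e) \<inter> proj ?W)"
  proof -
    have "proj ?W = (\<Union>e\<in>edges s. proj (line_space e) \<inter> proj ?W)" using cov by blast
    moreover have "finite (\<Union>e\<in>edges s. proj (line_space e) \<inter> proj ?W)"
      if "\<forall>e\<in>edges s. finite (proj (line_space e) \<inter> proj ?W)" using that fin by blast
    ultimately have "\<not> (\<forall>e\<in>edges s. finite (proj (line_space e) \<inter> proj ?W))"
      using infinite_proj_line[OF i] by metis
    then show thesis using that by blast
  qed
  have e5: "e \<in> pairs5" using edges_subset s(1) e(1) by blast
  have "proj ?W \<subseteq> proj (line_space e)" using closed_contains_line[OF closed_line_space i] e(2) by blast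
  moreover obtain a' b' where L: "indep2 a' b'" "line_space e = vec.span {a', b'}" using line_space_basis[OF e5] by blast
  moreover have "a \<in> line_space e" "b \<in> line_space e"
    using calculation(1) indep2_nonzero[OF i] span1_in_proj[OF vec.subspace_span, of _ "{a, b}"]
      span1_in_proj[OF subspace_line_space, of _ e] vec.span_base[of _ "{a, b}"] by blast+
  ultimately have "?W = line_space e" using span2_eq i by metis
  then show ?thesis using e5 by auto
qed

section \<open>Combinatorial pentagons\<close>

definition pent_edges :: "(5 \<Rightarrow> 'a) \<Rightarrow> 'a set set" where
  "pent_edges p = range (\<lambda>i. {p i, p (i + 1)})"

text \<open>The pentagon of \<open>\<sigma>\<^sub>i\<^sub>j\<close> is the neighbour of the pentagon \<open>(i, 4, j, k, 5)\<close> of \<open>s\<^sub>i\<^sub>j\<close>.\<close>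

fun verts :: "sec_index \<Rightarrow> 5 \<Rightarrow> nat" where
  "verts (b, i, j) n = (let m = if b then 2 * n else n in
     if m = 0 then i else if m = 1 then 4 else if m = 2 then j else if m = 3 then 6 - i - j else 5)"

lemma numerals_mod_5: "(5 :: 5) = 0" "(6 :: 5) = 1" "(7 :: 5) = 2" "(8 :: 5) = 3" "(9 :: 5) = 4"
  by simp_all

lemma pent_edges_eq: "pent_edges p = {{p 0, p 1}, {p 1, p 2}, {p 2, p 3}, {p 3, p 4}, {p 4, p 0}}"
  unfolding pent_edges_def UNIV_5 by (simp add: numerals_mod_5)

lemma inj_5: "inj (p :: 5 \<Rightarrow> 'a) \<longleftrightarrow> p 0 \<noteq> p 1 \<and> p 0 \<noteq> p 2 \<and> p 0 \<noteq> p 3 \<and> p 0 \<noteq> p 4 \<and> p 1 \<noteq> p 2 \<and> p 1 \<noteq> p 3 \<and>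
    p 1 \<noteq> p 4 \<and> p 2 \<noteq> p 3 \<and> p 2 \<noteq> p 4 \<and> p 3 \<noteq> p 4"
proof
  assume "inj p"
  then show "p 0 \<noteq> p 1 \<and> p 0 \<noteq> p 2 \<and> p 0 \<noteq> p 3 \<and> p 0 \<noteq> p 4 \<and> p 1 \<noteq> p 2 \<and> p 1 \<noteq> p 3 \<and>
    p 1 \<noteq> p 4 \<and> p 2 \<noteq> p 3 \<and> p 2 \<noteq> p 4 \<and> p 3 \<noteq> p 4" by (simp add: inj_eq)
next
  assume "p 0 \<noteq> p 1 \<and> p 0 \<noteq> p 2 \<and> p 0 \<noteq> p 3 \<and> p 0 \<noteq> p 4 \<and> p 1 \<noteq> p 2 \<and> p 1 \<noteq> p 3 \<and>
    p 1 \<noteq> p 4 \<and> p 2 \<noteq> p 3 \<and> p 2 \<noteq> p 4 \<and> p 3 \<noteq> p 4"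
  then show "inj p" unfolding inj_on_def UNIV_5 by auto
qed

lemma verts_pentagon:
  assumes "s \<in> sec_indices"
  shows "inj (verts s)" "range (verts s) \<subseteq> {1..5}" "pent_edges (verts s) = edges s"
proof -
  have "\<forall>s\<in>sec_indices. inj (verts s)"
    unfolding ball_sec_indices all_bool_eq inj_5 by simp
  then show "inj (verts s)" using assms by blast
  have "\<forall>s\<in>sec_indices. range (verts s) \<subseteq> {1..5}"
    unfolding ball_sec_indices all_bool_eq UNIV_5 by simp
  then show "range (verts s) \<subseteq> {1..5}" using assms by blast
  have "\<forall>s\<in>sec_indices. pent_edges (verts s) = edges s"
    unfolding ball_sec_indices all_bool_eq pent_edges_eq
    by (simp add: edges_simps; intro conjI; simp add: insert_commute)
  then show "pent_edges (verts s) = edges s" using assms by blast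
qed

lemma edges_inject:
  assumes "s \<in> sec_indices" "t \<in> sec_indices" "edges s = edges t"
  shows "s = t"
proof -
  have "\<forall>s\<in>sec_indices. \<forall>t\<in>sec_indices. s = t \<or> (\<exists>e\<in>edges s. e \<notin> edges t)"
    unfolding ball_sec_indices all_bool_eq
    by (simp add: edges_simps doubleton_eq_iff)
  from bspec[OF bspec[OF this assms(1)] assms(2)] show ?thesis using assms(3) by auto
qed

lemma pentagon_class_self: "p \<in> pentagon_class p"
  unfolding pentagon_class_def by (rule CollectI, intro exI[of _ 1] exI[of _ 0]) simp

text \<open>The maps i \<mapsto> e i + a with e = 1 or e = -1 form a group; since
  \<open>e * e = 1\<close>, the inverse has the same linear part.\<close>

lemma pentagon_class_eq:
  assumes "q \<in> pentagon_class p"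
  shows "pentagon_class q = pentagon_class p"
proof -
  obtain e a where e: "e = 1 \<or> e = -1" and q: "q = (\<lambda>i. p (e * i + a))" using assms by (auto simp: pentagon_class_def)
  have ee: "e * e = 1" using e by auto
  show ?thesis
  proof (intro Set.set_eqI iffI)
    fix r assume "r \<in> pentagon_class q"
    then obtain f b where f: "f = 1 \<or> f = -1" and r: "r = (\<lambda>i. q (f * i + b))" by (auto simp: pentagon_class_def)
    have "r = (\<lambda>i. p (e * f * i + (e * b + a)))" by (simp add: r q algebra_simps)
    moreover have "e * f = 1 \<or> e * f = -1" using e f by auto
    ultimately show "r \<in> pentagon_class p" unfolding pentagon_class_def by blast
  next
    fix r assume "r \<in> pentagon_class p"
    then obtain f b where f: "f = 1 \<or> f = -1" and r: "r = (\<lambda>i. p (f * i + b))" by (auto simp: pentagon_class_def)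
    have "e * (e * f * i + (e * b - e * a)) + a = (e * e) * (f * i + b - a) + a" for i by (simp add: algebra_simps)
    then have "r = (\<lambda>i. q (e * f * i + (e * b - e * a)))" unfolding r q ee by simp
    moreover have "e * f = 1 \<or> e * f = -1" using e f by auto
    ultimately show "r \<in> pentagon_class q" unfolding pentagon_class_def by blast
  qed
qed

lemma pent_edges_class:
  assumes "q \<in> pentagon_class p"
  shows "pent_edges q = pent_edges p"
proof -
  obtain e a where e: "e = 1 \<or> e = -1" and q: "q = (\<lambda>i. p (e * i + a))" using assms by (auto simp: pentagon_class_def)
  have 1: "pent_edges (\<lambda>i. p (i + a)) \<subseteq> pent_edges p" for p :: "5 \<Rightarrow> 'a" and a
    unfolding pent_edges_def by (auto simp: add.commute add.left_commute)
  have 2: "pent_edges (\<lambda>i. p (- i)) \<subseteq> pent_edges p" for p :: "5 \<Rightarrow> 'a"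
  proof -
    have "{p (- i), p (- (i + 1))} = {p (- i - 1), p (- i - 1 + 1)}" for i by (simp add: insert_commute)
    then show ?thesis unfolding pent_edges_def by blast
  qed
  have sub: "pent_edges q \<subseteq> pent_edges p" if "q \<in> pentagon_class p" for p q :: "5 \<Rightarrow> 'a"
  proof -
    obtain e a where e: "e = 1 \<or> e = -1" and q: "q = (\<lambda>i. p (e * i + a))" using \<open>q \<in> pentagon_class p\<close> by (auto simp: pentagon_class_def)
    show ?thesis
    proof (cases "e = 1")
      case True
      then show ?thesis using 1[of p a] q by simp
    next
      case False
      then have "q = (\<lambda>i. (\<lambda>i. p (i + a)) (- i))" using e q by simp
      then show ?thesis using 2[of "\<lambda>i. p (i + a)"] 1[of p a] by simp
    qed
  qed
  have "p \<in> pentagon_class q" using pentagon_class_eq[OF assms] pentagon_class_self by metis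
  then show ?thesis using sub assms by blast
qed

lemma three_of_five:
  assumes "a \<in> {1..5::nat}" "b \<in> {1..5}" "c \<in> {1..5}" "a \<noteq> b" "a \<noteq> c" "b \<noteq> c"
    "a \<noteq> 4" "a \<noteq> 5" "b \<noteq> 4" "b \<noteq> 5" "c \<noteq> 4" "c \<noteq> 5"
  shows "(a, b) \<in> index_pairs \<and> c = 6 - a - b"
proof -
  have "a = 1 \<or> a = 2 \<or> a = 3" "b = 1 \<or> b = 2 \<or> b = 3" "c = 1 \<or> c = 2 \<or> c = 3"
    using assms by (simp_all, arith+)
  then show ?thesis using assms(4-6) unfolding index_pairs_eq by auto
qed

text \<open>The positions of the labels 4 and 5 decide the kind of section: they are neighbours in
  the pentagon of \<open>\<sigma>\<^sub>i\<^sub>j\<close> and two steps apart in that of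
  \<open>\<s>\<^sub>i\<^sub>j\<close>. An affine change of the index brings both into standard
  position, and the other three vertices then supply i, j and the third index.\<close>

lemma pentagon_is_verts:
  fixes p :: "5 \<Rightarrow> nat"
  assumes p: "inj p" "range p \<subseteq> {1..5}"
  shows "\<exists>s\<in>sec_indices. verts s \<in> pentagon_class p"
proof -
  have "card (range p) = 5" using p(1) by (simp add: card_image)
  then have r: "range p = {1..5}" using p(2) by (intro card_subset_eq) auto
  have "(5::nat) \<in> range p" "(4::nat) \<in> range p" unfolding r by simp_all
  then obtain m n where m: "p m = 5" and n: "p n = 4" by (metis imageE)
  have rot: "inj (\<lambda>x. p (d * (x - c) + m))" if "d = 1 \<or> d = -1" for c d
  proof (rule injI)
    fix x y assume "p (d * (x - c) + m) = p (d * (y - c) + m)"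
    then have "d * (x - c) = d * (y - c)" using p(1) by (simp add: inj_eq)
    then show "x = y" using that by auto
  qed
  have cl: "(\<lambda>x. p (d * (x - c) + m)) \<in> pentagon_class p" if "d = 1 \<or> d = -1" for c d
  proof -
    have "(\<lambda>x. p (d * (x - c) + m)) = (\<lambda>x. p (d * x + (m - d * c)))" by (simp add: algebra_simps)
    then show ?thesis unfolding pentagon_class_def using that by blast
  qed
  have val: "p x \<in> {1..5}" for x using p(2) by blast
  have "n \<noteq> m" using m n by auto
  then have "n - m \<noteq> 0" by simp
  moreover have "(4::5) = -1" "(3::5) = -2" by simp_all
  ultimately consider d where "d = 1 \<or> d = -1" "n = d + m" | d where "d = 1 \<or> d = -1" "n = 2 * d + m"
    using exhaust_5[of "n - m"] by (metis diff_add_cancel mult.right_neutral mult_minus_right)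
  then show ?thesis
  proof cases
    case 1
    define q where "q = (\<lambda>x. p (d * (x - 2) + m))"
    have q: "q 2 = 5" "q 3 = 4" using m n 1 by (simp_all add: q_def)
    have iq: "inj q" unfolding q_def by (rule rot[OF 1(1)])
    have q5: "q x \<in> {1..5}" for x unfolding q_def by (rule val)
    have "(q 0, q 1) \<in> index_pairs \<and> q 4 = 6 - q 0 - q 1"
      using iq[unfolded inj_5] q by (intro three_of_five q5) auto
    then have "(True, q 0, q 1) \<in> sec_indices" "\<forall>x. verts (True, q 0, q 1) x = q x"
      using q unfolding forall_5 by simp_all
    then have "verts (True, q 0, q 1) = q" by blast
    then show ?thesis using cl[OF 1(1)] \<open>(True, q 0, q 1) \<in> sec_indices\<close> unfolding q_def by metis
  next
    case 2
    define q where "q = (\<lambda>x. p (d * (x - 4) + m))"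
    have "(1 - 4 :: 5) = 2" by simp
    then have "q 1 = p (d * 2 + m)" by (simp only: q_def)
    then have q: "q 4 = 5" "q 1 = 4" using m n 2 by (simp_all add: q_def mult.commute)
    have iq: "inj q" unfolding q_def by (rule rot[OF 2(1)])
    have q5: "q x \<in> {1..5}" for x unfolding q_def by (rule val)
    have "(q 0, q 2) \<in> index_pairs \<and> q 3 = 6 - q 0 - q 2"
      using iq[unfolded inj_5] q by (intro three_of_five q5) auto
    then have "(False, q 0, q 2) \<in> sec_indices" "\<forall>x. verts (False, q 0, q 2) x = q x"
      using q unfolding forall_5 by simp_all
    then have "verts (False, q 0, q 2) = q" by blast
    then show ?thesis using cl[OF 2(1)] \<open>(False, q 0, q 2) \<in> sec_indices\<close> unfolding q_def by metis
  qed
qed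

lemma pentagon_is_section:
  fixes p :: "5 \<Rightarrow> nat"
  assumes "inj p" "range p \<subseteq> {1..5}"
  shows "\<exists>s\<in>sec_indices. pentagon_class p = pentagon_class (verts s) \<and> pent_edges p = edges s"
  using pentagon_is_verts[OF assms] pentagon_class_eq pent_edges_class verts_pentagon(3) by metis

lemma combinatorial_pentagons_eq:
  "combinatorial_pentagons {1..5} = (\<lambda>s. pentagon_class (verts s)) ` sec_indices"
proof
  show "combinatorial_pentagons {1..5} \<subseteq> (\<lambda>s. pentagon_class (verts s)) ` sec_indices"
  proof
    fix A assume "A \<in> combinatorial_pentagons {1..5::nat}"
    then obtain p where "A = pentagon_class p" "inj p" "range p \<subseteq> {1..5}"
      unfolding combinatorial_pentagons_def by blast
    then show "A \<in> (\<lambda>s. pentagon_class (verts s)) ` sec_indices" using pentagon_is_section[of p] by blast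
  qed
  show "(\<lambda>s. pentagon_class (verts s)) ` sec_indices \<subseteq> combinatorial_pentagons {1..5}"
    unfolding combinatorial_pentagons_def using verts_pentagon(1, 2) by blast
qed

lemma class_verts_inject:
  assumes "s \<in> sec_indices" "t \<in> sec_indices" "pentagon_class (verts s) = pentagon_class (verts t)"
  shows "s = t"
proof -
  have "verts s \<in> pentagon_class (verts t)" using assms(3) pentagon_class_self by metis
  then show ?thesis using pent_edges_class verts_pentagon(3) edges_inject assms by metis
qed

text \<open>The disjoint edges \<open>e 0\<close> and \<open>e 1\<close> omit one vertex f. As
  \<open>e 2\<close> avoids \<open>e 1\<close>, it joins f to a vertex a of \<open>e 0\<close>;
  likewise \<open>e 4\<close> joins f to a vertex c of \<open>e 1\<close>; and \<open>e 3\<close>,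
  avoiding both, joins the remaining b and d. In the order 0, 3, 1, 4, 2 the edges run around the
  pentagon a b d c f.\<close>

lemma disjoint_cycle_is_section:
  assumes e: "\<And>i::5. e i \<in> pairs5" "inj e" "\<And>i. e i \<inter> e (i + 1) = {}"
  shows "\<exists>s\<in>sec_indices. edges s = range e"
proof -
  have disj: "e 0 \<inter> e 1 = {}" "e 1 \<inter> e 2 = {}" "e 2 \<inter> e 3 = {}" "e 3 \<inter> e 4 = {}" "e 4 \<inter> e 0 = {}"
    using e(3)[of 0] e(3)[of 1] e(3)[of 2] e(3)[of 3] e(3)[of 4] by (simp_all add: numerals_mod_5)
  have sz: "card (e i) = 2 \<and> e i \<subseteq> {1..5}" for i using e(1)[of i] by (auto elim!: pairs5E)
  have fin: "finite (e i)" for i using sz[of i] by (metis card.infinite zero_neq_numeral)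
  have "card ({1..5} - (e 0 \<union> e 1)) = 1"
    using sz[of 0] sz[of 1] disj(1) fin by (simp add: card_Diff_subset card_Un_disjoint)
  then obtain f where f: "{1..5} - (e 0 \<union> e 1) = {f}" by (metis card_1_singletonE)
  have pair: "\<exists>x y. A = {x, y} \<and> x \<noteq> y \<and> B = {x, f}"
    if A: "card A = 2" and B: "card B = 2" "B \<subseteq> insert f A" "B \<noteq> A" for A B
  proof -
    have fA: "finite A" using A by (metis card.infinite zero_neq_numeral)
    have fB: "f \<in> B"
    proof (rule ccontr)
      assume "f \<notin> B"
      then have "B \<subseteq> A" using B by blast
      then show False using A B card_subset_eq[OF fA] by simp
    qed
    have "card (B - {f}) = 1" using B(1) fB by simp
    then obtain x where x: "B - {f} = {x}" by (metis card_1_singletonE)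
    then have "x \<in> A" using B by blast
    then have "card (A - {x}) = 1" using A by simp
    then obtain y where "A - {x} = {y}" by (metis card_1_singletonE)
    then show ?thesis using x fB \<open>x \<in> A\<close> by blast
  qed
  have ne: "e 2 \<noteq> e 0" "e 4 \<noteq> e 1" "e 0 \<noteq> e 1" using e(2) by (simp_all add: inj_eq)
  have "e 2 \<subseteq> insert f (e 0)" using sz[of 2] disj f by blast
  then obtain a b where ab: "e 0 = {a, b}" "a \<noteq> b" "e 2 = {a, f}" using pair sz ne by metis
  have "e 4 \<subseteq> insert f (e 1)" using sz[of 4] disj f by blast
  then obtain c d where cd: "e 1 = {c, d}" "c \<noteq> d" "e 4 = {c, f}" using pair sz ne by metis
  have dis: "a \<noteq> c" "a \<noteq> d" "b \<noteq> c" "b \<noteq> d" "f \<notin> {a, b, c, d}" using disj(1) ab cd f by auto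
  have "e 3 \<subseteq> {b, d}"
  proof
    fix x assume x: "x \<in> e 3"
    then have "x \<in> {1..5}" using sz by blast
    then have "x \<in> {a, b, c, d, f}" using f ab cd by blast
    moreover have "x \<notin> {a, f}" "x \<notin> {c, f}" using disj(3, 4) x ab cd by blast+
    ultimately show "x \<in> {b, d}" by blast
  qed
  then have e3: "e 3 = {b, d}" using sz[of 3] dis by (intro card_subset_eq) auto
  define p where "p n = (if n = 0 then a else if n = 1 then b else if n = 2 then d else if n = 3 then c else f)" for n :: 5
  have "inj p" unfolding inj_5 using ab cd dis by (auto simp: p_def)
  moreover have "e 0 \<subseteq> {1..5}" "e 1 \<subseteq> {1..5}" "f \<in> {1..5}"
    using sz[of 0] sz[of 1] f by (metis, metis, metis Diff_iff insertI1)
  then have "range p \<subseteq> {1..5}" unfolding UNIV_5 ab cd by (simp add: p_def)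
  moreover have "pent_edges p = range e"
  proof -
    have perm: "{A, B, C, D, E} = {A, C, E, B, D}" for A B C D E :: "nat set" by blast
    have "{d, c} = {c, d}" "{f, a} = {a, f}" by blast+
    then have "pent_edges p = {e 0, e 3, e 1, e 4, e 2}"
      unfolding pent_edges_eq ab cd e3 by (simp add: p_def)
    also have "\<dots> = {e 0, e 1, e 2, e 3, e 4}" by (rule perm)
    also have "\<dots> = range e" unfolding UNIV_5 by simp
    finally show ?thesis .
  qed
  ultimately show ?thesis using pentagon_is_section by metis
qed

text \<open>The lines \<open>E\<close> of consecutive sides of a combinatorial pentagon do not meet; taking every
  other side gives the cyclic order in which they do.\<close>

lemma pentagon_disjoint_cycle:
  fixes p :: "5 \<Rightarrow> nat"
  assumes "inj p" "range p \<subseteq> {1..5}"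
  defines "e \<equiv> \<lambda>i. {p (2 * i), p (2 * i + 1)}"
  shows "\<And>i. e i \<in> pairs5" "inj e" "\<And>i. e i \<inter> e (i + 1) = {}" "\<And>i. e i \<inter> e (i + 2) \<noteq> {}" "range e = pent_edges p"
proof -
  have val: "p x \<in> {1..5}" for x using assms(2) by blast
  show "e i \<in> pairs5" for i unfolding e_def
    using assms(1) by (intro doubleton_in_pairs5 val) (simp add: inj_eq)
  show "inj e"
  proof (rule injI)
    fix i j assume "e i = e j"
    then have "2 * i = 2 * j \<or> (2 * i = 2 * j + 1 \<and> 2 * i + 1 = 2 * j)"
      using assms(1) unfolding e_def doubleton_eq_iff inj_eq[OF assms(1)] by blast
    moreover have "\<not> (2 * i = 2 * j + 1 \<and> 2 * i + 1 = 2 * j)"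
    proof
      assume h: "2 * i = 2 * j + 1 \<and> 2 * i + 1 = 2 * j"
      then have "2 * j + 1 + 1 = 2 * j" by metis
      then show False by (simp add: add.assoc)
    qed
    ultimately have "3 * (2 * i) = 3 * (2 * j)" by simp
    then show "i = j" by (simp add: mult.assoc[symmetric] numerals_mod_5)
  qed
  show "e i \<inter> e (i + 1) = {}" for i
    using assms(1) by (simp add: e_def inj_eq algebra_simps)
  show "e i \<inter> e (i + 2) \<noteq> {}" for i
    by (simp add: e_def algebra_simps numerals_mod_5)
  show "range e = pent_edges p"
    unfolding pent_edges_eq UNIV_5 e_def by (simp add: numerals_mod_5 insert_commute)
qed

section \<open>Geometrical pentagons\<close>

text \<open>In the order of \<open>pentagon_disjoint_cycle\<close> consecutive lines meet, and their
  intersection points are the vertices. Consecutive vertices differ because a common point would lie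
  on the lines i - 1 and i + 1, whose edges share an index.\<close>

lemma geometrical_pentagon_section:
  assumes s: "s \<in> sec_indices"
  shows "lines_union (edges s) \<in> geometrical_pentagons_in_dP5"
proof -
  note cyc = pentagon_disjoint_cycle[OF verts_pentagon(1, 2)[OF s]]
  obtain e where e: "e = (\<lambda>i. {verts s (2 * i), verts s (2 * i + 1)})" by blast
  have c: "\<And>i. e i \<in> pairs5" "inj e" "\<And>i. e i \<inter> e (i + 1) = {}" "\<And>i. e i \<inter> e (i + 2) \<noteq> {}"
    and r: "range e = edges s"
    unfolding e using cyc verts_pentagon(3)[OF s] by simp_all
  have "\<exists>w. w \<noteq> 0 \<and> w \<in> line_space (e i) \<and> w \<in> line_space (e (i + 1))" for i
    by (rule line_space_meet[OF c(1) c(1) c(3)])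
  then obtain w where w: "\<And>i. w i \<noteq> 0" "\<And>i. w i \<in> line_space (e i)" "\<And>i. w i \<in> line_space (e (i + 1))" by metis
  \<comment> \<open>Since \<open>w i\<close> lies on the lines i and i + 1, the shift makes
    \<open>q i\<close> and \<open>q (i + 1)\<close> the two vertices on the line i.\<close>
  define q where "q i = vec.span {w (i - 1)}" for i
  define L where "L i = proj (line_space (e i))" for i
  have ind: "indep2 (w (i - 1)) (w i)" for i
  proof (rule span1_neq_indep2[OF w(1) w(1)], rule notI)
    assume "vec.span {w (i - 1)} = vec.span {w i}"
    then have "w i \<in> line_space (e (i - 1))"
      using w(2)[of "i - 1"] span1_subset[OF subspace_line_space] by metis
    moreover have "w i \<in> line_space (e (i - 1 + 2))" using w(3)[of i] by (simp add: algebra_simps)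
    moreover have "e (i - 1) \<noteq> e (i - 1 + 2)" using c(2) by (simp add: inj_eq)
    ultimately have "w i = 0" using line_space_meet_trivial[OF c(1) c(1) _ c(4)] by blast
    then show False using w(1) by blast
  qed
  have joins: "L i = line_joining (q i) (q (i + 1))" for i
  proof -
    obtain a b where ab: "line_space (e i) = vec.span {a, b}" using line_space_basis c(1) by blast
    have "w (i - 1) \<in> line_space (e i)" using w(3)[of "i - 1"] by simp
    then have "vec.span {w (i - 1), w i} = line_space (e i)"
      using span2_eq[OF _ _ ind] w(2)[of i] ab by metis
    then show ?thesis by (simp add: L_def q_def line_joining_eq)
  qed
  have "inj L" unfolding L_def by (rule injI) (simp add: proj_line_space_inject c(1) inj_eq[OF c(2)])
  moreover have "q i \<in> proj_space" for i using w(1) by (simp add: q_def)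
  moreover have "q i \<noteq> q (i + 1)" for i
  proof
    assume "q i = q (i + 1)"
    then have "w i \<in> vec.span {w (i - 1)}" using vec.span_base[of "w i" "{w i}"] by (simp add: q_def)
    then show False using ind[of i] indep2_iff w(1) by blast
  qed
  moreover have "lines_union (edges s) = (\<Union>i. L i)" unfolding lines_union_def L_def r[symmetric] by blast
  ultimately have "geometrical_pentagon (lines_union (edges s))"
    unfolding geometrical_pentagon_def using joins by blast
  moreover have "lines_union (edges s) \<subseteq> dP5"
    unfolding lines_union_def using line_in_dP5 edges_subset[OF s] by blast
  ultimately show ?thesis by (simp add: geometrical_pentagons_in_dP5_def)
qed

text \<open>Each side is one of the ten lines. Consecutive sides share a vertex, so their edges are
  disjoint by \<open>line_space_meet_trivial\<close>, and the combinatorial classification of such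
  cycles applies.\<close>

lemma geometrical_pentagon_is_section:
  assumes "S \<in> geometrical_pentagons_in_dP5"
  shows "\<exists>s\<in>sec_indices. S = lines_union (edges s)"
proof -
  obtain L :: "5 \<Rightarrow> _" and q :: "5 \<Rightarrow> _" where L: "inj L" "\<And>i. q i \<in> proj_space" "\<And>i. q i \<noteq> q (i + 1)"
    "\<And>i. L i = line_joining (q i) (q (i + 1))" "S = (\<Union>i. L i)" and S: "S \<subseteq> dP5"
    using assms unfolding geometrical_pentagons_in_dP5_def geometrical_pentagon_def by blast
  have "\<forall>i. \<exists>v. v \<noteq> 0 \<and> q i = vec.span {v}" using L(2) by (simp add: proj_space_iff)
  then obtain v where v: "\<And>i. v i \<noteq> 0" "\<And>i. q i = vec.span {v i}" by metis
  have ind: "indep2 (v i) (v (i + 1))" for i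
    by (rule span1_neq_indep2[OF v(1) v(1)]) (use L(3)[of i] v(2) in metis)
  have Li: "L i = proj (vec.span {v i, v (i + 1)})" for i using L(4)[of i] v(2) line_joining_eq by metis
  have "\<forall>i. \<exists>e\<in>pairs5. L i = proj (line_space e)"
  proof
    fix i
    have "proj (vec.span {v i, v (i + 1)}) \<subseteq> dP5" using Li[of i] L(5) S by blast
    then show "\<exists>e\<in>pairs5. L i = proj (line_space e)" using lines_in_dP5[OF ind] Li by metis
  qed
  then obtain e where e: "\<And>i. e i \<in> pairs5" "\<And>i. L i = proj (line_space (e i))" by metis
  have inj: "inj e" using L(1) e(2) by (metis injD injI)
  have disj: "e i \<inter> e (i + 1) = {}" for i
  proof (rule ccontr)
    assume n: "e i \<inter> e (i + 1) \<noteq> {}"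
    have eq: "line_space (e i) = vec.span {v i, v (i + 1)}" for i
      using e(2)[of i] Li[of i] proj_inject[OF subspace_line_space vec.subspace_span] by metis
    have "v (i + 1) \<in> line_space (e i)" "v (i + 1) \<in> line_space (e (i + 1))"
      unfolding eq by (simp_all add: vec.span_base)
    moreover have "e i \<noteq> e (i + 1)" using inj by (simp add: inj_eq)
    ultimately show False using line_space_meet_trivial[OF e(1) e(1) _ n] v(1) by blast
  qed
  obtain s where "s \<in> sec_indices" "edges s = range e" using disjoint_cycle_is_section[OF e(1) inj disj] by blast
  then have "lines_union (edges s) = S" unfolding lines_union_def using L(5) e(2) by simp
  then show ?thesis using \<open>s \<in> sec_indices\<close> by blast
qed

lemma geometrical_pentagons_eq: "geometrical_pentagons_in_dP5 = (\<lambda>s. lines_union (edges s)) ` sec_indices"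
  using geometrical_pentagon_section geometrical_pentagon_is_section by blast

lemma reduced_divisor_inject:
  assumes s: "s \<in> sec_indices" and t: "t \<in> sec_indices"
    and eq: "reduced_divisor (lines_union (edges s)) = reduced_divisor (lines_union (edges t))"
  shows "s = t"
proof -
  have "C \<in> (\<lambda>e. proj (line_space e)) ` edges s \<longleftrightarrow> C \<in> (\<lambda>e. proj (line_space e)) ` edges t" for C
    using fun_cong[OF eq, of C] unfolding reduced_divisor_lines[OF s] reduced_divisor_lines[OF t]
    by (simp split: if_splits)
  then have *: "(\<lambda>e. proj (line_space e)) ` edges s = (\<lambda>e. proj (line_space e)) ` edges t" by blast
  have "inj_on (\<lambda>e. proj (line_space e)) pairs5" using proj_line_space_inject by (intro inj_onI) blast
  then have "edges s = edges t" using * edges_subset[OF s] edges_subset[OF t] by (metis inj_on_image_eq_iff)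
  then show ?thesis using edges_inject s t by blast
qed

section \<open>Counts and the bijection with combinatorial pentagons\<close>

lemma sections_eq: "sections = sec ` sec_indices"
  unfolding sections_def by (auto simp: image_iff Bex_def) (metis+)

lemma card_sec_indices: "card sec_indices = 12"
  by (simp add: card_cartesian_product index_pairs_eq)

text \<open>The divisors of zeros already differ, so the cubics need not be compared.\<close>

lemma inj_on_sec: "inj_on sec sec_indices"
  by (rule inj_onI) (metis divisor_of_zeros_sec reduced_divisor_inject)

lemma inj_on_lines_union: "inj_on (\<lambda>s. lines_union (edges s)) sec_indices"
  by (rule inj_onI) (metis reduced_divisor_inject)

lemma card_geometrical: "card geometrical_pentagons_in_dP5 = 12"
  unfolding geometrical_pentagons_eq using inj_on_lines_union card_sec_indices card_image by metis

lemma card_sections: "card sections = 12"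
  unfolding sections_eq using inj_on_sec card_sec_indices card_image by metis

lemma reduced_divisor_bij:
  "bij_betw reduced_divisor geometrical_pentagons_in_dP5 (divisor_of_zeros ` sections)"
proof (rule bij_betw_imageI)
  show "inj_on reduced_divisor geometrical_pentagons_in_dP5"
    unfolding geometrical_pentagons_eq
    by (rule inj_on_imageI, rule inj_onI, unfold o_apply, rule reduced_divisor_inject)
  have "divisor_of_zeros ` sections = (\<lambda>s. reduced_divisor (lines_union (edges s))) ` sec_indices"
    unfolding sections_eq image_image by (rule image_cong[OF refl]) (rule divisor_of_zeros_sec)
  then show "reduced_divisor ` geometrical_pentagons_in_dP5 = divisor_of_zeros ` sections"
    unfolding geometrical_pentagons_eq image_image by simp
qed

text \<open>All members of a class have the same edges; the union over the class avoids choosing one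
  of them.\<close>

definition pent_to_geom :: "(5 \<Rightarrow> nat) set \<Rightarrow> (complex ^ 6) set set" where
  "pent_to_geom A = lines_union (\<Union>p\<in>A. pent_edges p)"

lemma pent_to_geom_class: "pent_to_geom (pentagon_class p) = lines_union (pent_edges p)"
proof -
  have "(\<Union>q\<in>pentagon_class p. pent_edges q) = pent_edges p" using pent_edges_class pentagon_class_self by blast
  then show ?thesis by (simp add: pent_to_geom_def)
qed

lemma pent_to_geom_verts: "s \<in> sec_indices \<Longrightarrow> pent_to_geom (pentagon_class (verts s)) = lines_union (edges s)"
  by (simp only: pent_to_geom_class verts_pentagon(3))

lemma pent_to_geom_bij:
  "bij_betw pent_to_geom (combinatorial_pentagons {1..5}) geometrical_pentagons_in_dP5"
proof (rule bij_betw_imageI)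
  show "pent_to_geom ` combinatorial_pentagons {1..5} = geometrical_pentagons_in_dP5"
    unfolding combinatorial_pentagons_eq geometrical_pentagons_eq image_image
    by (rule image_cong[OF refl]) (rule pent_to_geom_verts)
  show "inj_on pent_to_geom (combinatorial_pentagons {1..5})"
  proof (rule inj_onI)
    fix A B assume "A \<in> combinatorial_pentagons {1..5::nat}" "B \<in> combinatorial_pentagons {1..5}"
      and eq: "pent_to_geom A = pent_to_geom B"
    then obtain s t where "s \<in> sec_indices" "t \<in> sec_indices" "A = pentagon_class (verts s)" "B = pentagon_class (verts t)"
      unfolding combinatorial_pentagons_eq by blast
    then show "A = B" using eq pent_to_geom_verts inj_onD[OF inj_on_lines_union] by metis
  qed
qed

lemma pent_to_geom_divisor:
  assumes p: "inj p" "range p \<subseteq> {1..5}"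
  shows "reduced_divisor (pent_to_geom (pentagon_class p)) =
    (\<lambda>C. \<Sum>i\<in>UNIV. prime_divisor (E_line (p i) (p (i + 1))) C)"
proof
  fix C
  obtain s where s: "s \<in> sec_indices" "pentagon_class p = pentagon_class (verts s)" "pent_edges p = edges s"
    using pentagon_is_section[OF p] by blast
  have val: "p i \<in> {1..5}" for i using p(2) by blast
  have ne: "p i \<noteq> p (i + 1)" for i using p(1) by (simp add: inj_eq)
  let ?L = "\<lambda>i. proj (line_space {p i, p (i + 1)})"
  have inj: "?L i = ?L j \<longleftrightarrow> i = j" for i j
  proof
    assume "?L i = ?L j"
    then have "{p i, p (i + 1)} = {p j, p (j + 1)}"
      using proj_line_space_inject doubleton_in_pairs5[OF val val ne] by metis
    then have "i = j \<or> (i = j + 1 \<and> i + 1 = j)" using p(1) by (simp add: doubleton_eq_iff inj_eq)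
    \<comment> \<open>An edge that coincides with another one with its ends exchanged would give 2 =
      0 modulo 5.\<close>
    moreover have "\<not> (i = j + 1 \<and> i + 1 = j)"
    proof
      assume "i = j + 1 \<and> i + 1 = j"
      then have "j + 1 + 1 = j" by metis
      then show False by (simp add: add.assoc)
    qed
    ultimately show "i = j" by blast
  qed simp
  have "(\<Sum>i\<in>UNIV. prime_divisor (E_line (p i) (p (i + 1))) C) = (\<Sum>i\<in>UNIV. if C = ?L i then 1 else 0)"
    by (rule sum.cong[OF refl]) (simp add: prime_divisor_def E_line_eq[OF val val ne])
  also have "\<dots> = (if C \<in> range ?L then 1 else 0)"
  proof (cases "C \<in> range ?L")
    case True
    then obtain j where "C = ?L j" by blast
    then have "(if C = ?L i then 1 else 0) = (if i = j then 1 else 0 :: int)" for i using inj by auto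
    then show ?thesis using True by simp
  next
    case False
    then have "C \<noteq> ?L i" for i by blast
    then show ?thesis using False by simp
  qed
  also have "range ?L = (\<lambda>e. proj (line_space e)) ` edges s"
    unfolding s(3)[symmetric] pent_edges_def by blast
  also have "(if C \<in> (\<lambda>e. proj (line_space e)) ` edges s then 1 else 0) = reduced_divisor (pent_to_geom (pentagon_class p)) C"
    unfolding s(2) pent_to_geom_verts[OF s(1)] reduced_divisor_lines[OF s(1)] by (rule refl)
  finally show "reduced_divisor (pent_to_geom (pentagon_class p)) C =
    (\<Sum>i\<in>UNIV. prime_divisor (E_line (p i) (p (i + 1))) C)" by simp
qed

section \<open>Quadrics and double pentagons\<close>

text \<open>On each coordinate line only two of the six cubics survive. The points of that line with
  coordinates (1, 1) and (1, -1) yield the sum and the difference of their two coefficients.\<close>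

lemma s_basis_independent:
  assumes "\<And>x. (\<Sum>m\<in>UNIV. c $ m * s_basis m x) = (\<Sum>m\<in>UNIV. d $ m * s_basis m x)"
  shows "c = d"
proof -
  define z where "z = c - d"
  have e: "(\<Sum>m\<in>UNIV. z $ m * s_basis m x) = 0" for x
    using assms[of x] by (simp add: z_def left_diff_distrib sum_subtractf)
  have pm: "a = 0 \<and> b = 0" if "a + b = 0" "a - b = 0" for a b :: complex
  proof -
    have "2 * a = (a + b) + (a - b)" by simp
    then have "a = 0" unfolding that by simp
    then show ?thesis using that by simp
  qed
  note val = e[unfolded sum_6 s_basis_sec]
  have 13: "z $ 1 = 0 \<and> z $ 3 = 0"
    by (rule pm) (use val[of "vector [1, 1, 0]"] val[of "vector [1, -1, 0]"] in \<open>simp_all add: s_form_def\<close>)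
  have 25: "z $ 2 = 0 \<and> z $ 5 = 0"
    by (rule pm) (use val[of "vector [1, 0, 1]"] val[of "vector [1, 0, -1]"] in \<open>simp_all add: s_form_def\<close>)
  have 46: "z $ 4 = 0 \<and> z $ 6 = 0"
    by (rule pm) (use val[of "vector [0, 1, 1]"] val[of "vector [0, 1, -1]"] in \<open>simp_all add: s_form_def\<close>)
  have "z $ m = 0" for m using 13 25 46 exhaust_6[of m] by auto
  then show ?thesis by (simp add: vec_eq_iff z_def)
qed

lemma coords_eq: "coords (\<lambda>x. \<Sum>m\<in>UNIV. c $ m * s_basis m x) = c"
  unfolding coords_def
proof (rule the_equality)
  fix d assume "(\<lambda>x. \<Sum>m\<in>UNIV. c $ m * s_basis m x) = (\<lambda>x. \<Sum>m\<in>UNIV. d $ m * s_basis m x)"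
  then show "d = c" using s_basis_independent[of d c] by metis
qed (rule refl)

fun sec_coords :: "sec_index \<Rightarrow> complex ^ 6" where
  "sec_coords (b, i, j) = (let k = 6 - i - j in
     if b then of_int (sign (perm3 i j k)) *s (axis (s_index i k) 1 - axis (s_index k i) 1 - axis (s_index j k) 1)
     else axis (s_index i j) 1)"

lemma sec_eq_combination: "s \<in> sec_indices \<Longrightarrow> sec s = (\<lambda>x. \<Sum>m\<in>UNIV. sec_coords s $ m * s_basis m x)"
proof -
  have "\<forall>s\<in>sec_indices. sec s = (\<lambda>x. \<Sum>m\<in>UNIV. sec_coords s $ m * s_basis m x)"
    unfolding ball_sec_indices all_bool_eq sum_6 s_basis_sec
    by (simp add: s_index_def axis_def sigma_form_def fun_eq_iff sign_perm3)
  then show "s \<in> sec_indices \<Longrightarrow> sec s = (\<lambda>x. \<Sum>m\<in>UNIV. sec_coords s $ m * s_basis m x)" by blast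
qed

lemma coords_sec: "s \<in> sec_indices \<Longrightarrow> coords (sec s) = sec_coords s"
  by (simp only: sec_eq_combination coords_eq)

lemma linear_form_sec:
  assumes "s \<in> sec_indices"
  shows "linear_form (sec s) w = sec_lin s w"
proof -
  have "\<forall>s\<in>sec_indices. (\<Sum>m\<in>UNIV. sec_coords s $ m * w $ m) = sec_lin s w"
    unfolding ball_sec_indices all_bool_eq sum_6
    by (simp add: s_index_def axis_def algebra_simps)
  then show ?thesis using assms by (simp only: linear_form_def coords_sec)
qed

lemma quadric_eq:
  assumes "(i, j) \<in> index_pairs"
  shows "quadric i j w = sec_lin (False, i, j) w * sec_lin (True, i, j) w"
  using assms linear_form_sec[of "(False, i, j)" w] linear_form_sec[of "(True, i, j)" w]
  by (simp add: quadric_def)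

lemma quadric_inject:
  assumes "(i, j) \<in> index_pairs" "(i', j') \<in> index_pairs" "quadric i j = quadric i' j'"
  shows "(i, j) = (i', j')"
proof -
  have "quadric i j w = quadric i' j' w" for w using assms(3) by simp
  then have eq: "sec_lin (False, i, j) w * sec_lin (True, i, j) w = sec_lin (False, i', j') w * sec_lin (True, i', j') w" for w
    using quadric_eq assms(1, 2) by metis
  have "sec_lin (False, i, j) w * sec_lin (True, i, j) w - sec_lin (False, i', j') w * sec_lin (True, i', j') w = 0" for w
    using eq by simp
  \<comment> \<open>On these three vectors \<open>quadric i j\<close> takes the values of a signed
    unit vector, with 1 or -1 in place i. The six quadrics give the six different signed unit
    vectors.\<close>
  note eqs = this[of "v6 1 1 0 0 0 0"] this[of "v6 0 0 1 1 0 0"] this[of "v6 0 0 0 0 1 1"]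
  show ?thesis using assms(1, 2) eqs
    unfolding index_pairs_eq by (elim insertE emptyE; simp add: s_index_def sign_perm3)
qed

definition double_of :: "nat \<times> nat \<Rightarrow> (5 \<Rightarrow> nat) set set" where
  "double_of ij = {pentagon_class (verts (False, ij)), pentagon_class (verts (True, ij))}"

text \<open>Halving modulo 5 is multiplication by 3, so a shift by a before doubling the index
  becomes a shift by \<open>3 * a\<close> after it. The neighbour therefore depends only on the
  class.\<close>

lemma neighbour_class:
  fixes p q :: "5 \<Rightarrow> 'a"
  assumes "pentagon_class p = pentagon_class q"
  shows "pentagon_class (\<lambda>i. p (2 * i)) = pentagon_class (\<lambda>i. q (2 * i))"
proof -
  have "p \<in> pentagon_class q" using assms pentagon_class_self by metis
  then obtain e a where e: "e = 1 \<or> e = -1" and p: "p = (\<lambda>i. q (e * i + a))" by (auto simp: pentagon_class_def)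
  have "2 * (e * i + 3 * a) = e * (2 * i) + (6 * a)" for i :: 5 by (simp add: algebra_simps)
  then have "(\<lambda>i. p (2 * i)) = (\<lambda>i. (\<lambda>i. q (2 * i)) (e * i + 3 * a))" unfolding p by (simp add: numerals_mod_5 mult.left_commute)
  then have "(\<lambda>i. p (2 * i)) \<in> pentagon_class (\<lambda>i. q (2 * i))" unfolding pentagon_class_def using e by blast
  then show ?thesis by (rule pentagon_class_eq)
qed

lemma verts_True: "verts (True, i, j) = (\<lambda>n. verts (False, i, j) (2 * n))"
  by (simp add: fun_eq_iff)

text \<open>Doubling twice multiplies the index by 4 = -1, a reflection; hence being neighbours is a
  symmetric relation.\<close>

lemma verts_True_double: "pentagon_class (\<lambda>n. verts (True, i, j) (2 * n)) = pentagon_class (verts (False, i, j))"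
proof -
  have "2 * (2 * n) = - 1 * n + 0" for n :: 5
  proof -
    have "2 * (2 * n) = (2 * 2) * n" by (simp only: mult.assoc)
    also have "(2 * 2 :: 5) = - 1" by simp
    finally show ?thesis by simp
  qed
  then have "(\<lambda>n. verts (True, i, j) (2 * n)) = (\<lambda>n. verts (False, i, j) (- 1 * n + 0))"
    unfolding verts_True by presburger
  then have "(\<lambda>n. verts (True, i, j) (2 * n)) \<in> pentagon_class (verts (False, i, j))"
    unfolding pentagon_class_def by blast
  then show ?thesis by (rule pentagon_class_eq)
qed

lemma double_pentagons_eq: "double_pentagons {1..5} = double_of ` index_pairs"
proof
  show "double_pentagons {1..5} \<subseteq> double_of ` index_pairs"
  proof
    fix D assume "D \<in> double_pentagons {1..5::nat}"
    then obtain A B where D: "D = {A, B}" "A \<in> combinatorial_pentagons {1..5}" "neighbouring A B"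
      by (auto simp: double_pentagons_def)
    obtain b i j where s: "(b, i, j) \<in> sec_indices" "A = pentagon_class (verts (b, i, j))"
      using D(2) unfolding combinatorial_pentagons_eq by auto
    obtain p where p: "A = pentagon_class p" "B = pentagon_class (\<lambda>i. p (2 * i))"
      using D(3) by (auto simp: neighbouring_def)
    then have B: "B = pentagon_class (\<lambda>n. verts (b, i, j) (2 * n))" using neighbour_class s(2) by metis
    have "D = double_of (i, j)"
    proof (cases b)
      case True
      then have "B = pentagon_class (verts (False, i, j))" using B verts_True_double by metis
      then show ?thesis using D(1) s(2) True by (simp only: double_of_def insert_commute)
    next
      case False
      then have "B = pentagon_class (verts (True, i, j))" using B by (simp only: verts_True)
      then show ?thesis using D(1) s(2) False by (simp only: double_of_def)
    qed
    then show "D \<in> double_of ` index_pairs" using s(1) by auto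
  qed
  show "double_of ` index_pairs \<subseteq> double_pentagons {1..5}"
  proof
    fix D assume "D \<in> double_of ` index_pairs"
    then obtain i j where ij: "(i, j) \<in> index_pairs" "D = double_of (i, j)" by auto
    have "neighbouring (pentagon_class (verts (False, i, j))) (pentagon_class (verts (True, i, j)))"
      unfolding neighbouring_def verts_True by blast
    moreover have "pentagon_class (verts (b, i, j)) \<in> combinatorial_pentagons {1..5}" for b
      unfolding combinatorial_pentagons_eq using ij(1) by blast
    ultimately show "D \<in> double_pentagons {1..5}" unfolding double_pentagons_def ij(2) double_of_def by blast
  qed
qed

lemma double_of_inject:
  assumes "ij \<in> index_pairs" "kl \<in> index_pairs" "double_of ij = double_of kl"
  shows "ij = kl"
proof -
  have "pentagon_class (verts (False, ij)) \<in> double_of kl" using assms(3) unfolding double_of_def by blast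
  then have "(False, ij) = (False, kl) \<or> (False, ij) = (True, kl)"
    unfolding double_of_def using class_verts_inject[of "(False, ij)"] assms(1, 2) by blast
  then show ?thesis by blast
qed

text \<open>A bare bijection between two sets of six elements says little. It is pinned down by
  requiring that the two pentagons be those of the two linear factors of the quadric.\<close>

lemma quadrics_double_pentagons:
  "card quadrics = 6 \<and>
   (\<exists>\<Delta>. bij_betw \<Delta> quadrics (double_pentagons {1..5::nat}) \<and>
     (\<forall>(i, j)\<in>index_pairs. \<exists>A B. \<Delta> (quadric i j) = {A, B} \<and>
        A \<in> combinatorial_pentagons {1..5} \<and> B \<in> combinatorial_pentagons {1..5} \<and>
        reduced_divisor (pent_to_geom A) = divisor_of_zeros (s_form i j) \<and>
        reduced_divisor (pent_to_geom B) = divisor_of_zeros (sigma_form i j)))"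
proof -
  define Q where "Q = (\<lambda>ij. quadric (fst ij) (snd ij))"
  have im: "quadrics = Q ` index_pairs" unfolding quadrics_def Q_def by force
  have inj: "inj_on Q index_pairs" unfolding Q_def by (rule inj_onI) (metis quadric_inject prod.collapse)
  then have QB: "bij_betw Q index_pairs quadrics" unfolding im by (rule inj_on_imp_bij_betw)
  have "bij_betw double_of index_pairs (double_pentagons {1..5})"
    unfolding double_pentagons_eq by (rule inj_on_imp_bij_betw) (metis inj_onI double_of_inject)
  define \<Delta> where "\<Delta> = double_of \<circ> inv_into index_pairs Q"
  have "bij_betw \<Delta> quadrics (double_pentagons {1..5})"
    unfolding \<Delta>_def by (rule bij_betw_trans[OF bij_betw_inv_into[OF QB]]) fact
  moreover have "\<exists>A B. \<Delta> (quadric i j) = {A, B} \<and>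
        A \<in> combinatorial_pentagons {1..5} \<and> B \<in> combinatorial_pentagons {1..5} \<and>
        reduced_divisor (pent_to_geom A) = divisor_of_zeros (s_form i j) \<and>
        reduced_divisor (pent_to_geom B) = divisor_of_zeros (sigma_form i j)" if ij: "(i, j) \<in> index_pairs" for i j
  proof (intro exI conjI)
    show "\<Delta> (quadric i j) = {pentagon_class (verts (False, i, j)), pentagon_class (verts (True, i, j))}"
      using inv_into_f_f[OF inj ij] by (simp add: \<Delta>_def Q_def double_of_def del: verts.simps)
    show "pentagon_class (verts (False, i, j)) \<in> combinatorial_pentagons {1..5}"
      "pentagon_class (verts (True, i, j)) \<in> combinatorial_pentagons {1..5}"
      unfolding combinatorial_pentagons_eq using ij by blast+
    have s: "(b, i, j) \<in> sec_indices" for b using ij by simp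
    show "reduced_divisor (pent_to_geom (pentagon_class (verts (False, i, j)))) = divisor_of_zeros (s_form i j)"
      using divisor_of_zeros_sec[OF s, of False] pent_to_geom_verts[OF s, of False] by simp
    show "reduced_divisor (pent_to_geom (pentagon_class (verts (True, i, j)))) = divisor_of_zeros (sigma_form i j)"
      using divisor_of_zeros_sec[OF s, of True] pent_to_geom_verts[OF s, of True] by simp
  qed
  moreover have "card quadrics = card index_pairs" unfolding im by (rule card_image[OF inj])
  then have "card quadrics = 6" by (simp add: index_pairs_eq)
  ultimately show ?thesis by blast
qed

section \<open>Cubic forms vanishing at the four points\<close>

text \<open>The generation rules of \<open>homogeneous_poly\<close> supply no coefficients; this
  normal form as a list of monomial terms is the way to them.\<close>

inductive monomial_span :: "nat \<Rightarrow> form \<Rightarrow> bool" where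
  zero: "monomial_span d (\<lambda>_. 0)"
| step: "monomial_span d f \<Longrightarrow> a + b + c = d \<Longrightarrow>
    monomial_span d (\<lambda>x. \<kappa> * (x $ 1 ^ a * x $ 2 ^ b * x $ 3 ^ c) + f x)"

lemma monomial_span_add: "monomial_span d f \<Longrightarrow> monomial_span d g \<Longrightarrow> monomial_span d (\<lambda>x. f x + g x)"
proof (induction rule: monomial_span.induct)
  case (zero d)
  then show ?case by simp
next
  case (step d f a b c \<kappa>)
  show ?case using monomial_span.step[OF step.IH[OF step.prems] step.hyps(2), of \<kappa>] by (simp add: add.assoc)
qed

lemma monomial_span_monomial: "a + b + c = d \<Longrightarrow> monomial_span d (\<lambda>x. \<kappa> * (x $ 1 ^ a * x $ 2 ^ b * x $ 3 ^ c))"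
  using monomial_span.step[OF monomial_span.zero, of a b c d \<kappa>] by simp

lemma monomial_span_mult_monomial:
  assumes "monomial_span d f" "a + b + c = e"
  shows "monomial_span (e + d) (\<lambda>x. \<kappa> * (x $ 1 ^ a * x $ 2 ^ b * x $ 3 ^ c) * f x)"
  using assms(1)
proof (induction rule: monomial_span.induct)
  case (zero d)
  then show ?case using monomial_span.zero by simp
next
  case (step d f a' b' c' \<kappa>')
  have "monomial_span (e + d) (\<lambda>x. (\<kappa> * \<kappa>') * (x $ 1 ^ (a + a') * x $ 2 ^ (b + b') * x $ 3 ^ (c + c'))
      + \<kappa> * (x $ 1 ^ a * x $ 2 ^ b * x $ 3 ^ c) * f x)"
    using step assms(2) by (intro monomial_span.step) auto
  then show ?case by (simp add: algebra_simps power_add)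
qed

lemma monomial_span_mult:
  assumes "monomial_span d f" "monomial_span e g"
  shows "monomial_span (d + e) (\<lambda>x. f x * g x)"
  using assms(1)
proof (induction rule: monomial_span.induct)
  case (zero d)
  then show ?case using monomial_span.zero by simp
next
  case (step d f a b c \<kappa>)
  have "monomial_span (d + e) (\<lambda>x. \<kappa> * (x $ 1 ^ a * x $ 2 ^ b * x $ 3 ^ c) * g x)"
    using monomial_span_mult_monomial[OF assms(2) step(2)] .
  from monomial_span_add[OF this step.IH] show ?case by (simp add: algebra_simps)
qed

lemma homogeneous_monomial_span: "homogeneous_poly d f \<Longrightarrow> monomial_span d f"
proof (induction rule: homogeneous_poly.induct)
  case (const c)
  then show ?case using monomial_span_monomial[of 0 0 0 0 c] by simp
next
  case (coord i)
  then show ?case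
    using monomial_span_monomial[of 1 0 0 1 1] monomial_span_monomial[of 0 1 0 1 1] monomial_span_monomial[of 0 0 1 1 1]
      exhaust_3[of i] by auto
qed (auto intro: monomial_span_add monomial_span_mult)

lemma monomial_span_sum:
  assumes "monomial_span d f"
  shows "\<exists>K. \<forall>x. f x = (\<Sum>p\<in>(SIGMA a:{..d}. {..d - a}). K p * (x $ 1 ^ fst p * x $ 2 ^ snd p * x $ 3 ^ (d - fst p - snd p)))"
  using assms
proof (induction rule: monomial_span.induct)
  case (zero d)
  then show ?case by (intro exI[of _ "\<lambda>_. 0"]) simp
next
  case (step d f a b c \<kappa>)
  let ?S = "SIGMA a:{..d}. {..d - a}"
  let ?m = "\<lambda>x :: complex ^ 3. \<lambda>p. x $ 1 ^ fst p * x $ 2 ^ snd p * x $ 3 ^ (d - fst p - snd p)"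
  obtain K where K: "\<And>x. f x = (\<Sum>p\<in>?S. K p * ?m x p)" using step.IH by blast
  have "\<kappa> * (x $ 1 ^ a * x $ 2 ^ b * x $ 3 ^ c) + f x = (\<Sum>p\<in>?S. (K p + (if p = (a, b) then \<kappa> else 0)) * ?m x p)" for x
  proof -
    have "(\<Sum>p\<in>?S. (K p + (if p = (a, b) then \<kappa> else 0)) * ?m x p) =
      (\<Sum>p\<in>?S. K p * ?m x p) + (\<Sum>p\<in>?S. if p = (a, b) then \<kappa> * ?m x p else 0)"
      unfolding sum.distrib[symmetric] by (rule sum.cong) (auto simp: algebra_simps)
    also have "(\<Sum>p\<in>?S. if p = (a, b) then \<kappa> * ?m x p else 0) = \<kappa> * ?m x (a, b)"
      using step.hyps(2) by (subst sum.delta) auto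
    also have "?m x (a, b) = x $ 1 ^ a * x $ 2 ^ b * x $ 3 ^ c" using step.hyps(2) by auto
    finally show ?thesis using K[of x] by simp
  qed
  then show ?case by (intro exI[of _ "\<lambda>p. K p + (if p = (a, b) then \<kappa> else 0)"] allI)
qed

definition form_of :: "complex ^ 6 \<Rightarrow> form" where
  "form_of c = (\<lambda>x. \<Sum>m\<in>UNIV. c $ m * s_basis m x)"

lemma form_of_eq: "form_of c x = c $ 1 * s_form 1 2 x + c $ 2 * s_form 1 3 x + c $ 3 * s_form 2 1 x
    + c $ 4 * s_form 2 3 x + c $ 5 * s_form 3 1 x + c $ 6 * s_form 3 2 x"
  by (simp add: form_of_def sum_6 s_basis_sec)

lemma coords_form_of: "coords (form_of c) = c"
  unfolding form_of_def by (rule coords_eq)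

text \<open>Of the ten coefficients of a cubic, vanishing at the coordinate points removes those of
  the cubes, and vanishing at (1:1:1) expresses that of the product of all three coordinates by the
  others. The remaining six belong to the monomials \<open>x\<^sub>i x\<^sub>j\<^sup>2\<close>, and
  each of these occurs in \<open>s\<^sub>i\<^sub>j\<close> alone.\<close>

lemma V_forms_eq: "V_forms = range form_of"
proof
  show "range form_of \<subseteq> V_forms"
  proof
    fix P assume "P \<in> range form_of"
    then obtain c where P: "P = form_of c" by blast
    have "homogeneous_poly 3 P" unfolding P form_of_eq[abs_def]
      by (intro homogeneous_poly.add homogeneous_poly_cmult homogeneous_s_form)
    moreover have "\<forall>i\<in>{1..4}. P (pt i) = 0" unfolding ball_14 P form_of_eq by (simp add: s_form_def pt_def)
    ultimately show "P \<in> V_forms" by (simp add: V_forms_def)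
  qed
  show "V_forms \<subseteq> range form_of"
  proof
    fix P assume "P \<in> V_forms"
    then have h: "homogeneous_poly 3 P" and v: "\<forall>i\<in>{1..4}. P (pt i) = 0" by (auto simp: V_forms_def)
    obtain K where K: "\<And>x. P x = (\<Sum>p\<in>(SIGMA a:{..3}. {..3 - a}). K p * (x $ 1 ^ fst p * x $ 2 ^ snd p * x $ 3 ^ (3 - fst p - snd p)))"
      using monomial_span_sum[OF homogeneous_monomial_span[OF h]] by blast
    have S: "(\<Sum>p\<in>(SIGMA a:{..3}. {..3 - a}). g p) = g (0, 0) + g (0, 1) + g (0, 2) + g (0, 3) + g (1, 0) + g (1, 1) + g (1, 2)
      + g (2, 0) + g (2, 1) + g (3, 0)" for g :: "nat \<times> nat \<Rightarrow> complex"
      using sum.Sigma[of "{..3}" "\<lambda>a. {..3 - a}" "\<lambda>a b. g (a, b)"]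
      by (simp add: numeral_3_eq_3 numeral_2_eq_2 atMost_Suc ac_simps)
    have P: "P x = K (0, 0) * x $ 3 ^ 3 + K (0, 1) * (x $ 2 * x $ 3 ^ 2) + K (0, 2) * (x $ 2 ^ 2 * x $ 3) + K (0, 3) * x $ 2 ^ 3
      + K (1, 0) * (x $ 1 * x $ 3 ^ 2) + K (1, 1) * (x $ 1 * x $ 2 * x $ 3) + K (1, 2) * (x $ 1 * x $ 2 ^ 2)
      + K (2, 0) * (x $ 1 ^ 2 * x $ 3) + K (2, 1) * (x $ 1 ^ 2 * x $ 2) + K (3, 0) * x $ 1 ^ 3" for x
      unfolding K S by simp
    have z: "K (3, 0) = 0" "K (0, 3) = 0" "K (0, 0) = 0"
      using v unfolding ball_14 P by (simp_all add: pt_def)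
    have "P (pt 4) = 0" using v by simp
    then have "K (0, 1) + K (0, 2) + K (1, 0) + K (1, 1) + K (1, 2) + K (2, 0) + K (2, 1) = 0"
      unfolding P z by (simp add: pt_def)
    then have k: "K (1, 1) = - K (0, 1) - K (0, 2) - K (1, 0) - K (1, 2) - K (2, 0) - K (2, 1)"
      by (simp add: eq_neg_iff_add_eq_0 algebra_simps)
    have "P x = form_of (v6 (K (1, 2)) (K (1, 0)) (K (2, 1)) (K (0, 1)) (K (2, 0)) (K (0, 2))) x" for x
      unfolding P z k form_of_eq by (simp add: s_form_def algebra_simps power2_eq_square)
    then show "P \<in> range form_of" by blast
  qed
qed

section \<open>Tournaments on five vertices\<close>

text \<open>Pentagons with a starting vertex and an orientation. Passing to
  \<open>tournament\<close> forgets exactly the starting vertex; reversing the orientation changes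
  the sign.\<close>

definition pentagons5 :: "(5 \<Rightarrow> nat) set" where
  "pentagons5 = {p. inj p \<and> range p = {1..5}}"

text \<open>\<open>chi\<close> makes \<open>tournament p\<close> the sum of the oriented cycle \<open>p\<close> and of the reversed oriented cycle
  \<open>i \<mapsto> p (2 * i)\<close>.\<close>

definition chi :: "5 \<Rightarrow> complex" where
  "chi n = (if n = 1 \<or> n = 3 then 1 else if n = 2 \<or> n = 4 then -1 else 0)"

definition tournament :: "(5 \<Rightarrow> nat) \<Rightarrow> nat \<Rightarrow> nat \<Rightarrow> complex" where
  "tournament p x y = (if x \<in> {1..5} \<and> y \<in> {1..5} then chi (inv_into UNIV p y - inv_into UNIV p x) else 0)"

definition circulations :: "(nat \<Rightarrow> nat \<Rightarrow> complex) set" where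
  "circulations = {A. (\<forall>x y. A x y = - A y x) \<and> (\<forall>x y. x \<notin> {1..5} \<longrightarrow> A x y = 0) \<and> (\<forall>x\<in>{1..5}. (\<Sum>y=1..5. A x y) = 0)}"

lemma tournament_apply: "p \<in> pentagons5 \<Longrightarrow> tournament p (p a) (p b) = chi (b - a)"
  unfolding tournament_def pentagons5_def by (auto simp: inv_f_f)

lemma pentagons5_I: "inj p \<Longrightarrow> range p \<subseteq> {1..5} \<Longrightarrow> p \<in> pentagons5"
proof -
  assume p: "inj p" "range p \<subseteq> {1..5::nat}"
  have "card (range p) = 5" using p(1) by (simp add: card_image)
  then have "range p = {1..5}" using p(2) by (intro card_subset_eq) simp_all
  then show "p \<in> pentagons5" using p(1) unfolding pentagons5_def by blast
qed

lemma pentagons5_cases: "p \<in> pentagons5 \<Longrightarrow> x \<in> {1..5} \<Longrightarrow> \<exists>a. x = p a"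
  unfolding pentagons5_def by blast

lemma chi_minus: "chi (- n) = - chi n"
  using exhaust_5[of n] by (auto simp: chi_def)

lemma tournament_circulation:
  assumes p: "p \<in> pentagons5"
  shows "tournament p \<in> circulations"
proof -
  have "tournament p x y = - tournament p y x" for x y
    unfolding tournament_def using chi_minus[of "inv_into UNIV p y - inv_into UNIV p x"] by auto
  moreover have "tournament p x y = 0" if "x \<notin> {1..5}" for x y using that by (auto simp: tournament_def)
  moreover have "(\<Sum>y=1..5. tournament p x y) = 0" if x: "x \<in> {1..5}" for x
  proof -
    obtain a where a: "x = p a" using pentagons5_cases p x by blast
    have "(\<Sum>y=1..5. tournament p x y) = (\<Sum>b\<in>UNIV. tournament p x (p b))"
      using p sum.reindex[of p UNIV "tournament p x"] by (simp add: pentagons5_def)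
    also have "\<dots> = (\<Sum>b\<in>UNIV. chi (b - a))" unfolding a tournament_apply[OF p] ..
    also have "\<dots> = (\<Sum>b\<in>UNIV. chi b)"
      by (rule sum.reindex_bij_witness[of _ "\<lambda>b. b + a" "\<lambda>b. b - a"]) auto
    also have "\<dots> = 0" unfolding sum_5 by (simp add: chi_def)
    finally show ?thesis .
  qed
  ultimately show ?thesis unfolding circulations_def by blast
qed

lemma tournament_affine:
  assumes p: "p \<in> pentagons5"
  shows "(\<lambda>i. p (i + a)) \<in> pentagons5" "tournament (\<lambda>i. p (i + a)) = tournament p"
    "(\<lambda>i. p (- i + a)) \<in> pentagons5" "tournament (\<lambda>i. p (- i + a)) x y = - tournament p x y"
proof -
  have r: "range p = {1..5}" and i: "inj p" using p by (auto simp: pentagons5_def)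
  show q: "(\<lambda>i. p (i + a)) \<in> pentagons5"
    using r by (intro pentagons5_I injI) (auto simp: inj_eq[OF i])
  show q': "(\<lambda>i. p (- i + a)) \<in> pentagons5"
    using r by (intro pentagons5_I injI) (auto simp: inj_eq[OF i])
  show "tournament (\<lambda>i. p (i + a)) = tournament p"
  proof (intro ext)
    fix x y
    show "tournament (\<lambda>i. p (i + a)) x y = tournament p x y"
    proof (cases "x \<in> {1..5} \<and> y \<in> {1..5}")
      case False
      then show ?thesis by (auto simp: tournament_def)
    next
      case True
      then obtain b c where bc: "x = p b" "y = p c" using pentagons5_cases[OF p] by metis
      then show ?thesis using tournament_apply[OF q, of "b - a" "c - a"] tournament_apply[OF p, of b c] by simp
    qed
  qed
  show "tournament (\<lambda>i. p (- i + a)) x y = - tournament p x y"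
  proof (cases "x \<in> {1..5} \<and> y \<in> {1..5}")
    case False
    then show ?thesis by (auto simp: tournament_def)
  next
    case True
    then obtain b c where bc: "x = p b" "y = p c" using pentagons5_cases[OF p] by metis
    then show ?thesis using tournament_apply[OF q', of "a - b" "a - c"] tournament_apply[OF p, of b c] chi_minus[of "c - b"]
      by simp
  qed
qed

text \<open>The regular tournament has only rotations as automorphisms. Once the vertex 0 is fixed,
  its out-neighbours 1 and 3 and its in-neighbours 2 and 4 are preserved as sets, and the arcs among
  these four fix each of them.\<close>

lemma chi_rigid:
  assumes r: "\<And>a b. chi (r b - r a) = chi (b - a)"
  shows "r b = b + r 0"
proof -
  have z: "chi (r b - r 0) = chi b" for b using r[of b 0] by simp
  define t where "t b = r b - r 0" for b
  have t: "chi (t b) = chi b" "chi (t b - t a) = chi (b - a)" for a b using z r by (simp_all add: t_def)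
  have one: "chi n = 1 \<longleftrightarrow> n = 1 \<or> n = 3" "chi n = -1 \<longleftrightarrow> n = 2 \<or> n = 4" for n by (auto simp: chi_def)
  have t0: "t 0 = 0" by (simp add: t_def)
  have "chi (t 1) = 1" "chi (t 3) = 1" "chi (t 2) = -1" "chi (t 4) = -1" unfolding t by (simp_all add: chi_def)
  then have c: "t 1 = 1 \<or> t 1 = 3" "t 3 = 1 \<or> t 3 = 3" "t 2 = 2 \<or> t 2 = 4" "t 4 = 2 \<or> t 4 = 4"
    unfolding one by blast+
  have "chi (t 3 - t 1) = -1" "chi (t 2 - t 1) = 1" "chi (t 3 - t 2) = 1" "chi (t 4 - t 2) = -1" "chi (t 4 - t 3) = 1"
    unfolding t by (simp_all add: chi_def)
  then have "t 1 = 1 \<and> t 2 = 2 \<and> t 3 = 3 \<and> t 4 = 4" using c by (auto simp: chi_def)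
  then have "t b = b" for b using t0 exhaust_5[of b] by auto
  then show ?thesis by (metis t_def diff_add_cancel)
qed

lemma tournament_inject:
  assumes p: "p \<in> pentagons5" and q: "q \<in> pentagons5" and eq: "tournament p = tournament q"
  shows "\<exists>a. q = (\<lambda>i. p (i + a))"
proof -
  have "\<forall>b. q b \<in> {1..5}" using q by (auto simp: pentagons5_def)
  then have "\<forall>b. \<exists>a. q b = p a" using pentagons5_cases[OF p] by blast
  then obtain r where r: "\<And>b. q b = p (r b)" by metis
  have "chi (r b - r a) = chi (b - a)" for a b
    using tournament_apply[OF p, of "r a" "r b"] tournament_apply[OF q, of a b] eq r by simp
  then have "r b = b + r 0" for b by (rule chi_rigid)
  then have "q = (\<lambda>i. p (i + r 0))" using r by metis
  then show ?thesis by blast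
qed

section \<open>The representation on circulations\<close>

text \<open>Inverse, on circulations, of the linear map that sends the basis vector \<open>s_form i j\<close> to the tournament
  of its pentagon.\<close>

definition circ_coord :: "(nat \<Rightarrow> nat \<Rightarrow> complex) \<Rightarrow> nat \<Rightarrow> nat \<Rightarrow> complex" where
  "circ_coord A i j = (A i 4 + A i (6 - i - j)) / 2"

definition circ_coords :: "(nat \<Rightarrow> nat \<Rightarrow> complex) \<Rightarrow> complex ^ 6" where
  "circ_coords A = v6 (circ_coord A 1 2) (circ_coord A 1 3) (circ_coord A 2 1) (circ_coord A 2 3) (circ_coord A 3 1) (circ_coord A 3 2)"

abbreviation tour :: "nat \<Rightarrow> nat \<Rightarrow> nat \<Rightarrow> nat \<Rightarrow> complex" where
  "tour i j \<equiv> tournament (verts (False, i, j))"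

definition circ_of :: "complex ^ 6 \<Rightarrow> nat \<Rightarrow> nat \<Rightarrow> complex" where
  "circ_of c x y = c $ 1 * tour 1 2 x y + c $ 2 * tour 1 3 x y + c $ 3 * tour 2 1 x y
     + c $ 4 * tour 2 3 x y + c $ 5 * tour 3 1 x y + c $ 6 * tour 3 2 x y"

definition circ_form :: "(nat \<Rightarrow> nat \<Rightarrow> complex) \<Rightarrow> form" where
  "circ_form A = form_of (circ_coords A)"

lemma verts_values:
  "verts (False, i, j) 0 = i" "verts (False, i, j) 1 = 4" "verts (False, i, j) 2 = j"
  "verts (False, i, j) 3 = 6 - i - j" "verts (False, i, j) 4 = 5"
  "verts (True, i, j) 0 = i" "verts (True, i, j) 1 = j" "verts (True, i, j) 2 = 5"
  "verts (True, i, j) 3 = 4" "verts (True, i, j) 4 = 6 - i - j"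
  by simp_all

declare verts.simps [simp del]

lemma tournament_values:
  assumes p: "p \<in> pentagons5" and v: "p 0 = a" "p 1 = b" "p 2 = c" "p 3 = d" "p 4 = e"
  shows "tournament p a b = 1" "tournament p a c = -1" "tournament p a d = 1" "tournament p a e = -1"
    "tournament p b a = -1" "tournament p b c = 1" "tournament p b d = -1" "tournament p b e = 1"
    "tournament p c a = 1" "tournament p c b = -1" "tournament p c d = 1" "tournament p c e = -1"
    "tournament p d a = -1" "tournament p d b = 1" "tournament p d c = -1" "tournament p d e = 1"
    "tournament p e a = 1" "tournament p e b = -1" "tournament p e c = 1" "tournament p e d = -1"
  using tournament_apply[OF p] unfolding v[symmetric] by (simp_all add: chi_def)

lemma verts_in_pentagons5: "s \<in> sec_indices \<Longrightarrow> verts s \<in> pentagons5"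
  by (rule pentagons5_I[OF verts_pentagon(1, 2)])

lemma tour_values:
  assumes "(i, j) \<in> index_pairs" "k = 6 - i - j"
  shows "tour i j i 4 = 1" "tour i j j 4 = -1" "tour i j k 4 = 1" "tour i j i j = -1" "tour i j i k = 1"
    "tour i j j i = 1" "tour i j j k = 1" "tour i j k i = -1" "tour i j k j = -1"
proof -
  have s: "verts (False, i, j) \<in> pentagons5" using assms(1) by (intro verts_in_pentagons5) simp
  show "tour i j i 4 = 1" "tour i j j 4 = -1" "tour i j k 4 = 1" "tour i j i j = -1" "tour i j i k = 1"
    "tour i j j i = 1" "tour i j j k = 1" "tour i j k i = -1" "tour i j k j = -1"
    unfolding assms(2) by (rule tournament_values[OF s verts_values(1-5)])+
qed

lemma tour_values_True:
  assumes "(i, j) \<in> index_pairs" "k = 6 - i - j"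
  defines "t \<equiv> tournament (verts (True, i, j))"
  shows "t i 4 = 1" "t j 4 = -1" "t k 4 = -1" "t i j = 1" "t i k = -1"
    "t j i = -1" "t j k = 1" "t k i = 1" "t k j = -1"
proof -
  have s: "verts (True, i, j) \<in> pentagons5" using assms(1) by (intro verts_in_pentagons5) simp
  show "t i 4 = 1" "t j 4 = -1" "t k 4 = -1" "t i j = 1" "t i k = -1"
    "t j i = -1" "t j k = 1" "t k i = 1" "t k j = -1"
    unfolding t_def assms(2) by (rule tournament_values[OF s verts_values(6-10)])+
qed

lemma index_pairs_mem: "(Suc 0, 2) \<in> index_pairs" "(Suc 0, 3) \<in> index_pairs" "(2, Suc 0) \<in> index_pairs"
  "(2, 3) \<in> index_pairs" "(3, Suc 0) \<in> index_pairs" "(3, 2) \<in> index_pairs"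
  by (simp_all add: index_pairs_eq)

lemmas tour_simps =
  tour_values[OF index_pairs_mem(1), of 3, simplified] tour_values[OF index_pairs_mem(2), of 2, simplified]
  tour_values[OF index_pairs_mem(3), of 3, simplified] tour_values[OF index_pairs_mem(4), of "Suc 0", simplified]
  tour_values[OF index_pairs_mem(5), of 2, simplified] tour_values[OF index_pairs_mem(6), of "Suc 0", simplified]

lemmas tour_True_simps =
  tour_values_True[OF index_pairs_mem(1), of 3, simplified] tour_values_True[OF index_pairs_mem(2), of 2, simplified]
  tour_values_True[OF index_pairs_mem(3), of 3, simplified] tour_values_True[OF index_pairs_mem(4), of "Suc 0", simplified]
  tour_values_True[OF index_pairs_mem(5), of 2, simplified] tour_values_True[OF index_pairs_mem(6), of "Suc 0", simplified]

text \<open>With k the third index, the functional \<open>A i 4 + A i k\<close> has the value 2 on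
  the tournament of \<open>s\<^sub>i\<^sub>j\<close> and 0 on the tournaments of the other five
  basis elements.\<close>

lemma circ_coords_circ_of: "circ_coords (circ_of c) = c"
  by (simp add: vec_eq_iff forall_6 circ_coords_def circ_coord_def circ_of_def tour_simps)

text \<open>The second equation is the relation defining \<open>\<sigma>\<^sub>i\<^sub>j\<close>,
  verified between tournaments. The orientation chosen in \<open>verts\<close> ignores the sign of
  the permutation, which therefore appears as a factor.\<close>

lemma circ_form_tournament:
  assumes "(i, j) \<in> index_pairs"
  shows "circ_form (tournament (verts (False, i, j))) = s_form i j"
    "circ_form (tournament (verts (True, i, j))) = (\<lambda>x. of_int (sign (perm3 i j (6 - i - j))) * sigma_form i j x)"
proof -
  show "circ_form (tournament (verts (False, i, j))) = s_form i j"
    using assms unfolding index_pairs_eq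
    by (elim insertE emptyE; simp add: fun_eq_iff circ_form_def form_of_eq circ_coords_def circ_coord_def tour_simps)
  show "circ_form (tournament (verts (True, i, j))) = (\<lambda>x. of_int (sign (perm3 i j (6 - i - j))) * sigma_form i j x)"
    using assms unfolding index_pairs_eq
    by (elim insertE emptyE; simp add: fun_eq_iff circ_form_def form_of_eq circ_coords_def circ_coord_def tour_True_simps
        sigma_form_def sign_perm3)
qed

lemma circulationsI:
  assumes "\<And>x y. A x y = - A y x" "\<And>x y. x \<notin> {1..5} \<Longrightarrow> A x y = 0" "\<And>x. x \<in> {1..5} \<Longrightarrow> (\<Sum>y=1..5. A x y) = 0"
  shows "A \<in> circulations"
  using assms unfolding circulations_def by blast

lemma circulationsD:
  assumes "A \<in> circulations"
  shows "A x y = - A y x" "x \<notin> {1..5} \<Longrightarrow> A x y = 0" "x \<in> {1..5} \<Longrightarrow> (\<Sum>y=1..5. A x y) = 0"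
  using assms unfolding circulations_def by blast+

lemma circulations_combination:
  assumes A: "A \<in> circulations" and B: "B \<in> circulations"
  shows "(\<lambda>x y. a * A x y + b * B x y) \<in> circulations"
proof (rule circulationsI)
  show "a * A x y + b * B x y = - (a * A y x + b * B y x)" for x y
    by (simp add: circulationsD(1)[OF A, of x y] circulationsD(1)[OF B, of x y])
  show "a * A x y + b * B x y = 0" if "x \<notin> {1..5}" for x y
    by (simp only: circulationsD(2)[OF A that] circulationsD(2)[OF B that]) simp
  show "(\<Sum>y=1..5. a * A x y + b * B x y) = 0" if "x \<in> {1..5}" for x
    unfolding sum.distrib sum_distrib_left[symmetric] circulationsD(3)[OF A that] circulationsD(3)[OF B that] by simp
qed

lemma circulations_scale: "A \<in> circulations \<Longrightarrow> (\<lambda>x y. a * A x y) \<in> circulations"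
  using circulations_combination[of A A a 0] by simp

lemma circulations_add: "A \<in> circulations \<Longrightarrow> B \<in> circulations \<Longrightarrow> (\<lambda>x y. A x y + B x y) \<in> circulations"
  using circulations_combination[of A B 1 1] by simp

lemma circ_of_circulation: "circ_of c \<in> circulations"
proof -
  have t: "tour i j \<in> circulations" if "(i, j) \<in> index_pairs" for i j
    using that by (intro tournament_circulation verts_in_pentagons5) simp
  show ?thesis unfolding circ_of_def[abs_def]
    by (intro circulations_add circulations_scale t) (simp_all add: index_pairs_eq)
qed

text \<open>Vanishing coordinates mean that \<open>A i 4\<close> is the negative of
  \<open>A i k\<close> for both other indices k up to 3. By antisymmetry these equations force
  \<open>A 1 2 = - A 1 2\<close> and make all entries with indices up to 4 zero; the zero row sums
  then remove those with index 5.\<close>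

lemma circulation_eq_0:
  assumes A: "A \<in> circulations" and 0: "circ_coords A = 0"
  shows "A = (\<lambda>x y. 0)"
proof -
  note anti = circulationsD(1)[OF A] and supp = circulationsD(2)[OF A]
  have I: "{1..5::nat} = {1, 2, 3, 4, 5}" by auto
  have S: "(\<Sum>y=1..5. g y) = g 1 + g 2 + g 3 + g 4 + g 5" for g :: "nat \<Rightarrow> complex"
    unfolding I by (simp add: ac_simps)
  have row: "A x 1 + A x 2 + A x 3 + A x 4 + A x 5 = 0" if "x \<in> {1..5}" for x
    using circulationsD(3)[OF A that] unfolding S .
  have diag: "A x x = 0" for x using anti[of x x] by simp
  have "A 1 4 + A 1 3 = 0" "A 1 4 + A 1 2 = 0" "A 2 4 + A 2 3 = 0" "A 2 4 + A 2 1 = 0" "A 3 4 + A 3 2 = 0" "A 3 4 + A 3 1 = 0"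
    using 0 by (simp_all add: circ_coords_def circ_coord_def vec_eq_iff forall_6)
  then have e: "A 1 4 = - A 1 3" "A 1 4 = - A 1 2" "A 2 4 = - A 2 3" "A 2 4 = - A 2 1" "A 3 4 = - A 3 2" "A 3 4 = - A 3 1"
    unfolding eq_neg_iff_add_eq_0 .
  have "A 1 4 = - A 1 2" "A 2 4 = A 1 2" "A 1 4 = - A 1 3" "A 3 4 = A 1 3" "A 2 4 = - A 2 3" "A 3 4 = A 2 3"
    using e anti by metis+
  then have "A 1 2 = A 1 3" "A 2 3 = - A 1 2" "A 2 3 = A 1 3" by simp_all
  then have "A 1 2 = - A 1 2" by simp
  then have z: "A 1 2 = 0" "A 1 3 = 0" "A 2 3 = 0" "A 1 4 = 0" "A 2 4 = 0" "A 3 4 = 0"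
    using \<open>A 1 2 = A 1 3\<close> \<open>A 2 3 = A 1 3\<close> \<open>A 1 4 = - A 1 2\<close> \<open>A 2 4 = A 1 2\<close> \<open>A 3 4 = A 1 3\<close> by simp_all
  then have z': "A 2 1 = 0" "A 3 1 = 0" "A 3 2 = 0" "A 4 1 = 0" "A 4 2 = 0" "A 4 3 = 0"
    using anti[of 2 1] anti[of 3 1] anti[of 3 2] anti[of 4 1] anti[of 4 2] anti[of 4 3] by simp_all
  have z5: "A 1 5 = 0" "A 2 5 = 0" "A 3 5 = 0" "A 4 5 = 0"
    using row[of 1] row[of 2] row[of 3] row[of 4] by (simp_all add: z[simplified] z'[simplified] diag)
  then have z5': "A 5 1 = 0" "A 5 2 = 0" "A 5 3 = 0" "A 5 4 = 0"
    using anti[of 5 1] anti[of 5 2] anti[of 5 3] anti[of 5 4] by simp_all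
  have "A x y = 0" for x y
  proof (cases "x \<in> {1..5} \<and> y \<in> {1..5}")
    case False
    then show ?thesis using supp[of x y] supp[of y x] anti[of x y] by auto
  next
    case True
    then have "x \<in> {1, 2, 3, 4, 5}" "y \<in> {1, 2, 3, 4, 5}" unfolding I by blast+
    then show ?thesis using z z' z5 z5' diag by (elim insertE emptyE) (simp_all only:)
  qed
  then show ?thesis by blast
qed

lemma circ_coords_combination:
  "circ_coords (\<lambda>x y. a * A x y + b * B x y) = a *s circ_coords A + b *s circ_coords B"
  by (simp add: vec_eq_iff forall_6 circ_coords_def circ_coord_def algebra_simps add_divide_distrib)

lemma circ_of_circ_coords:
  assumes "A \<in> circulations"
  shows "circ_of (circ_coords A) = A"
proof -
  have "(\<lambda>x y. 1 * circ_of (circ_coords A) x y + (-1) * A x y) = (\<lambda>x y. 0)"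
    by (rule circulation_eq_0[OF circulations_combination[OF circ_of_circulation assms]])
      (simp only: circ_coords_combination circ_coords_circ_of, simp add: vec_eq_iff)
  then show ?thesis by (simp add: fun_eq_iff)
qed

lemma circ_form_inject: "A \<in> circulations \<Longrightarrow> B \<in> circulations \<Longrightarrow> circ_form A = circ_form B \<longleftrightarrow> A = B"
  unfolding circ_form_def by (metis coords_form_of circ_of_circ_coords)

lemma V_forms_circ: "V_forms = circ_form ` circulations"
proof
  show "V_forms \<subseteq> circ_form ` circulations"
    unfolding V_forms_eq circ_form_def using circ_of_circulation circ_coords_circ_of by (metis image_eqI image_subsetI)
qed (auto simp: V_forms_eq circ_form_def)

definition act :: "(nat \<Rightarrow> nat) \<Rightarrow> (nat \<Rightarrow> nat \<Rightarrow> complex) \<Rightarrow> nat \<Rightarrow> nat \<Rightarrow> complex" where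
  "act \<tau> A = (\<lambda>x y. of_int (sign \<tau>) * A (inv_into UNIV \<tau> x) (inv_into UNIV \<tau> y))"

lemma act_circulation:
  assumes \<tau>: "\<tau> permutes {1..5}" and A: "A \<in> circulations"
  shows "act \<tau> A \<in> circulations"
proof -
  let ?i = "inv_into UNIV \<tau>"
  have i: "?i permutes {1..5}" by (rule permutes_inv[OF \<tau>])
  have "(\<lambda>x y. A (?i x) (?i y)) \<in> circulations"
  proof (rule circulationsI)
    have mem: "?i x \<in> {1..5} \<longleftrightarrow> x \<in> {1..5}" for x by (rule permutes_in_image[OF i])
    show "A (?i x) (?i y) = - A (?i y) (?i x)" for x y by (rule circulationsD(1)[OF A])
    show "A (?i x) (?i y) = 0" if "x \<notin> {1..5}" for x y
      using that mem by (intro circulationsD(2)[OF A]) blast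
    fix x :: nat assume x: "x \<in> {1..5}"
    have "(\<Sum>y=1..5. A (?i x) (?i y)) = (\<Sum>y=1..5. A (?i x) y)"
      using sum.permute[OF i, of "A (?i x)"] by (simp add: o_def)
    also have "\<dots> = 0" using x mem by (intro circulationsD(3)[OF A]) blast
    finally show "(\<Sum>y=1..5. A (?i x) (?i y)) = 0" .
  qed
  then show ?thesis unfolding act_def by (rule circulations_scale)
qed

lemma act_id: "act id A = A"
  by (simp add: act_def sign_id)

lemma act_compose:
  assumes "\<sigma> permutes {1..5}" "\<tau> permutes {1..5}"
  shows "act (\<sigma> \<circ> \<tau>) A = act \<sigma> (act \<tau> A)"
proof -
  have "bij \<sigma>" "bij \<tau>" using assms permutes_bij by blast+
  then have "inv_into UNIV (\<sigma> \<circ> \<tau>) = inv_into UNIV \<tau> \<circ> inv_into UNIV \<sigma>" by (rule o_inv_distrib)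
  moreover have "permutation \<sigma>" "permutation \<tau>" using assms permutation_permutes by blast+
  ultimately show ?thesis by (simp add: act_def sign_compose fun_eq_iff)
qed

lemma permutes_pentagon:
  assumes "\<tau> permutes {1..5}" "p \<in> pentagons5"
  shows "\<tau> \<circ> p \<in> pentagons5"
proof -
  have "range (\<tau> \<circ> p) = \<tau> ` range p" by (rule image_comp[symmetric])
  then show ?thesis
    using assms(2) permutes_inj[OF assms(1)] permutes_image[OF assms(1)] unfolding pentagons5_def
    by (simp add: inj_compose)
qed

lemma act_tournament:
  assumes \<tau>: "\<tau> permutes {1..5}" and p: "p \<in> pentagons5"
  shows "act \<tau> (tournament p) = (\<lambda>x y. of_int (sign \<tau>) * tournament (\<tau> \<circ> p) x y)"
proof (intro ext)
  fix x y
  let ?i = "inv_into UNIV \<tau>"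
  have i: "?i x \<in> {1..5} \<longleftrightarrow> x \<in> {1..5}" for x by (rule permutes_in_image[OF permutes_inv[OF \<tau>]])
  have "tournament p (?i x) (?i y) = tournament (\<tau> \<circ> p) x y"
  proof (cases "x \<in> {1..5} \<and> y \<in> {1..5}")
    case False
    then show ?thesis using i by (auto simp: tournament_def)
  next
    case True
    then obtain a b where ab: "?i x = p a" "?i y = p b" using i pentagons5_cases[OF p] by metis
    then have "x = (\<tau> \<circ> p) a" "y = (\<tau> \<circ> p) b" using permutes_inverses(1)[OF \<tau>] by (metis comp_apply)+
    then show ?thesis using tournament_apply[OF p] tournament_apply[OF permutes_pentagon[OF \<tau> p]] ab by metis
  qed
  then show "act \<tau> (tournament p) x y = of_int (sign \<tau>) * tournament (\<tau> \<circ> p) x y" by (simp add: act_def)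
qed

lemma circ_form_scale: "circ_form (\<lambda>x y. c * A x y) = (\<lambda>z. c * circ_form A z)"
  using circ_coords_combination[of c A 0 A] by (simp add: circ_form_def form_of_def fun_eq_iff sum_distrib_left mult.assoc)

section \<open>The action of the symmetric group\<close>

text \<open>The restriction to \<open>V_forms\<close> makes each \<open>rho \<tau>\<close>
  extensional, as membership in \<open>Bij V_forms\<close> demands.\<close>

definition rho :: "(nat \<Rightarrow> nat) \<Rightarrow> form \<Rightarrow> form" where
  "rho \<tau> = (\<lambda>P\<in>V_forms. circ_form (act \<tau> (circ_of (coords P))))"

lemma circ_form_in_V: "A \<in> circulations \<Longrightarrow> circ_form A \<in> V_forms"
  using V_forms_circ by blast

lemma rho_circ_form: "A \<in> circulations \<Longrightarrow> rho \<tau> (circ_form A) = circ_form (act \<tau> A)"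
  using circ_form_in_V by (simp add: rho_def) (simp add: circ_form_def coords_form_of circ_of_circ_coords)

lemma rho_compose:
  assumes "\<sigma> permutes {1..5}" "\<tau> permutes {1..5}" "P \<in> V_forms"
  shows "rho (\<sigma> \<circ> \<tau>) P = rho \<sigma> (rho \<tau> P)"
  using assms act_circulation[OF assms(2)] unfolding V_forms_circ by (auto simp: rho_circ_form act_compose)

lemma rho_id: "P \<in> V_forms \<Longrightarrow> rho id P = P"
  unfolding V_forms_circ by (auto simp: rho_circ_form act_id)

lemma rho_closed: "\<tau> permutes {1..5} \<Longrightarrow> P \<in> V_forms \<Longrightarrow> rho \<tau> P \<in> V_forms"
  using act_circulation circ_form_in_V unfolding V_forms_circ by (auto simp: rho_circ_form)

lemma rho_group_action: "group_action (sym_group 5) V_forms rho"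
proof -
  have inv: "inv_into UNIV \<tau> permutes {1..5}" "\<tau> \<circ> inv_into UNIV \<tau> = id" "inv_into UNIV \<tau> \<circ> \<tau> = id"
    if "\<tau> permutes {1..5}" for \<tau> :: "nat \<Rightarrow> nat"
    using that permutes_inv permutes_inv_o by blast+
  have bij: "rho \<tau> \<in> Bij V_forms" if t: "\<tau> permutes {1..5}" for \<tau>
  proof -
    have "bij_betw (rho \<tau>) V_forms V_forms"
      by (rule bij_betw_byWitness[where f' = "rho (inv_into UNIV \<tau>)"])
        (use rho_compose[OF inv(1)[OF t] t] rho_compose[OF t inv(1)[OF t]] inv[OF t] rho_id rho_closed t in auto)
    then show ?thesis by (simp add: Bij_def rho_def)
  qed
  have "rho \<in> hom (sym_group 5) (BijGroup V_forms)"
  proof (rule homI)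
    fix \<tau> assume "\<tau> \<in> carrier (sym_group 5)"
    then show "rho \<tau> \<in> carrier (BijGroup V_forms)" using bij by (simp add: sym_group_carrier BijGroup_def)
  next
    fix \<sigma> \<tau> assume "\<sigma> \<in> carrier (sym_group 5)" "\<tau> \<in> carrier (sym_group 5)"
    then have st: "\<sigma> permutes {1..5}" "\<tau> permutes {1..5}" by (simp_all add: sym_group_carrier)
    have "rho (\<sigma> \<circ> \<tau>) = compose V_forms (rho \<sigma>) (rho \<tau>)"
    proof
      fix P show "rho (\<sigma> \<circ> \<tau>) P = compose V_forms (rho \<sigma>) (rho \<tau>) P"
        by (cases "P \<in> V_forms") (simp_all add: rho_compose[OF st] compose_def, simp add: rho_def)
    qed
    then show "rho (\<sigma> \<otimes>\<^bsub>sym_group 5\<^esub> \<tau>) = rho \<sigma> \<otimes>\<^bsub>BijGroup V_forms\<^esub> rho \<tau>"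
      using bij st by (simp add: sym_group_mult BijGroup_def)
  qed
  then show ?thesis
    by (intro group_action.intro group_hom.intro group_hom_axioms.intro sym_group_is_group group_BijGroup)
qed

lemma form_of_combination: "form_of (a *s c + b *s d) = (\<lambda>x. a * form_of c x + b * form_of d x)"
  by (simp add: fun_eq_iff form_of_eq algebra_simps)

lemma rho_linear:
  assumes "P \<in> V_forms" "P' \<in> V_forms"
  shows "rho \<tau> (\<lambda>x. a * P x + b * P' x) = (\<lambda>x. a * rho \<tau> P x + b * rho \<tau> P' x)"
proof -
  obtain A where A: "P = circ_form A" "A \<in> circulations" using assms(1) V_forms_circ by blast
  obtain B where B: "P' = circ_form B" "B \<in> circulations" using assms(2) V_forms_circ by blast
  have lin: "(\<lambda>x. a * circ_form A x + b * circ_form B x) = circ_form (\<lambda>x y. a * A x y + b * B x y)" for A B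
    unfolding circ_form_def circ_coords_combination form_of_combination ..
  have "act \<tau> (\<lambda>x y. a * A x y + b * B x y) = (\<lambda>x y. a * act \<tau> A x y + b * act \<tau> B x y)"
    by (simp add: act_def fun_eq_iff algebra_simps)
  then show ?thesis using A B circulations_combination[OF A(2) B(2)] by (simp add: lin rho_circ_form)
qed

lemma rho_tournament:
  assumes "\<tau> permutes {1..5}" "p \<in> pentagons5"
  shows "rho \<tau> (circ_form (tournament p)) = (\<lambda>x. of_int (sign \<tau>) * circ_form (tournament (\<tau> \<circ> p)) x)"
  using assms by (simp add: rho_circ_form tournament_circulation act_tournament circ_form_scale)

lemma rho_s_form:
  assumes "\<tau> permutes {1..5}" "(i, j) \<in> index_pairs"
  shows "rho \<tau> (s_form i j) = (\<lambda>x. of_int (sign \<tau>) * circ_form (tournament (\<tau> \<circ> verts (False, i, j))) x)"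
  using rho_tournament[OF assms(1) verts_in_pentagons5[of "(False, i, j)"]] assms(2) circ_form_tournament(1)[OF assms(2)]
  by simp

lemma circ_form_rotation: "p \<in> pentagons5 \<Longrightarrow> circ_form (tournament (\<lambda>i. p (i + a))) = circ_form (tournament p)"
  by (simp add: tournament_affine(2))

lemma circ_form_reflection:
  assumes "p \<in> pentagons5"
  shows "circ_form (tournament (\<lambda>i. p (- i + a))) = (\<lambda>x. - circ_form (tournament p) x)"
proof -
  have "tournament (\<lambda>i. p (- i + a)) = (\<lambda>x y. (-1) * tournament p x y)"
    using tournament_affine(4)[OF assms] by (simp add: fun_eq_iff)
  then show ?thesis by (simp only: circ_form_scale) simp
qed

text \<open>Permutations of 1, 2, 3 fix the labels 4 and 5 and respect the third index, so they
  carry the standard pentagons to standard pentagons without rotation or reflection; only the sign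
  of the permutation remains.\<close>

lemma index_pairs_permute:
  assumes \<tau>: "\<tau> permutes {1..3}" and ij: "(i, j) \<in> index_pairs"
  shows "(\<tau> i, \<tau> j) \<in> index_pairs" "\<tau> \<circ> verts (False, i, j) = verts (False, \<tau> i, \<tau> j)"
proof -
  let ?k = "6 - i - j"
  have k: "?k \<in> {1..3}" "i \<in> {1..3}" "j \<in> {1..3}" "i \<noteq> j" "i \<noteq> ?k" "j \<noteq> ?k"
    using ij unfolding index_pairs_eq by auto
  have t: "\<tau> x \<in> {1..3}" if "x \<in> {1..3}" for x using permutes_in_image[OF \<tau>] that by blast
  then have t': "\<tau> x \<in> {1..5} \<and> \<tau> x \<noteq> 4 \<and> \<tau> x \<noteq> 5" if "x \<in> {1..3}" for x using that by force
  have ne: "\<tau> x \<noteq> \<tau> y" if "x \<noteq> y" for x y using permutes_inj[OF \<tau>] that by (simp add: inj_eq)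
  have *: "(\<tau> i, \<tau> j) \<in> index_pairs \<and> \<tau> ?k = 6 - \<tau> i - \<tau> j"
    using t' ne k by (intro three_of_five) blast+
  then show "(\<tau> i, \<tau> j) \<in> index_pairs" ..
  have "\<tau> 4 = 4" "\<tau> 5 = 5" using permutes_not_in[OF \<tau>] by simp_all
  then have "\<forall>n. (\<tau> \<circ> verts (False, i, j)) n = verts (False, \<tau> i, \<tau> j) n"
    using * unfolding forall_5 by (simp add: verts_values)
  then show "\<tau> \<circ> verts (False, i, j) = verts (False, \<tau> i, \<tau> j)" by blast
qed

lemma rho_action: "S5_action rho"
proof -
  let ?t = "Transposition.transpose :: nat \<Rightarrow> nat \<Rightarrow> nat \<Rightarrow> nat"
  have p34: "?t 3 4 permutes {1..5}" "sign (?t 3 4) = -1" by (simp_all add: permutes_swap_id sign_swap_id)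
  have p45: "?t 4 5 permutes {1..5}" "sign (?t 4 5) = -1" by (simp_all add: permutes_swap_id sign_swap_id)
  have S3: "rho \<tau> (s_form i j) = (\<lambda>x. of_int (sign \<tau>) * s_form (\<tau> i) (\<tau> j) x)"
    if "\<tau> permutes {1..3}" "(i, j) \<in> index_pairs" for \<tau> i j
  proof -
    have "\<tau> permutes {1..5}" using permutes_subset[OF that(1)] by simp
    then show ?thesis using rho_s_form[OF _ that(2)] index_pairs_permute[OF that] circ_form_tournament(1) by simp
  qed
  \<comment> \<open>A transposition contributes the sign -1. It cancels if the image of the pentagon
    is a reflection of \<open>verts s\<close>, and stays if it is a rotation, as in
    \<open>rot\<close> below; the shift a aligns the two pentagons.\<close>
  have refl: "rho \<tau> (s_form i j) = circ_form (tournament (verts s))"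
    if "\<tau> permutes {1..5}" "sign \<tau> = -1" "(i, j) \<in> index_pairs" "s \<in> sec_indices"
      "\<forall>n. \<tau> (verts (False, i, j) n) = verts s (- n + a)" for \<tau> i j s a
  proof -
    have "\<tau> \<circ> verts (False, i, j) = (\<lambda>n. verts s (- n + a))" using that(5) by (simp add: fun_eq_iff)
    then show ?thesis
      using rho_s_form[OF that(1, 3)] that(2) circ_form_reflection[OF verts_in_pentagons5[OF that(4)], of a] by simp
  qed
  have rot: "rho \<tau> (s_form i j) = (\<lambda>x. - circ_form (tournament (verts s)) x)"
    if "\<tau> permutes {1..5}" "sign \<tau> = -1" "(i, j) \<in> index_pairs" "s \<in> sec_indices"
      "\<forall>n. \<tau> (verts (False, i, j) n) = verts s (n + a)" for \<tau> i j s a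
  proof -
    have "\<tau> \<circ> verts (False, i, j) = (\<lambda>n. verts s (n + a))" using that(5) by (simp add: fun_eq_iff)
    then show ?thesis
      using rho_s_form[OF that(1, 3)] that(2) circ_form_rotation[OF verts_in_pentagons5[OF that(4)], of a] by simp
  qed
  note ip = index_pairs_mem[unfolded One_nat_def[symmetric]]
  have sec: "(b, i, j) \<in> sec_indices" if "(i, j) \<in> index_pairs" for b i j using that by simp
  have "(- 1 :: 5) = 4" "(- 2 :: 5) = 3" "(- 3 :: 5) = 2" "(- 4 :: 5) = 1" by simp_all
  note eval = this forall_5 verts_values numerals_mod_5 Transposition.transpose_def
  have "rho (?t 3 4) (s_form 1 2) = sigma_form 3 1"
    using refl[OF p34 ip(1) sec[OF ip(5), of True], of 1] circ_form_tournament(2)[OF ip(5)]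
    by (simp add: eval sign_perm3)
  moreover have "rho (?t 3 4) (s_form 1 3) = s_form 2 3"
    using refl[OF p34 ip(2) sec[OF ip(4), of False], of 3] circ_form_tournament(1)[OF ip(4)]
    by (simp add: eval)
  moreover have "rho (?t 3 4) (s_form 2 1) = - sigma_form 3 2"
    using refl[OF p34 ip(3) sec[OF ip(6), of True], of 1] circ_form_tournament(2)[OF ip(6)]
    by (simp add: eval sign_perm3 fun_eq_iff)
  moreover have "rho (?t 3 4) (s_form 2 3) = s_form 1 3"
    using refl[OF p34 ip(4) sec[OF ip(2), of False], of 3] circ_form_tournament(1)[OF ip(2)]
    by (simp add: eval)
  moreover have "rho (?t 3 4) (s_form 3 1) = - sigma_form 1 2"
    using rot[OF p34 ip(5) sec[OF ip(1), of True], of 3] circ_form_tournament(2)[OF ip(1)]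
    by (simp add: eval sign_perm3 fun_eq_iff)
  moreover have "rho (?t 3 4) (s_form 3 2) = sigma_form 2 1"
    using rot[OF p34 ip(6) sec[OF ip(3), of True], of 3] circ_form_tournament(2)[OF ip(3)]
    by (simp add: eval sign_perm3 fun_eq_iff)
  moreover have "rho (?t 4 5) (s_form i j) = s_form i (6 - i - j)" if ij: "(i, j) \<in> index_pairs" for i j
  proof -
    have ik: "(i, 6 - i - j) \<in> index_pairs" using ij unfolding index_pairs_eq by auto
    have "\<forall>n. ?t 4 5 (verts (False, i, j) n) = verts (False, i, 6 - i - j) (- n + 0)"
      using ij unfolding index_pairs_eq by (elim insertE emptyE; simp add: eval)
    then show ?thesis
      using refl[OF p45 ij sec[OF ik, of False], of 0] circ_form_tournament(1)[OF ik] by simp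
  qed
  ultimately show ?thesis
    unfolding S5_action_def using rho_group_action rho_linear S3 by (simp only: split_beta) blast
qed

section \<open>Uniqueness of the action\<close>

lemma V_forms_combination:
  assumes "P \<in> V_forms" "P' \<in> V_forms"
  shows "(\<lambda>x. a * P x + b * P' x) \<in> V_forms"
proof -
  obtain c where c: "P = form_of c" using assms(1) unfolding V_forms_eq by (rule rangeE)
  obtain d where d: "P' = form_of d" using assms(2) unfolding V_forms_eq by (rule rangeE)
  show ?thesis unfolding c d form_of_combination[symmetric] V_forms_eq by (rule rangeI)
qed

lemma s_form_in_V:
  assumes "(i, j) \<in> index_pairs"
  shows "s_form i j \<in> V_forms"
proof -
  have "(False, i, j) \<in> sec_indices" using assms by simp
  from circ_form_in_V[OF tournament_circulation[OF verts_in_pentagons5[OF this]]]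
  show ?thesis unfolding circ_form_tournament(1)[OF assms] .
qed

lemma linear_agree:
  assumes f: "\<And>P P' a b. P \<in> V_forms \<Longrightarrow> P' \<in> V_forms \<Longrightarrow> f (\<lambda>x. a * P x + b * P' x) = (\<lambda>x. a * f P x + b * f P' x)"
    and g: "\<And>P P' a b. P \<in> V_forms \<Longrightarrow> P' \<in> V_forms \<Longrightarrow> g (\<lambda>x. a * P x + b * P' x) = (\<lambda>x. a * g P x + b * g P' x)"
    and eq: "\<And>i j. (i, j) \<in> index_pairs \<Longrightarrow> f (s_form i j) = g (s_form i j)"
    and P: "P \<in> V_forms"
  shows "f P = g P"
proof -
  define S where "S = {P \<in> V_forms. f P = g P}"
  have add: "(\<lambda>x. a * P x + b * P' x) \<in> S" if P: "P \<in> S" and P': "P' \<in> S" for P P' a b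
  proof -
    have V: "P \<in> V_forms" "P' \<in> V_forms" and fg: "f P = g P" "f P' = g P'" using P P' by (simp_all add: S_def)
    have "f (\<lambda>x. a * P x + b * P' x) = g (\<lambda>x. a * P x + b * P' x)" unfolding f[OF V] g[OF V] fg ..
    then show ?thesis using V_forms_combination[OF V] by (simp add: S_def)
  qed
  have s: "s_form i j \<in> S" if ij: "(i, j) \<in> index_pairs" for i j
    using eq[OF ij] s_form_in_V[OF ij] by (simp add: S_def)
  note ip = index_pairs_mem[unfolded One_nat_def[symmetric]]
  obtain c where c: "P = form_of c" using P unfolding V_forms_eq by (rule rangeE)
  note 1 = add[OF s[OF ip(1)] s[OF ip(2)], of "c $ 1" "c $ 2"]
  note 2 = add[OF s[OF ip(3)] s[OF ip(4)], of "c $ 3" "c $ 4"]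
  note 3 = add[OF s[OF ip(5)] s[OF ip(6)], of "c $ 5" "c $ 6"]
  have "P = (\<lambda>x. 1 * (c $ 1 * s_form 1 2 x + c $ 2 * s_form 1 3 x) + 1 * (1 * (c $ 3 * s_form 2 1 x + c $ 4 * s_form 2 3 x)
      + 1 * (c $ 5 * s_form 3 1 x + c $ 6 * s_form 3 2 x)))"
    unfolding c by (simp add: fun_eq_iff form_of_eq)
  also have "\<dots> \<in> S" by (rule add[OF 1 add[OF 2 3]])
  finally show ?thesis by (simp add: S_def)
qed

text \<open>The permutations on which the two actions agree are closed under composition and contain
  the prescribed generators. Conjugating (3,4) and (4,5) by transpositions already obtained gives
  every transposition.\<close>

lemma S5_action_unique:
  assumes r: "S5_action r" and r': "S5_action r'" and \<tau>: "\<tau> permutes {1..5}" and P: "P \<in> V_forms"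
  shows "r \<tau> P = r' \<tau> P"
proof -
  let ?t = "Transposition.transpose :: nat \<Rightarrow> nat \<Rightarrow> nat \<Rightarrow> nat"
  define G where "G = {\<tau>. \<tau> permutes {1..5} \<and> (\<forall>P\<in>V_forms. r \<tau> P = r' \<tau> P)}"
  interpret r: group_action "sym_group 5" V_forms r using r by (simp add: S5_action_def)
  interpret r': group_action "sym_group 5" V_forms r' using r' by (simp add: S5_action_def)
  have comp: "\<sigma> \<circ> \<tau> \<in> G" if "\<sigma> \<in> G" "\<tau> \<in> G" for \<sigma> \<tau>
  proof -
    have st: "\<sigma> permutes {1..5}" "\<tau> permutes {1..5}" using that by (auto simp: G_def)
    have "r (\<sigma> \<circ> \<tau>) P = r' (\<sigma> \<circ> \<tau>) P" if P: "P \<in> V_forms" for P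
    proof -
      have "r (\<sigma> \<circ> \<tau>) P = r \<sigma> (r \<tau> P)" "r' (\<sigma> \<circ> \<tau>) P = r' \<sigma> (r' \<tau> P)"
        using r.composition_rule[OF P, of \<sigma> \<tau>] r'.composition_rule[OF P, of \<sigma> \<tau>] st
        by (simp_all add: sym_group_mult sym_group_carrier)
      moreover have "r \<tau> P \<in> V_forms" using r.element_image[OF _ P refl] st by (simp add: sym_group_carrier)
      ultimately show ?thesis using \<open>\<sigma> \<in> G\<close> \<open>\<tau> \<in> G\<close> P by (simp add: G_def)
    qed
    then show ?thesis using permutes_compose[OF st(2, 1)] by (simp add: G_def)
  qed
  have gen: "\<tau> \<in> G" if t: "\<tau> permutes {1..5}" and e: "\<And>i j. (i, j) \<in> index_pairs \<Longrightarrow> r \<tau> (s_form i j) = r' \<tau> (s_form i j)" for \<tau>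
  proof -
    have c: "\<tau> \<in> carrier (sym_group 5)" using t by (simp add: sym_group_carrier)
    have lin: "r \<tau> (\<lambda>x. a * P x + b * P' x) = (\<lambda>x. a * r \<tau> P x + b * r \<tau> P' x)"
      "r' \<tau> (\<lambda>x. a * P x + b * P' x) = (\<lambda>x. a * r' \<tau> P x + b * r' \<tau> P' x)"
      if "P \<in> V_forms" "P' \<in> V_forms" for P P' a b
      using r r' c that unfolding S5_action_def by blast+
    have "r \<tau> P = r' \<tau> P" if "P \<in> V_forms" for P
      using lin e that by (rule linear_agree[where f = "r \<tau>" and g = "r' \<tau>"])
    then show ?thesis using t by (simp add: G_def)
  qed
  have S3: "\<tau> \<in> G" if t: "\<tau> permutes {1..3}" for \<tau>
  proof (rule gen)
    show "\<tau> permutes {1..5}" by (rule permutes_subset[OF t]) simp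
    fix i j assume "(i, j) \<in> index_pairs"
    then show "r \<tau> (s_form i j) = r' \<tau> (s_form i j)" using r r' t unfolding S5_action_def by fastforce
  qed
  have T34: "?t 3 4 \<in> G"
  proof (rule gen)
    show "?t 3 4 permutes {1..5}" by (simp add: permutes_swap_id)
    fix i j :: nat assume "(i, j) \<in> index_pairs"
    then show "r (?t 3 4) (s_form i j) = r' (?t 3 4) (s_form i j)"
      using r r' unfolding S5_action_def index_pairs_eq by (elim conjE insertE emptyE) simp_all
  qed
  have T45: "?t 4 5 \<in> G"
  proof (rule gen)
    show "?t 4 5 permutes {1..5}" by (simp add: permutes_swap_id)
    fix i j :: nat assume "(i, j) \<in> index_pairs"
    then show "r (?t 4 5) (s_form i j) = r' (?t 4 5) (s_form i j)"
      using r r' unfolding S5_action_def by fastforce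
  qed
  have T3: "?t a b \<in> G" if "a \<in> {1..3}" "b \<in> {1..3}" for a b
    using that by (intro S3 permutes_swap_id)
  have T4: "?t a 4 \<in> G" if "a \<in> {1..3}" for a
  proof (cases "a = 3")
    case False
    then have "?t a 3 \<circ> ?t 3 4 \<circ> ?t a 3 = ?t a 4" using that by (intro transpose_comp_triple) auto
    moreover have "?t a 3 \<in> G" using T3 that by simp
    ultimately show ?thesis using comp T34 by metis
  qed (simp add: T34)
  have T5: "?t a 5 \<in> G" if "a \<in> {1..4}" for a
  proof (cases "a = 4")
    case False
    then have a: "a \<in> {1..3}" using that by auto
    then have "?t a 4 \<circ> ?t 4 5 \<circ> ?t a 4 = ?t a 5" by (intro transpose_comp_triple) auto
    then show ?thesis using comp T45 T4[OF a] by metis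
  qed (simp add: T45)
  have T: "?t a b \<in> G" if ab: "a \<in> {1..5}" "b \<in> {1..5}" "a \<noteq> b" for a b
  proof -
    consider "a \<in> {1..3}" "b \<in> {1..3}" | "a \<in> {1..3}" "b = 4" | "b \<in> {1..3}" "a = 4" | "a \<in> {1..4}" "b = 5" | "b \<in> {1..4}" "a = 5"
      using ab by (simp; arith)
    then show ?thesis using T3 T4 T5 by cases (metis transpose_commute)+
  qed
  have "\<tau> \<in> G" using \<tau> finite_atLeastAtMost
  proof (induction rule: permutes_induct)
    case id
    show ?case by (rule S3) (rule permutes_id)
  next
    case (swap a b p)
    then show ?case using comp T by blast
  qed
  then show ?thesis using P by (simp add: G_def)
qed

section \<open>Transitivity and stabilizers\<close>

definition relabel :: "(5 \<Rightarrow> nat) \<Rightarrow> (5 \<Rightarrow> nat) \<Rightarrow> nat \<Rightarrow> nat" where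
  "relabel p q = (\<lambda>x. if x \<in> {1..5} then q (inv_into UNIV p x) else x)"

lemma relabel:
  assumes "p \<in> pentagons5" "q \<in> pentagons5"
  shows "relabel p q permutes {1..5}" "relabel p q \<circ> p = q"
proof -
  have p: "inj p" "range p = {1..5}" and q: "inj q" "range q = {1..5}" using assms by (auto simp: pentagons5_def)
  have "p n \<in> {1..5}" for n using p(2) by blast
  then have rp: "relabel p q (p n) = q n" for n using p(1) by (simp add: relabel_def del: atLeastAtMost_iff)
  then show *: "relabel p q \<circ> p = q" by (simp add: fun_eq_iff)
  show "relabel p q permutes {1..5}"
  proof (rule bij_imp_permutes)
    show "bij_betw (relabel p q) {1..5} {1..5}"
    proof (rule bij_betw_imageI)
      show "relabel p q ` {1..5} = {1..5}" unfolding p(2)[symmetric] image_image rp using q(2) p(2) by simp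
      show "inj_on (relabel p q) {1..5}"
      proof (rule inj_onI)
        fix x y assume xy: "x \<in> {1..5}" "y \<in> {1..5}" "relabel p q x = relabel p q y"
        then obtain m n where "x = p m" "y = p n" using pentagons5_cases[OF assms(1)] by metis
        then show "x = y" using xy(3) rp inj_eq[OF q(1)] by simp
      qed
    qed
    show "relabel p q x = x" if "x \<notin> {1..5}" for x using that by (simp only: relabel_def if_False)
  qed
qed

lemma permutes_eqI:
  assumes "\<sigma> permutes {1..5}" "\<tau> permutes {1..5}" "p \<in> pentagons5" "\<sigma> \<circ> p = \<tau> \<circ> p"
  shows "\<sigma> = \<tau>"
proof
  fix x show "\<sigma> x = \<tau> x"
  proof (cases "x \<in> {1..5}")
    case True
    then obtain n where "x = p n" using pentagons5_cases[OF assms(3)] by blast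
    then show ?thesis using fun_cong[OF assms(4), of n] by simp
  qed (use permutes_not_in[OF assms(1)] permutes_not_in[OF assms(2)] in simp)
qed

lemma sign_square:
  assumes "\<pi> permutes {1..5::nat}"
  shows "sign (\<pi> \<circ> \<pi>) = 1"
proof -
  have "permutation \<pi>" using assms permutation_permutes by blast
  then have "sign (\<pi> \<circ> \<pi>) = sign \<pi> * sign \<pi>" by (rule sign_compose) fact
  then show ?thesis by (simp add: sign_def)
qed

text \<open>The affine maps of \<open>\<int>/5\<close> with linear part \<open>1\<close> or \<open>-1\<close> are squares of affine maps, because
  \<open>-1 = 2\<^sup>2\<close>.\<close>

lemma affine_even:
  assumes \<tau>: "\<tau> permutes {1..5}" and p: "p \<in> pentagons5"
    and e: "\<tau> \<circ> p = (\<lambda>i. p (i + a)) \<or> \<tau> \<circ> p = (\<lambda>i. p (- i + a))"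
  shows "sign \<tau> = 1"
proof -
  have sq: "sign \<tau> = 1" if c: "c = 1 \<or> c = 2" and g: "\<tau> \<circ> p = (\<lambda>i. p (c * (c * i + d) + d))" for c d
  proof -
    have ip: "inj p" and rp: "range p = {1..5}" using p by (auto simp: pentagons5_def)
    have q: "(\<lambda>i. p (c * i + d)) \<in> pentagons5"
    proof (rule pentagons5_I)
      show "inj (\<lambda>i. p (c * i + d))"
      proof (rule injI)
        fix x y assume "p (c * x + d) = p (c * y + d)"
        then have "c * x = c * y" using inj_eq[OF ip] by simp
        then show "x = y"
        proof (cases "c = 1")
          case False
          then have "3 * (2 * x) = 3 * (2 * y)" using c \<open>c * x = c * y\<close> by simp
          then show ?thesis by (simp add: mult.assoc[symmetric] numerals_mod_5)
        qed simp
      qed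
      show "range (\<lambda>i. p (c * i + d)) \<subseteq> {1..5}" using rp by blast
    qed
    define \<pi> where "\<pi> = relabel p (\<lambda>i. p (c * i + d))"
    have \<pi>: "\<pi> permutes {1..5}" and "\<pi> \<circ> p = (\<lambda>i. p (c * i + d))" unfolding \<pi>_def by (rule relabel[OF p q])+
    then have "\<pi> (p n) = p (c * n + d)" for n by (metis comp_apply)
    then have "(\<pi> \<circ> \<pi>) \<circ> p = \<tau> \<circ> p" unfolding g by (simp add: fun_eq_iff)
    then have "\<pi> \<circ> \<pi> = \<tau>" by (rule permutes_eqI[OF permutes_compose[OF \<pi> \<pi>] \<tau> p])
    then show ?thesis using sign_square[OF \<pi>] by simp
  qed
  from e show ?thesis
  proof
    assume g: "\<tau> \<circ> p = (\<lambda>i. p (i + a))"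
    have "1 * (1 * i + 3 * a) + 3 * a = i + 6 * a" for i by (simp add: algebra_simps)
    then have "1 * (1 * i + 3 * a) + 3 * a = i + a" for i by (simp only: numerals_mod_5 mult_1)
    then have "\<tau> \<circ> p = (\<lambda>i. p (1 * (1 * i + 3 * a) + 3 * a))" unfolding g by presburger
    then show ?thesis by (rule sq[rotated]) simp
  next
    assume g: "\<tau> \<circ> p = (\<lambda>i. p (- i + a))"
    have "2 * (2 * i + 2 * a) + 2 * a = - i + a" for i :: 5
    proof -
      have "2 * (2 * i + 2 * a) + 2 * a = 4 * i + 6 * a" by (simp add: algebra_simps)
      also have "(4 :: 5) = - 1" by simp
      finally show ?thesis by (simp only: numerals_mod_5 mult_1 mult_minus1)
    qed
    then have "\<tau> \<circ> p = (\<lambda>i. p (2 * (2 * i + 2 * a) + 2 * a))" unfolding g by presburger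
    then show ?thesis by (rule sq[rotated]) simp
  qed
qed

text \<open>Relabelling p as q gives the tournament of q up to the sign of the relabelling. If the
  sign is -1, the target is replaced by a reflection of q: this composes the relabelling with an
  even permutation, so the sign stays -1, and it negates the tournament.\<close>

lemma act_transitive:
  assumes p: "p \<in> pentagons5" and q: "q \<in> pentagons5"
  shows "\<exists>\<tau>. \<tau> permutes {1..5} \<and> act \<tau> (tournament p) = tournament q"
proof (cases "sign (relabel p q) = 1")
  case True
  then show ?thesis using act_tournament[OF relabel(1)[OF p q] p] relabel[OF p q] by (intro exI[of _ "relabel p q"]) simp
next
  case False
  then have s: "sign (relabel p q) = -1" by (simp add: sign_def split: if_splits)
  define q' where "q' = (\<lambda>i. q (- i + 0))"
  have q': "q' \<in> pentagons5" unfolding q'_def by (rule tournament_affine(3)[OF q])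
  have "relabel q q' \<circ> relabel p q = relabel p q'"
    using relabel[OF p q] relabel[OF q q'] relabel[OF p q']
    by (intro permutes_eqI[OF _ _ p]) (auto simp: comp_assoc intro: permutes_compose)
  moreover have "permutation (relabel q q')" "permutation (relabel p q)"
    using relabel(1) p q q' permutation_permutes by blast+
  moreover have "sign (relabel q q') = 1"
    by (rule affine_even[OF relabel(1)[OF q q'] q, of 0], rule disjI2, unfold relabel(2)[OF q q'], rule q'_def)
  ultimately have "sign (relabel p q') = -1" using s sign_compose by (metis mult_1)
  then have "act (relabel p q') (tournament p) = (\<lambda>x y. - tournament q' x y)"
    using act_tournament[OF relabel(1)[OF p q'] p] relabel(2)[OF p q'] by simp
  also have "\<dots> = tournament q" using tournament_affine(4)[OF q, of 0] by (simp add: q'_def fun_eq_iff)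
  finally show ?thesis using relabel(1)[OF p q'] by blast
qed

text \<open>An odd permutation in the stabilizer would send p to a rotation of its reflection, but
  reflections are even by \<open>affine_even\<close>. For an even one,
  \<open>tournament_inject\<close> leaves only the rotations.\<close>

lemma act_stabilizer:
  assumes \<tau>: "\<tau> permutes {1..5}" and p: "p \<in> pentagons5"
  shows "act \<tau> (tournament p) = tournament p \<longleftrightarrow> (\<exists>a. \<tau> \<circ> p = (\<lambda>i. p (i + a)))"
proof
  assume "\<exists>a. \<tau> \<circ> p = (\<lambda>i. p (i + a))"
  then obtain a where a: "\<tau> \<circ> p = (\<lambda>i. p (i + a))" by blast
  then have "sign \<tau> = 1" using affine_even[OF \<tau> p] by blast
  then show "act \<tau> (tournament p) = tournament p"
    using act_tournament[OF \<tau> p] a tournament_affine(2)[OF p] by simp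
next
  assume eq: "act \<tau> (tournament p) = tournament p"
  note tp = permutes_pentagon[OF \<tau> p]
  show "\<exists>a. \<tau> \<circ> p = (\<lambda>i. p (i + a))"
  proof (cases "sign \<tau> = 1")
    case True
    then have "tournament p = tournament (\<tau> \<circ> p)" using act_tournament[OF \<tau> p] eq by simp
    then show ?thesis by (rule tournament_inject[OF p tp])
  next
    case False
    then have "sign \<tau> = -1" by (simp add: sign_def split: if_splits)
    then have "tournament p x y = - tournament (\<tau> \<circ> p) x y" for x y using fun_cong[OF fun_cong[OF trans[OF eq[symmetric] act_tournament[OF \<tau> p]]], of x y] by simp
    then have "tournament (\<lambda>i. p (- i + 0)) = tournament (\<tau> \<circ> p)"
      using tournament_affine(4)[OF p, of 0] by (simp add: fun_eq_iff)
    then obtain a where "\<tau> \<circ> p = (\<lambda>i. p (- (i + a) + 0))"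
      using tournament_inject[OF tournament_affine(3)[OF p] tp] by blast
    then have "\<tau> \<circ> p = (\<lambda>i. p (- i + (- a)))" by simp
    then have "sign \<tau> = 1" using affine_even[OF \<tau> p] by blast
    then show ?thesis using False by blast
  qed
qed

text \<open>Each pentagon is a rotation or a reflection of some \<open>verts s\<close>; the first
  keeps the tournament and the second negates it. The sign in \<open>circ_form_tournament\<close> is
  absorbed because both sets are closed under negation.\<close>

lemma signed_sections_eq: "signed_sections = (\<lambda>p. circ_form (tournament p)) ` pentagons5"
proof
  let ?X = "(\<lambda>p. circ_form (tournament p)) ` pentagons5"
  have neg: "- P \<in> ?X" if P: "P \<in> ?X" for P
  proof -
    obtain p where p: "p \<in> pentagons5" "P = circ_form (tournament p)" using P by blast
    have "tournament (\<lambda>i. p (- i + 0)) = (\<lambda>x y. (-1) * tournament p x y)"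
      using tournament_affine(4)[OF p(1), of 0] by (simp add: fun_eq_iff)
    then have "- P = circ_form (tournament (\<lambda>i. p (- i + 0)))" unfolding p(2) by (simp only: circ_form_scale) (simp add: fun_eq_iff)
    then show ?thesis using tournament_affine(3)[OF p(1), of 0] by blast
  qed
  have s: "sec s \<in> ?X \<or> - sec s \<in> ?X" and t: "circ_form (tournament (verts s)) \<in> signed_sections" if s: "s \<in> sec_indices" for s
  proof -
    obtain b i j where bij: "s = (b, i, j)" by (metis prod_cases3)
    then have ij: "(i, j) \<in> index_pairs" using s by simp
    have "circ_form (tournament (verts s)) = sec s \<or> circ_form (tournament (verts s)) = - sec s"
      using circ_form_tournament[OF ij] sign_perm3_cases[OF ij] unfolding bij by (cases b) (auto simp: fun_eq_iff)
    then show "sec s \<in> ?X \<or> - sec s \<in> ?X" "circ_form (tournament (verts s)) \<in> signed_sections"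
      using verts_in_pentagons5[OF s] s unfolding signed_sections_def sections_eq by (metis image_eqI, blast)
  qed
  have mm: "- (- P) = P" for P :: form by (simp add: fun_eq_iff)
  have sX: "sec s \<in> ?X" if "s \<in> sec_indices" for s
    using s[OF that] neg[of "- sec s"] unfolding mm by blast
  have neg': "- P \<in> signed_sections" if "P \<in> signed_sections" for P
    using that mm unfolding signed_sections_def by force
  show "signed_sections \<subseteq> ?X"
  proof
    fix P assume "P \<in> signed_sections"
    then consider s where "s \<in> sec_indices" "P = sec s" | s where "s \<in> sec_indices" "P = - sec s"
      unfolding signed_sections_def sections_eq by blast
    then show "P \<in> ?X" by cases (use sX neg in simp_all)
  qed
  show "?X \<subseteq> signed_sections"
  proof
    fix P assume "P \<in> ?X"
    then obtain p where p: "p \<in> pentagons5" "P = circ_form (tournament p)" by blast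
    then obtain s where s: "s \<in> sec_indices" "verts s \<in> pentagon_class p"
      using pentagon_is_verts[of p] by (auto simp: pentagons5_def)
    then obtain e a where e: "e = 1 \<or> e = -1" "verts s = (\<lambda>i. p (e * i + a))" by (auto simp: pentagon_class_def)
    have "circ_form (tournament (verts s)) = P \<or> circ_form (tournament (verts s)) = - P"
    proof (cases "e = 1")
      case True
      then show ?thesis using e(2) p tournament_affine(2)[OF p(1)] by simp
    next
      case False
      then have v: "verts s = (\<lambda>i. p (- i + a))" using e by simp
      have "tournament (verts s) = (\<lambda>x y. (-1) * tournament p x y)"
        unfolding v by (intro ext) (simp only: tournament_affine(4)[OF p(1)] mult_minus1)
      then show ?thesis unfolding p(2) by (simp only: circ_form_scale) (simp add: fun_eq_iff)
    qed
    then show "P \<in> signed_sections" using t[OF s(1)] neg'[of "- P"] unfolding mm by auto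
  qed
qed

text \<open>The pentagon of \<open>s_form 2 1\<close> is 2, 4, 1, 3, 5, in which the successor of
  each label modulo 5 stands three places further on.\<close>

lemma five_cycle:
  "cycle_of_list [1, 2, 3, 4, 5 :: nat] permutes {1..5}"
  "cycle_of_list [1, 2, 3, 4, 5] \<circ> verts (False, 2, 1) = (\<lambda>i. verts (False, 2, 1) (i + 3))"
proof -
  have "cycle_of_list [1, 2, 3, 4, 5 :: nat] permutes set [1, 2, 3, 4, 5]" by (rule cycle_permutes)
  then show "cycle_of_list [1, 2, 3, 4, 5 :: nat] permutes {1..5}" by (rule permutes_subset) auto
  have "\<forall>i. (cycle_of_list [1, 2, 3, 4, 5] \<circ> verts (False, 2, 1)) i = verts (False, 2, 1) (i + 3)"
    unfolding forall_5 by (simp add: verts_values numerals_mod_5 Transposition.transpose_def)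
  then show "cycle_of_list [1, 2, 3, 4, 5] \<circ> verts (False, 2, 1) = (\<lambda>i. verts (False, 2, 1) (i + 3))" by blast
qed

lemma rotation_in_generate:
  assumes \<tau>: "\<tau> permutes {1..5}" and a: "\<tau> \<circ> p = (\<lambda>i. p (i + a))" and p: "p \<in> pentagons5"
    and c: "c permutes {1..5}" "c \<circ> p = (\<lambda>i. p (i + 3))"
  shows "\<tau> \<in> generate (sym_group 5) {c}"
proof -
  let ?G = "generate (sym_group 5) {c}"
  have cp: "c (p i) = p (i + 3)" for i using fun_cong[OF c(2), of i] by simp
  have g1: "c \<in> ?G" by (rule generate.incl) simp
  have gm: "\<sigma> \<circ> \<tau> \<in> ?G" if "\<sigma> \<in> ?G" "\<tau> \<in> ?G" for \<sigma> \<tau>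
    using generate.eng[OF that] by (simp add: sym_group_mult)
  have id: "id \<in> ?G" using generate.one[of "sym_group 5"] by (simp add: sym_group_one)
  have power: "c ^^ n \<in> ?G \<and> c ^^ n permutes {1..5} \<and> (\<forall>i. (c ^^ n) (p i) = p (i + of_nat n * 3))" for n
  proof (induction n)
    case 0
    show ?case
    proof (intro conjI allI)
      show "c ^^ 0 \<in> ?G" using id by (simp only: funpow.simps(1))
      show "c ^^ 0 permutes {1..5}" by (simp only: funpow.simps(1) permutes_id)
      show "(c ^^ 0) (p i) = p (i + of_nat 0 * 3)" for i by simp
    qed
  next
    case (Suc n)
    have S: "c ^^ Suc n = c \<circ> c ^^ n" by simp
    have "(c ^^ Suc n) (p i) = p (i + of_nat (Suc n) * 3)" for i
      using Suc cp by (simp add: algebra_simps)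
    then show ?case using Suc gm[OF g1] permutes_compose[OF _ c(1)] unfolding S by blast
  qed
  \<comment> \<open>3 is invertible modulo 5, so the powers of c realize every rotation.\<close>
  have "\<exists>n. of_nat n * 3 = a"
  proof -
    have "of_nat 0 * 3 = (0::5)" "of_nat 2 * 3 = (1::5)" "of_nat 4 * 3 = (2::5)" "of_nat 1 * 3 = (3::5)" "of_nat 3 * 3 = (4::5)"
      by simp_all
    then show ?thesis using exhaust_5[of a] by metis
  qed
  then obtain n where "of_nat n * 3 = a" by blast
  then have "\<tau> \<circ> p = c ^^ n \<circ> p" using power[of n] a by (simp add: fun_eq_iff)
  then have "\<tau> = c ^^ n" by (rule permutes_eqI[OF \<tau> _ p, rotated]) (use power in blast)
  then show ?thesis using power by blast
qed

text \<open>By uniqueness the given action agrees with \<open>rho\<close> on \<open>V_forms\<close>,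
  so every claim can be checked with \<open>act\<close> on tournaments.\<close>

lemma S5_action_properties:
  assumes r: "S5_action r"
  shows "signed_sections \<in> orbits (sym_group 5) V_forms r"
    "stabilizer (sym_group 5) r (s_form 2 1) = generate (sym_group 5) {cycle_of_list [1, 2, 3, 4, 5]}"
    "\<forall>x\<in>signed_sections. \<forall>y\<in>signed_sections. \<exists>!\<tau>. \<tau> \<in> carrier (sym_group 5) \<and> \<tau> 5 = 5 \<and> r \<tau> x = y"
proof -
  interpret r: group_action "sym_group 5" V_forms r using r by (simp add: S5_action_def)
  have car: "\<tau> \<in> carrier (sym_group 5) \<longleftrightarrow> \<tau> permutes {1..5}" for \<tau> by (rule sym_group_carrier)
  have rA: "r \<tau> (circ_form A) = circ_form (act \<tau> A)" if "\<tau> permutes {1..5}" "A \<in> circulations" for \<tau> A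
    using S5_action_unique[OF r rho_action that(1) circ_form_in_V[OF that(2)]] rho_circ_form[OF that(2)] by simp
  have rT: "r \<tau> (circ_form (tournament p)) = circ_form (tournament q) \<longleftrightarrow> act \<tau> (tournament p) = tournament q"
    if "\<tau> permutes {1..5}" "p \<in> pentagons5" "q \<in> pentagons5" for \<tau> p q
    using rA[OF that(1) tournament_circulation[OF that(2)]] tournament_circulation act_circulation that circ_form_inject by metis
  let ?p = "verts (False, 2, 1)" and ?c = "cycle_of_list [1, 2, 3, 4, 5 :: nat]"
  have p: "?p \<in> pentagons5" by (rule verts_in_pentagons5) (simp add: index_pairs_eq)
  have s21: "circ_form (tournament ?p) = s_form 2 1"
    by (rule circ_form_tournament(1)) (simp add: index_pairs_eq)
  have V: "s_form 2 1 \<in> V_forms" by (rule s_form_in_V) (simp add: index_pairs_eq)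
  have image: "r \<tau> (s_form 2 1) \<in> signed_sections" if t: "\<tau> permutes {1..5}" for \<tau>
  proof -
    \<comment> \<open>An odd permutation gives the negative of a tournament, which is again the
      tournament of a reflected pentagon.\<close>
    obtain q where q: "q \<in> pentagons5" "act \<tau> (tournament ?p) = tournament q"
    proof (cases "sign \<tau> = 1")
      case True
      then have "act \<tau> (tournament ?p) = tournament (\<tau> \<circ> ?p)" using act_tournament[OF t p] by simp
      then show thesis using that permutes_pentagon[OF t p] by blast
    next
      case False
      then have "sign \<tau> = -1" by (simp add: sign_def split: if_splits)
      then have "act \<tau> (tournament ?p) = tournament (\<lambda>i. (\<tau> \<circ> ?p) (- i + 0))"
        unfolding act_tournament[OF t p] by (intro ext) (simp only: tournament_affine(4)[OF permutes_pentagon[OF t p]], simp)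
      then show thesis using that tournament_affine(3)[OF permutes_pentagon[OF t p]] by blast
    qed
    then have "r \<tau> (s_form 2 1) = circ_form (tournament q)" using rT[OF t p] s21 by metis
    then show ?thesis unfolding signed_sections_eq using q(1) by blast
  qed
  have "signed_sections = orbit (sym_group 5) r (s_form 2 1)"
  proof
    show "orbit (sym_group 5) r (s_form 2 1) \<subseteq> signed_sections" using image car by (auto simp: orbit_def)
    show "signed_sections \<subseteq> orbit (sym_group 5) r (s_form 2 1)"
    proof
      fix P assume "P \<in> signed_sections"
      then obtain q where q: "q \<in> pentagons5" "P = circ_form (tournament q)" unfolding signed_sections_eq by blast
      obtain \<tau> where t: "\<tau> permutes {1..5}" "act \<tau> (tournament ?p) = tournament q" using act_transitive[OF p q(1)] by blast
      then have "r \<tau> (s_form 2 1) = P" using rT[OF t(1) p q(1)] s21 q(2) by metis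
      then show "P \<in> orbit (sym_group 5) r (s_form 2 1)" using t(1) car by (auto simp: orbit_def)
    qed
  qed
  then show "signed_sections \<in> orbits (sym_group 5) V_forms r" using V by (auto simp: orbits_def)
  have stab: "\<tau> \<in> stabilizer (sym_group 5) r (s_form 2 1) \<longleftrightarrow> \<tau> permutes {1..5} \<and> (\<exists>a. \<tau> \<circ> ?p = (\<lambda>i. ?p (i + a)))" for \<tau>
    using rT[OF _ p p, of \<tau>] act_stabilizer[OF _ p, of \<tau>] car[of \<tau>] s21 unfolding stabilizer_def by auto
  show "stabilizer (sym_group 5) r (s_form 2 1) = generate (sym_group 5) {?c}"
  proof
    show "stabilizer (sym_group 5) r (s_form 2 1) \<subseteq> generate (sym_group 5) {?c}"
      using stab rotation_in_generate[OF _ _ p five_cycle] by blast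
    have "?c \<in> stabilizer (sym_group 5) r (s_form 2 1)" using stab five_cycle by blast
    then show "generate (sym_group 5) {?c} \<subseteq> stabilizer (sym_group 5) r (s_form 2 1)"
      using group.generate_subgroup_incl[OF sym_group_is_group _ r.stabilizer_subgroup[OF V]] by blast
  qed
  show "\<forall>x\<in>signed_sections. \<forall>y\<in>signed_sections. \<exists>!\<tau>. \<tau> \<in> carrier (sym_group 5) \<and> \<tau> 5 = 5 \<and> r \<tau> x = y"
  proof (intro ballI)
    fix x y assume "x \<in> signed_sections" "y \<in> signed_sections"
    then obtain p q where p: "p \<in> pentagons5" "x = circ_form (tournament p)" and q: "q \<in> pentagons5" "y = circ_form (tournament q)"
      unfolding signed_sections_eq by blast
    have rxy: "r \<tau> x = y \<longleftrightarrow> act \<tau> (tournament p) = tournament q" if "\<tau> permutes {1..5}" for \<tau>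
      unfolding p(2) q(2) by (rule rT[OF that p(1) q(1)])
    have "(5::nat) \<in> {1..5}" by simp
    then obtain m where m: "p m = 5" using pentagons5_cases[OF p(1)] by metis
    have ip: "inj p" using p(1) by (simp add: pentagons5_def)
    obtain \<sigma> where \<sigma>: "\<sigma> permutes {1..5}" "act \<sigma> (tournament p) = tournament q" using act_transitive[OF p(1) q(1)] by blast
    have "(5::nat) \<in> {1..5}" by simp
    then obtain n where n: "(\<sigma> \<circ> p) n = 5" using pentagons5_cases[OF permutes_pentagon[OF \<sigma>(1) p(1)]] by metis
    \<comment> \<open>The permutation \<sigma> carries x to y but may move 5. Precomposing it with
      the rotation of p that takes the label 5 to \<open>p n\<close>, the preimage of 5 under
      \<sigma>, corrects this without changing the image of x.\<close>
    let ?q = "\<lambda>i. p (i + (n - m))"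
    note q' = tournament_affine(1)[OF p(1), of "n - m"]
    define \<pi> where "\<pi> = relabel p ?q"
    have \<pi>: "\<pi> permutes {1..5}" "\<pi> \<circ> p = ?q" unfolding \<pi>_def by (rule relabel[OF p(1) q'])+
    have "act \<pi> (tournament p) = tournament p" using act_stabilizer[OF \<pi>(1) p(1)] \<pi>(2) by blast
    then have 1: "act (\<sigma> \<circ> \<pi>) (tournament p) = tournament q" using act_compose[OF \<sigma>(1) \<pi>(1)] \<sigma>(2) by simp
    have "\<pi> (p m) = p (m + (n - m))" using \<pi>(2) by (metis comp_apply)
    then have 5: "(\<sigma> \<circ> \<pi>) 5 = 5" using n m by simp
    have ex: "\<sigma> \<circ> \<pi> \<in> carrier (sym_group 5) \<and> (\<sigma> \<circ> \<pi>) 5 = 5 \<and> r (\<sigma> \<circ> \<pi>) x = y"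
      using 1 5 rxy permutes_compose[OF \<pi>(1) \<sigma>(1)] car by blast
    \<comment> \<open>Two solutions differ by an element of the stabilizer of the tournament of p, a
      rotation; a rotation that fixes the label 5 is trivial.\<close>
    have uniq: "\<tau> = \<tau>'" if t: "\<tau> permutes {1..5}" "\<tau> 5 = 5" "act \<tau> (tournament p) = tournament q"
        and t': "\<tau>' permutes {1..5}" "\<tau>' 5 = 5" "act \<tau>' (tournament p) = tournament q" for \<tau> \<tau>'
    proof -
      let ?i = "inv_into UNIV \<tau>'"
      have i: "?i permutes {1..5}" "?i \<circ> \<tau>' = id" "\<tau>' \<circ> ?i = id" using t'(1) permutes_inv permutes_inv_o by blast+
      have c: "?i \<circ> \<tau> permutes {1..5}" by (rule permutes_compose[OF t(1) i(1)])
      have "act (?i \<circ> \<tau>) (tournament p) = act ?i (act \<tau>' (tournament p))" using act_compose[OF i(1) t(1)] t(3) t'(3) by simp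
      also have "\<dots> = tournament p" using act_compose[OF i(1) t'(1), of "tournament p"] i(2) act_id by simp
      finally obtain a where a: "(?i \<circ> \<tau>) \<circ> p = (\<lambda>i. p (i + a))" using act_stabilizer[OF c p(1)] by blast
      have "?i 5 = 5" using t'(2) i(2) by (metis comp_apply id_apply)
      then have "p (m + a) = p m" using fun_cong[OF a, of m] m t(2) by simp
      then have "a = 0" using inj_eq[OF ip] by simp
      then have "(?i \<circ> \<tau>) \<circ> p = id \<circ> p" using a by simp
      then have "?i \<circ> \<tau> = id" by (rule permutes_eqI[OF c permutes_id p(1)])
      then show ?thesis using i(3) by (metis comp_assoc comp_id id_comp)
    qed
    show "\<exists>!\<tau>. \<tau> \<in> carrier (sym_group 5) \<and> \<tau> 5 = 5 \<and> r \<tau> x = y"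
    proof (rule ex1I[of _ "\<sigma> \<circ> \<pi>"])
      fix \<tau> assume "\<tau> \<in> carrier (sym_group 5) \<and> \<tau> 5 = 5 \<and> r \<tau> x = y"
      then have "\<tau> permutes {1..5}" "\<tau> 5 = 5" "act \<tau> (tournament p) = tournament q" using car rxy by blast+
      then show "\<tau> = \<sigma> \<circ> \<pi>" using permutes_compose[OF \<pi>(1) \<sigma>(1)] 5 1 by (rule uniq)
    qed (rule ex)
  qed
qed

text \<open>The bijection of (b) stays in scope in (c), so that the double pentagons can be tied to
  the factors of the quadrics. In (d) the claims concern every action with the prescribed values,
  and the existence of one keeps them from being vacuous.\<close>

theorem proposition3p3:
  shows
    "\<comment> \<open>(a)\<close>
     card geometrical_pentagons_in_dP5 = 12 \<and> card sections = 12 \<and>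
     bij_betw reduced_divisor geometrical_pentagons_in_dP5 (divisor_of_zeros ` sections) \<and>
     (\<exists>\<Gamma>.
        \<comment> \<open>(b)\<close>
        bij_betw \<Gamma> (combinatorial_pentagons {1..5::nat}) geometrical_pentagons_in_dP5 \<and>
        (\<forall>p. inj p \<and> range p \<subseteq> {1..5} \<longrightarrow>
           reduced_divisor (\<Gamma> (pentagon_class p)) =
             (\<lambda>C. \<Sum>i\<in>UNIV. prime_divisor (E_line (p i) (p (i + 1))) C)) \<and>
        \<comment> \<open>(c)\<close>
        card quadrics = 6 \<and>
        (\<exists>\<Delta>. bij_betw \<Delta> quadrics (double_pentagons {1..5::nat}) \<and>
           (\<forall>(i, j)\<in>index_pairs. \<exists>A B. \<Delta> (quadric i j) = {A, B} \<and>
              A \<in> combinatorial_pentagons {1..5} \<and> B \<in> combinatorial_pentagons {1..5} \<and>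
              reduced_divisor (\<Gamma> A) = divisor_of_zeros (s_form i j) \<and>
              reduced_divisor (\<Gamma> B) = divisor_of_zeros (sigma_form i j)))) \<and>
     \<comment> \<open>(d)\<close>
     (\<exists>\<rho>. S5_action \<rho>) \<and>
     (\<forall>\<rho>. S5_action \<rho> \<longrightarrow>
        signed_sections \<in> orbits (sym_group 5) V_forms \<rho> \<and>
        stabilizer (sym_group 5) \<rho> (s_form 2 1) =
          generate (sym_group 5) {cycle_of_list [1, 2, 3, 4, 5]} \<and>
        (\<forall>x\<in>signed_sections. \<forall>y\<in>signed_sections.
           \<exists>!\<tau>. \<tau> \<in> carrier (sym_group 5) \<and> \<tau> 5 = 5 \<and> \<rho> \<tau> x = y))"
  by (intro conjI exI[of _ pent_to_geom])
    (rule card_geometrical card_sections reduced_divisor_bij pent_to_geom_bij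
      conjunct1[OF quadrics_double_pentagons] conjunct2[OF quadrics_double_pentagons]
    | (rule exI, rule rho_action)
    | (intro allI impI, elim conjE, rule pent_to_geom_divisor; assumption)
    | (intro allI impI conjI; rule S5_action_properties; assumption))+

end
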